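(* Let $n,m,k\in \mathbb{Z}_+$ be such that $k\leq m$ and $k<n$ and define the following linear map of rank $k$: $$f:\mathbb{R}^m\rightarrow \mathbb{R}^n,\quad f(x_1,\ldots,x_m)=(x_1,\ldots,x_k,0,\ldots,0).$$ (i) The map $f^*:\mathcal{C}^{\infty}(\mathbb{R}^n)\rightarrow \mathcal{C}^{\infty}(\mathbb{R}^m)$, $f^*u=u\circ f$, does not extend to a continuous mapping $f^*:H^{r_2}_{\mathrm{loc}}(\mathbb{R}^n)\rightarrow\mathcal{D}'(\mathbb{R}^m)$ for any $r_2<(n-k)/2$. (ii) The map $f^*:\mathcal{C}^{\infty}(\mathbb{R}^n)\rightarrow \mathcal{C}^{\infty}(\mathbb{R}^m)$ does not extend to a continuous mapping $f^*:H^{r_2}_{\mathrm{loc}}(\mathbb{R}^n)\rightarrow\mathcal{D}'^{r_1}_{\widetilde{L}}(\mathbb{R}^m)$ if $r_2-r_1<(n-k)/2$ for any closed conic subset $\widetilde{L}$ of $\mathbb{R}^m\times (\mathbb{R}^m\backslash\{0\})$ which satisfies $$\left(\{0_m\}\times ((\mathbb{R}^k\times\{0_{m-k}\})\backslash\{0_m\})\right)\backslash \widetilde{L}\neq \emptyset.$$ In particular, $f^*$ does not extend to a continuous mapping $f^*:\mathcal{D}'^{r_2}_L(\mathbb{R}^n)\rightarrow\mathcal{D}'^{r_1}_{f^*L}(\mathbb{R}^m)$ if $r_2-r_1<(n-k)/2$ for any closed conic subset $L$ of $\mathbb{R}^n\times (\mathbb{R}^n\backslash\{0\})$ which satisfies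 $L\cap \mathcal{N}_f=\emptyset$ and $\left(\{0_n\}\times (\{\eta'_0\}\times\mathbb{R}^{n-k})\right)\cap L= \emptyset$ for some $\eta'_0\in\mathbb{R}^k\backslash\{0\}$.
   Context: $0_q$ denotes the zero of $\mathbb{R}^q$. $\mathcal{F}g(\xi)=\int e^{-ix\xi}g(x)dx$, $\langle\xi\rangle=(1+|\xi|^2)^{1/2}$; $\mathcal{D}(U)$ is the space of smooth compactly supported functions on $U$. $H^r_{\mathrm{loc}}(\mathbb{R}^n)$ is the local Sobolev space of order $r$. A subset $L$ of $U\times(\mathbb{R}^q\backslash\{0\})$ ($U\subseteq\mathbb{R}^q$ open) is conic if $(x,\xi)\in L$, $t>0$ imply $(x,t\xi)\in L$. For $u\in\mathcal{D}'(U)$ and $r\in\mathbb{R}$, $(x,\xi)\in U\times(\mathbb{R}^q\backslash\{0\})$ is not in the Sobolev wave front set $WF^r(u)$ iff there are an open cone $V\ni\xi$ and $\varphi\in\mathcal{D}(U)$ with $\varphi(x)\neq0$ such that $\int_V|\mathcal{F}(\varphi u)(\eta)|^2\langle\eta\rangle^{2r}d\eta<\infty$. For a closed conic $L$, $\mathcal{D}'^r_L(U):=\{u\in\mathcal{D}'(U)\,|\,WF^r(u)\subseteq L\}$ with the locally convex topology given by all continuous seminorms on $\mathcal{D}'(U)$ (strong dual topology) together with all seminorms $\mathfrak{p}_{r;\varphi,V}(u):=\big(\int_V|\mathcal{F}(\varphi u)(\xi)|^2\langle\xi\rangle^{2r}d\xi\big)^{1/2}$, $\varphi\in\mathcal{D}(U)$,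 $V\subseteq\mathbb{R}^q$ a closed cone with $(\operatorname{supp}\varphi\times V)\cap L=\emptyset$. For the smooth map $f:\mathbb{R}^m\to\mathbb{R}^n$: $\mathcal{N}_f:=\{(f(x),\eta)\in\mathbb{R}^n\times\mathbb{R}^n\,|\,x\in\mathbb{R}^m,\ {}^tf'(x)\eta=0\}$ and $f^*L:=\{(x,{}^tf'(x)\eta)\,|\,(f(x),\eta)\in L\}$ (a closed conic subset of $\mathbb{R}^m\times(\mathbb{R}^m\backslash\{0\})$ when $L\cap\mathcal{N}_f=\emptyset$). *)

theory Defs
  imports "HOL-Analysis.Analysis"
begin

section \<open>Smooth functions and test functions on Euclidean space\<close>

definition partial_deriv :: "'n::finite \<Rightarrow> (real^'n \<Rightarrow> complex) \<Rightarrow> real^'n \<Rightarrow> complex" where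
  "partial_deriv i g x = frechet_derivative g (at x) (axis i 1)"

text \<open>A multi-index is encoded as the list of the coordinates to be differentiated.\<close>

fun iter_partial :: "'n::finite list \<Rightarrow> (real^'n \<Rightarrow> complex) \<Rightarrow> real^'n \<Rightarrow> complex" where
  "iter_partial [] g = g"
| "iter_partial (i # js) g = partial_deriv i (iter_partial js g)"

definition smooth :: "(real^'n::finite \<Rightarrow> complex) \<Rightarrow> bool" where
  "smooth g \<longleftrightarrow> (\<forall>js x. iter_partial js g differentiable (at x))"

definition supp :: "(real^'n::finite \<Rightarrow> complex) \<Rightarrow> (real^'n) set" where
  "supp g = closure {x. g x \<noteq> 0}"

definition test_functions :: "(real^'n::finite \<Rightarrow> complex) set" where
  "test_functions = {\<phi>. smooth \<phi> \<and> compact (supp \<phi>)}"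

definition C_norm :: "nat \<Rightarrow> (real^'n::finite \<Rightarrow> complex) \<Rightarrow> real" where
  "C_norm N \<phi> = (\<Sum>js | length js \<le> N. SUP x. cmod (iter_partial js \<phi> x))"

text \<open>
  The test functions carry the inductive limit topology of the Frechet spaces of test functions
  supported in a fixed compact set: a seminorm is continuous iff its restriction to each of
  these subspaces is. A set is bounded iff every continuous seminorm is bounded on it.
\<close>

definition continuous_test_seminorm :: "((real^'n::finite \<Rightarrow> complex) \<Rightarrow> real) \<Rightarrow> bool" where
  "continuous_test_seminorm p \<longleftrightarrow>
     (\<forall>\<phi>\<in>test_functions. \<forall>\<psi>\<in>test_functions. p (\<lambda>x. \<phi> x + \<psi> x) \<le> p \<phi> + p \<psi>) \<and>
     (\<forall>c. \<forall>\<phi>\<in>test_functions. p (\<lambda>x. c * \<phi> x) = cmod c * p \<phi>) \<and>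
     (\<forall>K. compact K \<longrightarrow>
        (\<exists>C N. \<forall>\<phi>\<in>test_functions. supp \<phi> \<subseteq> K \<longrightarrow> p \<phi> \<le> C * C_norm N \<phi>))"

definition bounded_test_set :: "(real^'n::finite \<Rightarrow> complex) set \<Rightarrow> bool" where
  "bounded_test_set B \<longleftrightarrow>
     B \<subseteq> test_functions \<and> (\<forall>p. continuous_test_seminorm p \<longrightarrow> bdd_above (p ` B))"

section \<open>Distributions\<close>

type_synonym 'n functional = "(real^'n \<Rightarrow> complex) \<Rightarrow> complex"

text \<open>Extensionality makes a distribution determined by its values on test functions.\<close>

definition distributions :: "'n::finite functional set" where
  "distributions = {u \<in> extensional test_functions.
     (\<forall>\<phi>\<in>test_functions. \<forall>\<psi>\<in>test_functions. u (\<lambda>x. \<phi> x + \<psi> x) = u \<phi> + u \<psi>) \<and>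
     (\<forall>c. \<forall>\<phi>\<in>test_functions. u (\<lambda>x. c * \<phi> x) = c * u \<phi>) \<and>
     continuous_test_seminorm (\<lambda>\<phi>. cmod (u \<phi>))}"

definition dist_of_fun :: "(real^'n::finite \<Rightarrow> complex) \<Rightarrow> 'n functional" where
  "dist_of_fun g = (\<lambda>\<phi>\<in>test_functions. LINT x|lborel. g x * \<phi> x)"

text \<open>
  The Fourier transform of the compactly supported distribution \<open>\<phi>u\<close>, evaluated at \<open>\<xi>\<close>, is the
  pairing of \<open>\<phi>u\<close> with the function \<open>x \<mapsto> exp (-i x\<xi>)\<close>.
\<close>

definition local_fourier :: "(real^'n::finite \<Rightarrow> complex) \<Rightarrow> 'n functional \<Rightarrow> real^'n \<Rightarrow> complex" where
  "local_fourier \<phi> u \<xi> = u (\<lambda>x. \<phi> x * exp (- \<i> * complex_of_real (x \<bullet> \<xi>)))"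

definition japanese :: "real^'n::finite \<Rightarrow> real" where
  "japanese \<xi> = sqrt (1 + (norm \<xi>)\<^sup>2)"

definition sobolev_energy ::
    "real \<Rightarrow> (real^'n::finite \<Rightarrow> complex) \<Rightarrow> (real^'n) set \<Rightarrow> 'n functional \<Rightarrow> ennreal" where
  "sobolev_energy r \<phi> V u =
     (\<integral>\<^sup>+\<xi>\<in>V. ennreal ((cmod (local_fourier \<phi> u \<xi>))\<^sup>2 * japanese \<xi> powr (2 * r)) \<partial>lborel)"

text \<open>
  Only used where the energy is finite: for \<open>V = UNIV\<close> on the local Sobolev space, and for
  closed cones \<open>V\<close> with \<open>(supp \<phi> \<times> V) \<inter> L = {}\<close> on the distributions with wave front set in \<open>L\<close>.
\<close>

definition sobolev_seminorm ::
    "real \<Rightarrow> (real^'n::finite \<Rightarrow> complex) \<Rightarrow> (real^'n) set \<Rightarrow> 'n functional \<Rightarrow> real" where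
  "sobolev_seminorm r \<phi> V u = sqrt (enn2real (sobolev_energy r \<phi> V u))"

section \<open>Wave front sets\<close>

text \<open>Unlike for the library's \<open>cone\<close>, an open cone in this sense need not contain \<open>0\<close>.\<close>

definition pos_cone :: "(real^'n::finite) set \<Rightarrow> bool" where
  "pos_cone V \<longleftrightarrow> (\<forall>\<xi>\<in>V. \<forall>t>0. t *\<^sub>R \<xi> \<in> V)"

definition wave_front :: "real \<Rightarrow> 'n::finite functional \<Rightarrow> ((real^'n) \<times> (real^'n)) set" where
  "wave_front r u = {(x, \<xi>). \<xi> \<noteq> 0 \<and>
     \<not> (\<exists>V \<phi>. open V \<and> pos_cone V \<and> \<xi> \<in> V \<and> \<phi> \<in> test_functions \<and> \<phi> x \<noteq> 0 \<and>
          sobolev_energy r \<phi> V u < \<infinity>)}"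

definition closed_conic :: "((real^'n::finite) \<times> (real^'n)) set \<Rightarrow> bool" where
  "closed_conic L \<longleftrightarrow>
     closedin (top_of_set (UNIV \<times> (UNIV - {0}))) L \<and>
     (\<forall>x \<xi>. (x, \<xi>) \<in> L \<longrightarrow> (\<forall>t>0. (x, t *\<^sub>R \<xi>) \<in> L))"

section \<open>Topologies on spaces of distributions\<close>

definition seminorm_topology ::
    "'n::finite functional set \<Rightarrow> ('n functional \<Rightarrow> real) set \<Rightarrow> 'n functional topology" where
  "seminorm_topology X P =
     topology_generated_by {{v \<in> X. p (v - u) < \<epsilon>} | p u \<epsilon>. p \<in> P \<and> u \<in> X \<and> \<epsilon> > 0}"

definition strong_seminorms :: "('n::finite functional \<Rightarrow> real) set" where
  "strong_seminorms = {\<lambda>u. SUP \<phi>\<in>B. cmod (u \<phi>) | B. bounded_test_set B \<and> B \<noteq> {}}"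

definition distribution_topology :: "'n::finite functional topology" where
  "distribution_topology = seminorm_topology distributions strong_seminorms"

definition local_sobolev_topology :: "real \<Rightarrow> 'n::finite functional topology" where
  "local_sobolev_topology r = seminorm_topology
     {u \<in> distributions. \<forall>\<phi>\<in>test_functions. sobolev_energy r \<phi> UNIV u < \<infinity>}
     {sobolev_seminorm r \<phi> UNIV | \<phi>. \<phi> \<in> test_functions}"

definition wave_front_topology ::
    "real \<Rightarrow> ((real^'n::finite) \<times> (real^'n)) set \<Rightarrow> 'n functional topology" where
  "wave_front_topology r L = seminorm_topology
     {u \<in> distributions. wave_front r u \<subseteq> L}
     (strong_seminorms \<union>
      {sobolev_seminorm r \<phi> V | \<phi> V. \<phi> \<in> test_functions \<and> closed V \<and> pos_cone V \<and>
         (supp \<phi> \<times> V) \<inter> L = {}})"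

section \<open>Pullback\<close>

definition conormals :: "(real^'m::finite \<Rightarrow> real^'n::finite) \<Rightarrow> ((real^'n) \<times> (real^'n)) set" where
  "conormals f = {(f x, \<eta>) | x \<eta>. adjoint (frechet_derivative f (at x)) \<eta> = 0}"

definition pullback_cone :: "(real^'m::finite \<Rightarrow> real^'n::finite) \<Rightarrow>
    ((real^'n) \<times> (real^'n)) set \<Rightarrow> ((real^'m) \<times> (real^'m)) set" where
  "pullback_cone f L = {(x, adjoint (frechet_derivative f (at x)) \<eta>) | x \<eta>. (f x, \<eta>) \<in> L}"

text \<open>The extending map is not required to be linear.\<close>

definition pullback_extends :: "(real^'m::finite \<Rightarrow> real^'n::finite) \<Rightarrow>
    'n functional topology \<Rightarrow> 'm functional topology \<Rightarrow> bool" where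
  "pullback_extends f X Y \<longleftrightarrow>
     (\<exists>T. continuous_map X Y T \<and> (\<forall>u. smooth u \<longrightarrow> T (dist_of_fun u) = dist_of_fun (u \<circ> f)))"

end

theory Submission
  imports Defs "HOL-Probability.Sinc_Integral"
begin

text \<open>
  Split the frequency variables into the first \<open>k\<close> ones and the set \<open>J\<close> of the \<open>n - k\<close> others, on
  which \<open>f\<close> vanishes. Let \<open>u\<^sub>N\<close> be \<open>N\<close> to the power \<open>b - (n - k)\<close> times the sum of the plane waves
  whose frequencies are \<open>N \<eta>'\<close> in the first variables and range over the lattice points of
  \<open>[0, N)\<^sup>J\<close> in the others. All summands agree after pullback, so that \<open>u\<^sub>N \<circ> f\<close> is \<open>N\<close> to the power
  \<open>b\<close> times one plane wave, with frequency of size \<open>N\<close>; its local Sobolev energy of order \<open>r\<^sub>1\<close> is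
  of size \<open>N\<close> to the power \<open>2 b + 2 r\<^sub>1\<close>. Before pullback the frequencies are separated, hence the
  waves are almost orthogonal and the energy of order \<open>r\<^sub>2\<close> is only of size \<open>N\<close> to the power
  \<open>2 b - (n - k) + 2 r\<^sub>2\<close>. For \<open>b = - r\<^sub>1\<close> the latter tends to \<open>0\<close> while the former does not; since
  the frequencies tend to infinity if \<open>\<eta>' \<noteq> 0\<close>, also \<open>u\<^sub>N\<close> tends to \<open>0\<close> as a distribution. For
  convergence in the space of distributions take \<open>\<eta>' = 0\<close> and \<open>b = 0\<close>: the pullbacks are constantly \<open>1\<close>.
\<close>

section \<open>Smooth functions\<close>

text \<open>The threshold \<open>(n - k) / 2\<close> is the gap between two ways in which
  \<open>N ^ (n - k)\<close> waves add up. After pullback they are in phase and amplitudes add;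
  before it, only their squares do. Unit spacing suffices for this because the Fourier transform of
  a fixed cutoff decays on a scale independent of \<open>N\<close>. Two features of the setting
  shape the rest. The extension is not assumed linear, so its values are known only on distributions
  given by smooth functions; sequences of these tending to 0 are enough. And the topologies are
  generated by balls around arbitrary centres \<open>u\<close>, where a Sobolev seminorm returns 0
  for an infinite energy and the local Fourier transform of \<open>u\<close> is not known to be
  measurable. Convergence is therefore checked for every centre, without a triangle inequality for
  the seminorms. For \<eta>' = 0 the box contains the frequency 0, which no negative order damps;
  negative orders are then raised to 0, and this is where \<open>k < n\<close> enters part
  (i).\<close>

lemma partial_deriv_eq:
  assumes "(g has_derivative D) (at x)"
  shows "partial_deriv i g x = D (axis i 1)"
  using frechet_derivative_at[OF assms] by (simp add: partial_deriv_def)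

lemma partial_deriv_add:
  assumes "f differentiable (at x)" "g differentiable (at x)"
  shows "partial_deriv i (\<lambda>x. f x + g x) x = partial_deriv i f x + partial_deriv i g x"
  using partial_deriv_eq[OF has_derivative_add[OF assms[unfolded frechet_derivative_works]]]
  by (simp add: partial_deriv_def)

lemma partial_deriv_mult:
  assumes "f differentiable (at x)" "g differentiable (at x)"
  shows "partial_deriv i (\<lambda>x. f x * g x) x = partial_deriv i f x * g x + f x * partial_deriv i g x"
  using partial_deriv_eq[OF has_derivative_mult[OF assms[unfolded frechet_derivative_works]]]
  by (simp add: partial_deriv_def)

lemma partial_deriv_const [simp]: "partial_deriv i (\<lambda>x. c) = (\<lambda>x. 0)"
  by (rule ext) (simp add: partial_deriv_eq[OF has_derivative_const])

lemma iter_partial_append: "iter_partial (is @ js) g = iter_partial is (iter_partial js g)"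
  by (induction "is") auto

lemma smooth_differentiable: "smooth g \<Longrightarrow> g differentiable (at x)"
  using smooth_def[of g] by (metis iter_partial.simps(1))

lemma smooth_iter_partial: "smooth g \<Longrightarrow> smooth (iter_partial js g)"
  by (simp add: smooth_def flip: iter_partial_append)

lemma smooth_partial_deriv: "smooth g \<Longrightarrow> smooth (partial_deriv i g)"
  using smooth_iter_partial[of g "[i]"] by simp

lemma smooth_continuous_on: "smooth g \<Longrightarrow> continuous_on S g"
  by (meson continuous_at_imp_continuous_on differentiable_imp_continuous_within
      smooth_differentiable)

lemma smooth_measurable [measurable_dest]: "smooth g \<Longrightarrow> g \<in> borel_measurable borel"
  by (simp add: borel_measurable_continuous_onI smooth_continuous_on)

lemma smooth_has_derivative:
  "smooth g \<Longrightarrow> (g has_derivative frechet_derivative g (at x)) (at x)"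
  using frechet_derivative_works smooth_differentiable by blast

lemma iter_partial_add:
  assumes "smooth f" "smooth g"
  shows "iter_partial js (\<lambda>x. f x + g x) = (\<lambda>x. iter_partial js f x + iter_partial js g x)"
proof (induction js)
  case (Cons i js)
  then show ?case
    using assms by (auto simp: smooth_def intro!: ext partial_deriv_add)
qed simp

lemma smooth_add: "smooth f \<Longrightarrow> smooth g \<Longrightarrow> smooth (\<lambda>x. f x + g x)"
  unfolding smooth_def[of "\<lambda>x. f x + g x"]
  by (auto simp: iter_partial_add smooth_def intro!: differentiable_add)

text \<open>
  A class of differentiable functions consists of smooth functions as soon as the partial
  derivatives of its members are finite sums of members.
\<close>

inductive_set add_span :: "('a \<Rightarrow> complex) set \<Rightarrow> ('a \<Rightarrow> complex) set" for A where
  base: "g \<in> A \<Longrightarrow> g \<in> add_span A"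
| add: "f \<in> add_span A \<Longrightarrow> g \<in> add_span A \<Longrightarrow> (\<lambda>x. f x + g x) \<in> add_span A"

lemma add_span_smooth:
  assumes diff: "\<And>g x. g \<in> A \<Longrightarrow> g differentiable (at x)"
    and deriv: "\<And>g i. g \<in> A \<Longrightarrow> partial_deriv i g \<in> add_span A"
    and "g \<in> add_span A"
  shows "smooth g"
proof -
  have d: "g differentiable (at x)" if "g \<in> add_span A" for g x
    using that by induction (auto intro: diff)
  have p: "partial_deriv i g \<in> add_span A" if "g \<in> add_span A" for g i
    using that
  proof induction
    case (add f g)
    have "partial_deriv i (\<lambda>x. f x + g x) = (\<lambda>x. partial_deriv i f x + partial_deriv i g x)"
      using d[OF add.hyps(1)] d[OF add.hyps(2)] by (auto intro!: ext partial_deriv_add)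
    then show ?case
      using add.IH by (simp add: add_span.add)
  qed (rule deriv)
  have "iter_partial js g \<in> add_span A" for js
    by (induction js) (use assms(3) p in auto)
  then show ?thesis
    using d smooth_def by blast
qed

lemma smooth_mult:
  assumes "smooth f" "smooth g"
  shows "smooth (\<lambda>x. f x * g x)"
proof -
  \<comment> \<open>Quantifying over both factors makes the class large enough: either summand of
    the Leibniz rule is again a product of two smooth functions.\<close>
  let ?A = "{\<lambda>x. f x * g x |f g. smooth f \<and> smooth g}"
  have diff: "h differentiable (at x)" if "h \<in> ?A" for h x
    using that smooth_differentiable by (auto intro!: differentiable_mult)
  have deriv: "partial_deriv i h \<in> add_span ?A" if h: "h \<in> ?A" for h i
  proof -
    obtain f g where fg: "smooth f" "smooth g" and "h = (\<lambda>x. f x * g x)"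
      using h by auto
    then have "partial_deriv i h = (\<lambda>x. partial_deriv i f x * g x + f x * partial_deriv i g x)"
      by (auto intro!: ext partial_deriv_mult smooth_differentiable)
    moreover have "(\<lambda>x. partial_deriv i f x * g x) \<in> ?A" "(\<lambda>x. f x * partial_deriv i g x) \<in> ?A"
      using fg smooth_partial_deriv by blast+
    ultimately show ?thesis
      by (simp add: add_span.intros)
  qed
  have "(\<lambda>x. f x * g x) \<in> ?A"
    using assms by blast
  from add_span_smooth[of ?A, OF diff deriv add_span.base[OF this]] show ?thesis .
qed

lemma smooth_const: "smooth (\<lambda>x. c)"
proof -
  have "iter_partial js (\<lambda>x. c) \<in> {\<lambda>x. c, \<lambda>x. 0}" for js
    by (induction js) auto
  then show ?thesis
    unfolding smooth_def by (metis differentiable_const insertE singletonD)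
qed

lemma smooth_sum: "(\<And>l. l \<in> A \<Longrightarrow> smooth (g l)) \<Longrightarrow> smooth (\<lambda>x. \<Sum>l\<in>A. g l x)"
  by (induction A rule: infinite_finite_induct) (auto intro: smooth_const smooth_add)

lemma smooth_linear:
  assumes "bounded_linear g"
  shows "smooth g"
proof (rule add_span_smooth[of "insert g (range (\<lambda>c x. c))"])
  fix h :: "real^'a \<Rightarrow> complex" and i
  have "partial_deriv i g = (\<lambda>x. g (axis i 1))"
    using partial_deriv_eq[OF bounded_linear_imp_has_derivative[OF assms]] by blast
  then show "h \<in> insert g (range (\<lambda>c x. c)) \<Longrightarrow>
      partial_deriv i h \<in> add_span (insert g (range (\<lambda>c x. c)))"
    by (auto intro!: add_span.base)
qed (auto intro: add_span.base bounded_linear_imp_differentiable assms)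

definition plane_wave :: "real^'n::finite \<Rightarrow> real^'n \<Rightarrow> complex" where
  "plane_wave \<theta> x = exp (\<i> * complex_of_real (x \<bullet> \<theta>))"

lemma has_derivative_plane_wave:
  "(plane_wave \<theta> has_derivative (\<lambda>h. (\<i> * complex_of_real (h \<bullet> \<theta>)) * plane_wave \<theta> x)) (at x)"
proof -
  have "((\<lambda>x. \<i> * complex_of_real (x \<bullet> \<theta>)) has_derivative (\<lambda>h. \<i> * complex_of_real (h \<bullet> \<theta>))) (at x)"
    by (intro has_derivative_mult_right has_derivative_of_real has_derivative_inner_left
        has_derivative_ident)
  from has_derivative_compose[OF this DERIV_exp[unfolded has_field_derivative_def]]
  show ?thesis
    by (simp add: plane_wave_def[abs_def] mult.commute)
qed

lemma partial_deriv_plane_wave: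
  "partial_deriv i (plane_wave \<theta>) = (\<lambda>x. \<i> * complex_of_real (\<theta> $ i) * plane_wave \<theta> x)"
  by (rule ext) (simp add: partial_deriv_eq[OF has_derivative_plane_wave] inner_axis')

lemma smooth_plane_wave: "smooth (plane_wave \<theta>)"
proof -
  have iter: "\<exists>c. iter_partial js (plane_wave \<theta>) = (\<lambda>x. c * plane_wave \<theta> x)" for js
  proof (induction js)
    case (Cons i js)
    then obtain c where c: "iter_partial js (plane_wave \<theta>) = (\<lambda>x. c * plane_wave \<theta> x)"
      by blast
    have "partial_deriv i (\<lambda>x. c * plane_wave \<theta> x) x
      = (c * (\<i> * complex_of_real (\<theta> $ i))) * plane_wave \<theta> x" for x
      using partial_deriv_mult[OF differentiable_const differentiableI[OF has_derivative_plane_wave]]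
      unfolding partial_deriv_plane_wave by (simp add: mult.assoc)
    then show ?case
      by (auto simp: c)
  qed (auto intro!: exI[of _ 1])
  have diff: "(\<lambda>x. c * plane_wave \<theta> x) differentiable (at x)" for c x
    by (intro differentiable_mult differentiable_const
        differentiableI[OF has_derivative_plane_wave])
  show ?thesis
    unfolding smooth_def
  proof (intro allI)
    fix js x
    obtain c where "iter_partial js (plane_wave \<theta>) = (\<lambda>x. c * plane_wave \<theta> x)"
      using iter by blast
    then show "iter_partial js (plane_wave \<theta>) differentiable at x"
      using diff by simp
  qed
qed

section \<open>Test functions\<close>

lemma supp_vanishes: "x \<notin> supp g \<Longrightarrow> g x = 0"
  using closure_subset[of "{x. g x \<noteq> 0}"] by (auto simp: supp_def)

lemma supp_subset: "closed K \<Longrightarrow> (\<And>x. g x \<noteq> 0 \<Longrightarrow> x \<in> K) \<Longrightarrow> supp g \<subseteq> K"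
  unfolding supp_def by (intro closure_minimal) auto

lemma closed_supp [simp]: "closed (supp g)"
  by (simp add: supp_def)

lemma supp_partial_deriv: "supp (partial_deriv i g) \<subseteq> supp g"
proof (rule supp_subset)
  fix x assume x: "partial_deriv i g x \<noteq> 0"
  show "x \<in> supp g"
  proof (rule ccontr)
    assume "x \<notin> supp g"
    then have "(g has_derivative (\<lambda>h. 0)) (at x)"
      by (intro has_derivative_transform_within_open[OF has_derivative_const, where s = "- supp g"])
        (auto simp: supp_vanishes)
    from partial_deriv_eq[OF this] x show False
      by simp
  qed
qed simp

lemma supp_iter_partial: "supp (iter_partial js g) \<subseteq> supp g"
  by (induction js) (use supp_partial_deriv in fastforce)+

lemma test_functionsI:
  assumes "smooth \<phi>" "compact K" "supp \<phi> \<subseteq> K"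
  shows "\<phi> \<in> test_functions"
  using assms by (metis (no_types, lifting) closed_supp compact_Int_closed inf.absorb2
      mem_Collect_eq test_functions_def)

lemma test_function_smooth [dest]: "\<phi> \<in> test_functions \<Longrightarrow> smooth \<phi>"
  and test_function_compact [dest]: "\<phi> \<in> test_functions \<Longrightarrow> compact (supp \<phi>)"
  by (auto simp: test_functions_def)

lemma test_function_iter_partial: "\<phi> \<in> test_functions \<Longrightarrow> iter_partial js \<phi> \<in> test_functions"
  by (meson smooth_iter_partial supp_iter_partial test_functionsI test_function_smooth
      test_function_compact)

lemma test_function_partial_deriv: "\<phi> \<in> test_functions \<Longrightarrow> partial_deriv i \<phi> \<in> test_functions"
  using test_function_iter_partial[of \<phi> "[i]"] by simp

lemma test_function_mult:
  assumes "\<phi> \<in> test_functions" "smooth g"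
  shows "(\<lambda>x. g x * \<phi> x) \<in> test_functions" "(\<lambda>x. \<phi> x * g x) \<in> test_functions"
proof -
  have "supp (\<lambda>x. g x * \<phi> x) \<subseteq> supp \<phi>"
    by (rule supp_subset) (auto intro: ccontr supp_vanishes)
  then show "(\<lambda>x. g x * \<phi> x) \<in> test_functions"
    using assms by (intro test_functionsI[of _ "supp \<phi>"]) (auto intro: smooth_mult)
  then show "(\<lambda>x. \<phi> x * g x) \<in> test_functions"
    by (simp add: mult.commute)
qed

lemma test_function_cmult: "\<phi> \<in> test_functions \<Longrightarrow> (\<lambda>x. c * \<phi> x) \<in> test_functions"
  using test_function_mult(1)[OF _ smooth_const] .

lemma test_function_add:
  assumes "\<phi> \<in> test_functions" "\<psi> \<in> test_functions"
  shows "(\<lambda>x. \<phi> x + \<psi> x) \<in> test_functions"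
proof -
  have "supp (\<lambda>x. \<phi> x + \<psi> x) \<subseteq> supp \<phi> \<union> supp \<psi>"
  proof (rule supp_subset)
    fix x :: "real^'a" assume "\<phi> x + \<psi> x \<noteq> 0"
    then show "x \<in> supp \<phi> \<union> supp \<psi>"
      by (metis Un_iff add_0 supp_vanishes)
  qed (simp add: closed_Un)
  then show ?thesis
    using assms
    by (intro test_functionsI[of _ "supp \<phi> \<union> supp \<psi>"]) (auto intro: smooth_add compact_Un)
qed

text \<open>Makes the real-valued \<open>SUP\<close> in \<open>C_norm\<close> a true supremum; on an
  unbounded set its value would be unspecified.\<close>

lemma test_function_bounded:
  assumes "\<phi> \<in> test_functions"
  shows "bdd_above (range (\<lambda>x. cmod (\<phi> x)))"
proof -
  have "compact ((\<lambda>x. cmod (\<phi> x)) ` supp \<phi>)"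
    using assms by (intro compact_continuous_image continuous_on_norm smooth_continuous_on) auto
  then obtain B where B: "\<And>x. x \<in> supp \<phi> \<Longrightarrow> cmod (\<phi> x) \<le> B"
    using bounded_imp_bdd_above[OF compact_imp_bounded] by (metis bdd_above.E imageI)
  have "cmod (\<phi> x) \<le> max B 0" for x
    by (metis B dual_order.refl le_max_iff_disj norm_zero supp_vanishes)
  then show ?thesis
    by (intro bdd_aboveI[of _ "max B 0"]) auto
qed

lemma test_function_integrable_mult:
  assumes "\<phi> \<in> test_functions" "continuous_on UNIV g"
  shows "integrable lborel (\<lambda>x. g x * \<phi> x)"
proof -
  have "integrable lborel (\<lambda>x. indicator (supp \<phi>) x *\<^sub>R (g x * \<phi> x))"
    using assms smooth_continuous_on
    by (intro borel_integrable_compact continuous_on_mult) (auto intro: continuous_on_subset)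
  moreover have "(\<lambda>x. indicator (supp \<phi>) x *\<^sub>R (g x * \<phi> x)) = (\<lambda>x. g x * \<phi> x)"
    by (auto simp: indicator_def fun_eq_iff supp_vanishes)
  ultimately show ?thesis
    by simp
qed

lemma test_function_integrable: "\<phi> \<in> test_functions \<Longrightarrow> integrable lborel \<phi>"
  using test_function_integrable_mult[of \<phi> "\<lambda>x. 1"] by simp

lemma cmod_le_Sup:
  assumes "\<phi> \<in> test_functions"
  shows "cmod (\<phi> x) \<le> (SUP x. cmod (\<phi> x))"
  by (rule cSUP_upper[OF UNIV_I test_function_bounded[OF assms]])

lemma iter_partial_le_C_norm:
  assumes "\<phi> \<in> test_functions" "length js \<le> N"
  shows "cmod (iter_partial js \<phi> x) \<le> C_norm N \<phi>"
proof -
  have "finite {js :: 'a list. length js \<le> N}"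
    using finite_lists_length_le[of "UNIV :: 'a set" N] by simp
  then have "(SUP x. cmod (iter_partial js \<phi> x)) \<le> C_norm N \<phi>"
    unfolding C_norm_def using assms
    by (intro member_le_sum[where f = "\<lambda>js. SUP x. cmod (iter_partial js \<phi> x)"])
      (auto intro: order_trans[OF norm_ge_zero cmod_le_Sup[OF test_function_iter_partial]])
  with cmod_le_Sup[OF test_function_iter_partial[OF assms(1)], of js x] show ?thesis
    by linarith
qed

lemma integral_iter_partial_le_C_norm:
  assumes "\<phi> \<in> test_functions" "compact K" "supp \<phi> \<subseteq> K" "length js \<le> N"
  shows "(LINT x|lborel. cmod (iter_partial js \<phi> x)) \<le> measure lborel K * C_norm N \<phi>"
proof -
  have i: "integrable lborel (\<lambda>x. C_norm N \<phi> * indicator K x)"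
    using emeasure_compact_finite[OF assms(2)] borel_compact[OF assms(2)] by auto
  have "cmod (iter_partial js \<phi> x) \<le> C_norm N \<phi> * indicator K x" for x
    using iter_partial_le_C_norm[OF assms(1,4), of x] supp_iter_partial[of js \<phi>] assms(3)
      supp_vanishes[of x "iter_partial js \<phi>"]
    by (auto simp: indicator_def)
  then have "(LINT x|lborel. cmod (iter_partial js \<phi> x)) \<le> (LINT x|lborel. C_norm N \<phi> * indicator K x)"
    using assms by (intro integral_mono i integrable_norm test_function_integrable
        test_function_iter_partial) auto
  also have "\<dots> = measure lborel K * C_norm N \<phi>"
    by simp
  finally show ?thesis .
qed

text \<open>On a bounded set of test functions these integrals are bounded by one constant, which
  turns decay of Fourier transforms into decay uniform over the set.\<close>

lemma continuous_test_seminorm_L1: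
  "continuous_test_seminorm (\<lambda>\<phi> :: real^'n::finite \<Rightarrow> complex. LINT x|lborel. cmod (iter_partial js \<phi> x))"
  unfolding continuous_test_seminorm_def
proof (intro conjI ballI allI impI)
  fix \<phi> \<psi> :: "real^'n \<Rightarrow> complex"
  assume *: "\<phi> \<in> test_functions" "\<psi> \<in> test_functions"
  have i: "integrable lborel (\<lambda>x. cmod (iter_partial js \<phi> x))" if "\<phi> \<in> test_functions" for \<phi> :: "real^'n \<Rightarrow> complex"
    using that by (intro integrable_norm test_function_integrable test_function_iter_partial)
  have "(LINT x|lborel. cmod (iter_partial js (\<lambda>x. \<phi> x + \<psi> x) x))
    \<le> (LINT x|lborel. cmod (iter_partial js \<phi> x) + cmod (iter_partial js \<psi> x))"
    using * by (intro integral_mono i test_function_add Bochner_Integration.integrable_add)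
      (auto simp: iter_partial_add test_function_smooth norm_triangle_ineq)
  then show "(LINT x|lborel. cmod (iter_partial js (\<lambda>x. \<phi> x + \<psi> x) x))
    \<le> (LINT x|lborel. cmod (iter_partial js \<phi> x)) + (LINT x|lborel. cmod (iter_partial js \<psi> x))"
    using * by (simp add: i)
next
  fix \<phi> :: "real^'n \<Rightarrow> complex" and c :: complex
  assume *: "\<phi> \<in> test_functions"
  have "iter_partial js (\<lambda>x. c * \<phi> x) = (\<lambda>x. c * iter_partial js \<phi> x)" for js
  proof (induction js)
    case (Cons i js)
    have "partial_deriv i (\<lambda>x. c * iter_partial js \<phi> x) x = c * partial_deriv i (iter_partial js \<phi>) x" for x
      using partial_deriv_mult[of "\<lambda>x. c" x "iter_partial js \<phi>" i] *
      by (simp add: test_function_smooth smooth_differentiable smooth_iter_partial)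
    then show ?case
      by (simp add: Cons)
  qed simp
  then show "(LINT x|lborel. cmod (iter_partial js (\<lambda>x. c * \<phi> x) x)) =
      cmod c * (LINT x|lborel. cmod (iter_partial js \<phi> x))"
    by (simp add: norm_mult)
next
  fix K :: "(real^'n) set" assume "compact K"
  then show "\<exists>C N. \<forall>\<phi>\<in>test_functions. supp \<phi> \<subseteq> K \<longrightarrow>
      (LINT x|lborel. cmod (iter_partial js \<phi> x)) \<le> C * C_norm N \<phi>"
    using integral_iter_partial_le_C_norm by blast
qed

text \<open>Translation invariance makes every difference quotient integrate to 0; dominated
  convergence passes to the derivative. Applied to products, this is integration by parts.\<close>

lemma integral_partial_deriv_eq_0:
  fixes \<phi> :: "real^'n::finite \<Rightarrow> complex"
  assumes \<phi>: "\<phi> \<in> test_functions"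
  shows "(LINT x|lborel. partial_deriv i \<phi> x) = 0"
proof -
  define h where "h n = inverse (real (Suc n))" for n
  \<comment> \<open>Shifts of length at most 1 keep every difference quotient supported in the ball
    of radius \<open>R + 1\<close>, so that one dominating function serves all
    \<open>n\<close>.\<close>
  have h: "0 < h n" "h n \<le> 1" for n
    by (auto simp: h_def field_simps)
  define g where "g n x = (\<phi> (h n *\<^sub>R axis i 1 + x) - \<phi> x) /\<^sub>R h n" for n and x :: "real^'n"
  define M where "M = (SUP x. cmod (partial_deriv i \<phi> x))"
  have M: "cmod (partial_deriv i \<phi> x) \<le> M" for x
    unfolding M_def by (intro cmod_le_Sup test_function_partial_deriv \<phi>)
  obtain R where R: "supp \<phi> \<subseteq> cball 0 R"
    using compact_imp_bounded[OF test_function_compact[OF \<phi>]]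
    by (auto simp: bounded_iff subset_iff)
  have [measurable]: "\<phi> \<in> borel_measurable borel" "partial_deriv i \<phi> \<in> borel_measurable borel"
    using \<phi> by (auto intro: smooth_measurable smooth_partial_deriv)
  \<comment> \<open>Restriction to a coordinate line serves twice: the mean value inequality gives
    the domination, the derivative at \<open>t = 0\<close> the pointwise limit.\<close>
  have line: "((\<lambda>t. \<phi> (t *\<^sub>R axis i 1 + x)) has_derivative
      (\<lambda>s. s *\<^sub>R partial_deriv i \<phi> (t *\<^sub>R axis i 1 + x))) (at t)" for t x
  proof -
    let ?y = "t *\<^sub>R axis i 1 + x"
    have "((\<lambda>t. \<phi> (t *\<^sub>R axis i 1 + x)) has_derivative
      (\<lambda>s. frechet_derivative \<phi> (at ?y) (s *\<^sub>R axis i 1))) (at t)"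
      by (rule has_derivative_compose[where g = \<phi>])
        (auto intro!: derivative_eq_intros smooth_has_derivative test_function_smooth[OF \<phi>])
    moreover have "linear (frechet_derivative \<phi> (at ?y))"
      by (simp add: \<phi> linear_frechet_derivative smooth_differentiable test_function_smooth)
    ultimately show ?thesis
      by (simp add: partial_deriv_def linear_scale)
  qed
  have g_bound: "cmod (g n x) \<le> M * indicator (cball 0 (R + 1)) x" for n x
  proof (cases "x \<in> cball 0 (R + 1)")
    case True
    have "continuous_on {0..h n} (\<lambda>t. \<phi> (t *\<^sub>R axis i 1 + x))"
      by (intro continuous_on_compose2[OF smooth_continuous_on[OF test_function_smooth[OF \<phi>], of UNIV]])
        (auto intro!: continuous_intros)
    from mvt_general[OF h(1) this line] obtain t where
      "cmod (\<phi> (h n *\<^sub>R axis i 1 + x) - \<phi> x) \<le> cmod (h n *\<^sub>R partial_deriv i \<phi> (t *\<^sub>R axis i 1 + x))"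
      by auto
    also have "\<dots> \<le> h n * M"
      using h[of n] M by (simp add: mult_left_mono)
    finally show ?thesis
      using h[of n] True by (simp add: g_def divide_simps mult.commute)
  next
    case False
    have "norm (h n *\<^sub>R axis i 1 :: real^'n) \<le> 1"
      using h[of n] by simp
    then have "norm (h n *\<^sub>R axis i 1 + x) > R"
      using False norm_triangle_ineq4[of "h n *\<^sub>R axis i 1 + x" "h n *\<^sub>R axis i 1"] by simp
    then have "\<phi> (h n *\<^sub>R axis i 1 + x) = 0" "\<phi> x = 0"
      using R False by (auto intro!: supp_vanishes)
    then show ?thesis
      using False by (simp add: g_def)
  qed
  have lim: "(\<lambda>n. g n x) \<longlonglongrightarrow> partial_deriv i \<phi> x" for x
  proof -
    let ?q = "\<lambda>t. (\<phi> (t *\<^sub>R axis i 1 + x) - \<phi> x) /\<^sub>R t"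
    have "((\<lambda>t. norm (\<phi> (t *\<^sub>R axis i 1 + x) - \<phi> x - t *\<^sub>R partial_deriv i \<phi> x) / norm t) \<longlongrightarrow> 0) (at 0)"
      using line[of x 0] by (simp add: has_derivative_at)
    moreover have "norm (\<phi> (t *\<^sub>R axis i 1 + x) - \<phi> x - t *\<^sub>R partial_deriv i \<phi> x) / norm t
        = norm (?q t - partial_deriv i \<phi> x)" if "t \<noteq> 0" for t :: real
    proof -
      have "?q t - partial_deriv i \<phi> x =
          (\<phi> (t *\<^sub>R axis i 1 + x) - \<phi> x - t *\<^sub>R partial_deriv i \<phi> x) /\<^sub>R t"
        using that by (simp add: scaleR_diff_right)
      then show ?thesis
        by (simp add: divide_inverse mult.commute)
    qed
    ultimately have "((\<lambda>t. norm (?q t - partial_deriv i \<phi> x)) \<longlongrightarrow> 0) (at 0)"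
      by (elim Lim_transform_eventually) (auto simp: eventually_at_filter)
    then have "(?q \<longlongrightarrow> partial_deriv i \<phi> x) (at 0)"
      by (rule LIM_zero_cancel[OF tendsto_norm_zero_cancel])
    moreover have "filterlim h (at 0) sequentially"
      unfolding h_def using LIMSEQ_inverse_real_of_nat
      by (auto simp: filterlim_at)
    ultimately have "((\<lambda>n. ?q (h n)) \<longlongrightarrow> partial_deriv i \<phi> x) sequentially"
      by (rule filterlim_compose)
    then show ?thesis
      by (simp only: g_def)
  qed
  have "(\<lambda>n. LINT x|lborel. g n x) \<longlonglongrightarrow> (LINT x|lborel. partial_deriv i \<phi> x)"
  proof (rule integral_dominated_convergence[where w = "\<lambda>x. M * indicator (cball 0 (R + 1)) x"])
    show "integrable lborel (\<lambda>x::real^'n. M * indicator (cball 0 (R + 1)) x)"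
      using emeasure_compact_finite[of "cball 0 (R + 1) :: (real^'n) set"] by auto
    show "g n \<in> borel_measurable (lborel :: (real^'n) measure)" for n
      unfolding g_def by measurable
  qed (use lim g_bound in auto)
  moreover have "(LINT x|lborel. g n x) = 0" for n
  proof -
    have "integrable lborel (\<lambda>x. \<phi> (h n *\<^sub>R axis i 1 + x))"
      using test_function_integrable[OF \<phi>]
      by (subst (asm) lborel_distr_plus[of "h n *\<^sub>R axis i 1", symmetric]) (simp add: integrable_distr_eq)
    moreover have "(LINT x|lborel. \<phi> (h n *\<^sub>R axis i 1 + x)) = (LINT x|lborel. \<phi> x)"
      by (subst (2) lborel_distr_plus[of "h n *\<^sub>R axis i 1", symmetric]) (simp add: integral_distr)
    ultimately show ?thesis
      using test_function_integrable[OF \<phi>] by (simp add: g_def)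
  qed
  ultimately show ?thesis
    using LIMSEQ_unique by (auto simp: LIMSEQ_const_iff)
qed

section \<open>Fourier transforms of test functions\<close>

definition fourier :: "(real^'n::finite \<Rightarrow> complex) \<Rightarrow> real^'n \<Rightarrow> complex" where
  "fourier \<phi> \<xi> = (LINT x|lborel. plane_wave (- \<xi>) x * \<phi> x)"

lemma norm_plane_wave [simp]: "cmod (plane_wave \<theta> x) = 1"
  by (simp add: plane_wave_def)

lemma plane_wave_integrable:
  "\<phi> \<in> test_functions \<Longrightarrow> integrable lborel (\<lambda>x. plane_wave \<theta> x * \<phi> x)"
  by (intro test_function_integrable_mult smooth_continuous_on smooth_plane_wave)

lemma fourier_add:
  assumes "\<phi> \<in> test_functions" "\<psi> \<in> test_functions"
  shows "fourier (\<lambda>x. \<phi> x + \<psi> x) \<xi> = fourier \<phi> \<xi> + fourier \<psi> \<xi>"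
  unfolding fourier_def using assms by (simp add: distrib_left plane_wave_integrable)

lemma fourier_cmult: "fourier (\<lambda>x. c * \<phi> x) \<xi> = c * fourier \<phi> \<xi>"
  by (simp add: fourier_def mult.left_commute)

lemma fourier_measurable [measurable]:
  assumes "\<phi> \<in> test_functions"
  shows "fourier \<phi> \<in> borel_measurable borel"
proof -
  have [measurable]: "\<phi> \<in> borel_measurable borel"
    using assms by (intro smooth_measurable) auto
  have "(\<lambda>(\<xi>, x). plane_wave (- \<xi>) x * \<phi> x) \<in> borel_measurable (borel \<Otimes>\<^sub>M lborel)"
    unfolding plane_wave_def by measurable
  then show ?thesis
    unfolding fourier_def[abs_def] by (rule lborel.borel_measurable_lebesgue_integral)
qed

lemma fourier_le_L1: "cmod (fourier \<phi> \<xi>) \<le> (LINT x|lborel. cmod (\<phi> x))"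
  unfolding fourier_def using integral_norm_bound[of lborel "\<lambda>x. plane_wave (- \<xi>) x * \<phi> x"]
  by (simp only: norm_mult norm_plane_wave mult_1)

section \<open>Decay of Fourier transforms and summability of the decay\<close>

lemma fourier_partial_deriv:
  assumes "\<phi> \<in> test_functions"
  shows "fourier (partial_deriv i \<phi>) \<xi> = \<i> * complex_of_real (\<xi> $ i) * fourier \<phi> \<xi>"
proof -
  have "partial_deriv i (\<lambda>x. plane_wave (- \<xi>) x * \<phi> x) =
      (\<lambda>x. (- \<i> * complex_of_real (\<xi> $ i)) * (plane_wave (- \<xi>) x * \<phi> x) +
        plane_wave (- \<xi>) x * partial_deriv i \<phi> x)"
    using partial_deriv_mult[OF smooth_differentiable[OF smooth_plane_wave]
        smooth_differentiable[OF test_function_smooth[OF assms]], of i "- \<xi>"]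
    unfolding partial_deriv_plane_wave by (simp add: fun_eq_iff mult_ac)
  moreover have "(LINT x|lborel. partial_deriv i (\<lambda>x. plane_wave (- \<xi>) x * \<phi> x) x) = 0"
    by (intro integral_partial_deriv_eq_0 test_function_mult assms smooth_plane_wave)
  ultimately have "(- \<i> * complex_of_real (\<xi> $ i)) * fourier \<phi> \<xi> + fourier (partial_deriv i \<phi>) \<xi> = 0"
    unfolding fourier_def using assms
    by (simp add: plane_wave_integrable test_function_partial_deriv del: mult_minus_left)
  then show ?thesis
    by (simp add: algebra_simps add_eq_0_iff)
qed

text \<open>The constant is left as an explicit integral, so that it can be bounded uniformly when
  \<phi> ranges over a bounded set of test functions.\<close>

lemma fourier_coordinate_decay:
  assumes "\<phi> \<in> test_functions"
  shows "\<bar>\<xi> $ i\<bar> ^ M * cmod (fourier \<phi> \<xi>)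
    \<le> (LINT x|lborel. cmod (iter_partial (replicate M i) \<phi> x))"
proof -
  have "fourier (iter_partial (replicate M i) \<phi>) \<xi> = (\<i> * complex_of_real (\<xi> $ i)) ^ M * fourier \<phi> \<xi>"
    by (induction M) (simp_all add: fourier_partial_deriv test_function_iter_partial assms)
  then show ?thesis
    using fourier_le_L1[of "iter_partial (replicate M i) \<phi>" \<xi>] by (simp add: norm_mult norm_power)
qed

text \<open>A product in place of a power of \<open>japanese\<close>: its inverse is integrable by
  Fubini, and omitting the factors of some coordinates only decreases it, which suits sums over a
  lattice in the coordinates \<open>J\<close>.\<close>

definition weight :: "real^'n::finite \<Rightarrow> real" where
  "weight \<xi> = (\<Prod>i\<in>UNIV. 1 + (\<xi> $ i)\<^sup>2)"

lemma weight_ge_1: "weight \<xi> \<ge> 1"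
  unfolding weight_def by (intro prod_ge_1) auto

lemma weight_pos: "weight \<xi> > 0"
  using weight_ge_1[of \<xi>] by linarith

text \<open>Multiplication by the weight corresponds to the operator \<open>\<Prod>\<^sub>i (1 - \<partial>\<^sub>i\<^sup>2)\<close>.\<close>

lemma fourier_weight_decay:
  fixes \<phi> :: "real^'n::finite \<Rightarrow> complex"
  assumes "\<phi> \<in> test_functions"
  shows "\<exists>C. \<forall>\<xi>. weight \<xi> ^ M * cmod (fourier \<phi> \<xi>) \<le> C"
proof -
  have prod: "\<exists>\<psi>\<in>test_functions. \<forall>\<xi>.
      fourier \<psi> \<xi> = complex_of_real (\<Prod>i\<in>A. 1 + (\<xi> $ i)\<^sup>2) * fourier \<phi> \<xi>"
    if "\<phi> \<in> test_functions" for A and \<phi> :: "real^'n \<Rightarrow> complex"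
    using finite[of A]
  proof (induction A)
    case (insert i A)
    then obtain \<psi> where \<psi>: "\<psi> \<in> test_functions" and
      eq: "\<And>\<xi>. fourier \<psi> \<xi> = complex_of_real (\<Prod>i\<in>A. 1 + (\<xi> $ i)\<^sup>2) * fourier \<phi> \<xi>"
      by blast
    let ?\<psi> = "\<lambda>x. \<psi> x + (- 1) * partial_deriv i (partial_deriv i \<psi>) x"
    have "fourier ?\<psi> \<xi> = complex_of_real (1 + (\<xi> $ i)\<^sup>2) * fourier \<psi> \<xi>" for \<xi>
      unfolding fourier_add[OF \<psi> test_function_cmult[OF test_function_partial_deriv[OF
            test_function_partial_deriv[OF \<psi>]]]]
        fourier_cmult fourier_partial_deriv[OF test_function_partial_deriv[OF \<psi>]]
        fourier_partial_deriv[OF \<psi>]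
      by (simp add: algebra_simps power2_eq_square)
    moreover have "?\<psi> \<in> test_functions"
      by (intro test_function_add test_function_cmult test_function_partial_deriv \<psi>)
    ultimately show ?case
      using insert.hyps by (intro bexI[of _ ?\<psi>]) (auto simp: eq)
  qed (use that in auto)
  have "\<exists>\<psi>\<in>test_functions. \<forall>\<xi>. fourier \<psi> \<xi> = complex_of_real (weight \<xi> ^ M) * fourier \<phi> \<xi>"
  proof (induction M)
    case (Suc M)
    then obtain \<psi> where \<psi>: "\<psi> \<in> test_functions"
      "\<And>\<xi>. fourier \<psi> \<xi> = complex_of_real (weight \<xi> ^ M) * fourier \<phi> \<xi>"
      by blast
    then show ?case
      using prod[OF \<psi>(1), of UNIV] by (auto simp: mult.assoc simp flip: weight_def)
  qed (use assms in auto)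
  then obtain \<psi> where \<psi>: "\<psi> \<in> test_functions"
    and eq: "\<And>\<xi>. fourier \<psi> \<xi> = complex_of_real (weight \<xi> ^ M) * fourier \<phi> \<xi>"
    by blast
  have "weight \<xi> ^ M * cmod (fourier \<phi> \<xi>) = cmod (fourier \<psi> \<xi>)" for \<xi>
    using weight_ge_1[of \<xi>] by (simp add: eq norm_mult norm_power)
  then show ?thesis
    using fourier_le_L1 by metis
qed

lemma nn_integral_weight:
  "(\<integral>\<^sup>+\<xi>. ennreal (inverse (weight (\<xi> :: real^'n::finite))) \<partial>lborel) < \<infinity>"
proof -
  have B: "(Basis :: (real^'n) set) = range (\<lambda>i. axis i 1)"
    by (auto simp: Basis_vec_def)
  have w: "ennreal (inverse (weight \<xi>)) = (\<Prod>b\<in>Basis. ennreal (inverse (1 + (\<xi> \<bullet> b)\<^sup>2)))"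
    for \<xi> :: "real^'n"
  proof -
    have "(\<Prod>b\<in>Basis. inverse (1 + (\<xi> \<bullet> b)\<^sup>2)) = inverse (weight \<xi>)"
      unfolding B weight_def
      by (subst prod.reindex) (auto simp: inj_on_def axis_eq_axis inner_axis prod_inversef[symmetric] comp_def)
    then show ?thesis
      by (simp add: prod_ennreal)
  qed
  have "integrable lborel (\<lambda>t::real. inverse (1 + t\<^sup>2))"
    using integrable_inverse_1_plus_square by (simp add: set_integrable_def)
  then have "(\<integral>\<^sup>+t. ennreal (inverse (1 + t\<^sup>2)) \<partial>lborel) < \<infinity>"
    by (simp add: integrable_iff_bounded)
  then show ?thesis
    unfolding w by (subst nn_integral_lborel_prod) (auto simp: power_less_top_ennreal)
qed

text \<open>Comparison with an integral: consecutive differences of \<open>arctan\<close> telescope,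
  and their total is less than \<open>pi\<close>, whatever \<open>N\<close> and \<open>t\<close>
  are.\<close>

lemma sum_inverse_shifted_squares:
  "(\<Sum>l<N. inverse (1 + (t - real l)\<^sup>2)) \<le> 3 * pi"
proof -
  \<comment> \<open>The factor 3 is the price of replacing the mean value point \<open>c\<close> by
    the left endpoint \<open>a\<close>: from \<open>\<bar>c\<bar> \<le> \<bar>a\<bar> + 1\<close>
    follows \<open>1 + c\<^sup>2 \<le> 3 * (1 + a\<^sup>2)\<close>.\<close>
  have step: "inverse (1 + a\<^sup>2) \<le> 3 * (arctan (a + 1) - arctan a)" for a :: real
  proof -
    obtain c where c: "a < c" "c < a + 1" "arctan (a + 1) - arctan a = inverse (1 + c\<^sup>2)"
      using MVT2[of a "a + 1" arctan "\<lambda>x. inverse (1 + x\<^sup>2)"] DERIV_arctan by auto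
    have "\<bar>c\<bar> \<le> \<bar>a\<bar> + 1"
      using c by linarith
    then have "c\<^sup>2 \<le> (\<bar>a\<bar> + 1)\<^sup>2"
      using power_mono[of "\<bar>c\<bar>" "\<bar>a\<bar> + 1" 2] by simp
    also have "\<dots> \<le> 2 * a\<^sup>2 + 2"
      using sum_squares_bound[of "\<bar>a\<bar>" 1] by (simp add: power2_sum)
    finally have "1 + c\<^sup>2 \<le> 3 * (1 + a\<^sup>2)"
      using zero_le_power2[of a] unfolding distrib_left by linarith
    moreover have "1 + c\<^sup>2 > 0" "1 + a\<^sup>2 > 0"
      by (auto simp: add_pos_nonneg)
    ultimately show ?thesis
      unfolding c(3) by (simp add: field_simps)
  qed
  have "(\<Sum>l<N. inverse (1 + (t - real l)\<^sup>2)) = (\<Sum>l<N. inverse (1 + (real l - t)\<^sup>2))"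
    by (simp add: power2_commute)
  also have "\<dots> \<le> (\<Sum>l<N. 3 * (arctan (real (Suc l) - t) - arctan (real l - t)))"
    by (intro sum_mono order_trans[OF step]) (simp add: algebra_simps)
  also have "\<dots> = 3 * (arctan (real N - t) - arctan (- t))"
    unfolding sum_distrib_left[symmetric]
    using sum_lessThan_telescope[of "\<lambda>l. arctan (real l - t)" N] by simp
  also have "\<dots> \<le> 3 * pi"
    using arctan_ubound[of "real N - t"] arctan_lbound[of "- t"]
    by (intro mult_left_mono) linarith+
  finally show ?thesis .
qed

section \<open>The Japanese bracket and Peetre's inequality\<close>

lemma japanese_ge_1: "japanese \<xi> \<ge> 1"
  by (simp add: japanese_def)

lemma japanese_pos: "japanese \<xi> > 0"
  using japanese_ge_1[of \<xi>] by linarith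

lemma japanese_sq: "(japanese \<xi>)\<^sup>2 = 1 + (norm \<xi>)\<^sup>2"
  by (simp add: japanese_def)

lemma japanese_minus [simp]: "japanese (- \<xi>) = japanese \<xi>"
  by (simp add: japanese_def)

lemma japanese_measurable [measurable]: "japanese \<in> borel_measurable borel"
  unfolding japanese_def[abs_def] by measurable

text \<open>Multiplying out the product gives 1, the sum of the squares, and further nonnegative
  terms.\<close>

lemma japanese_sq_le_weight: "(japanese \<xi>)\<^sup>2 \<le> weight \<xi>"
proof -
  have "1 + (\<Sum>i\<in>A. (\<xi> $ i)\<^sup>2) \<le> (\<Prod>i\<in>A. 1 + (\<xi> $ i)\<^sup>2)" for A
    using finite[of A]
  proof induction
    case (insert i A)
    have "0 \<le> (\<xi> $ i)\<^sup>2 * (\<Sum>i\<in>A. (\<xi> $ i)\<^sup>2)"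
      by (simp add: sum_nonneg)
    then have "1 + (\<Sum>j\<in>insert i A. (\<xi> $ j)\<^sup>2) \<le> (1 + (\<xi> $ i)\<^sup>2) * (1 + (\<Sum>j\<in>A. (\<xi> $ j)\<^sup>2))"
      using insert.hyps by (simp add: algebra_simps)
    also have "\<dots> \<le> (1 + (\<xi> $ i)\<^sup>2) * (\<Prod>j\<in>A. 1 + (\<xi> $ j)\<^sup>2)"
      using insert.IH by (intro mult_left_mono) auto
    finally show ?case
      using insert.hyps by simp
  qed simp
  from this[of UNIV] show ?thesis
    by (simp add: japanese_sq weight_def norm_vec_def L2_set_def sum_nonneg)
qed

lemma japanese_add_le: "japanese (\<xi> + \<eta>) \<le> 2 * (japanese \<xi> * japanese \<eta>)"
proof (rule power2_le_imp_le)
  have "(norm (\<xi> + \<eta>))\<^sup>2 \<le> (norm \<xi> + norm \<eta>)\<^sup>2"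
    by (simp add: norm_triangle_ineq)
  also have "\<dots> \<le> 2 * (norm \<xi>)\<^sup>2 + 2 * (norm \<eta>)\<^sup>2"
    using sum_squares_bound[of "norm \<xi>" "norm \<eta>"] by (simp add: power2_sum)
  finally have "1 + (norm (\<xi> + \<eta>))\<^sup>2 \<le> 4 * ((1 + (norm \<xi>)\<^sup>2) * (1 + (norm \<eta>)\<^sup>2))"
    using mult_nonneg_nonneg[of "(norm \<xi>)\<^sup>2" "(norm \<eta>)\<^sup>2"]
    by (simp add: algebra_simps)
      (smt (verit) mult_nonneg_nonneg zero_le_power2)
  then show "(japanese (\<xi> + \<eta>))\<^sup>2 \<le> (2 * (japanese \<xi> * japanese \<eta>))\<^sup>2"
    by (simp add: power_mult_distrib japanese_sq)
qed (use japanese_pos[of \<xi>] japanese_pos[of \<eta>] in simp)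

text \<open>Peetre's inequality: all dependence on \<xi> sits in a factor that the decay of a
  Fourier transform can absorb.\<close>

lemma peetre:
  "japanese (\<xi> + \<eta>) powr s \<le> 2 powr \<bar>s\<bar> * japanese \<xi> powr \<bar>s\<bar> * japanese \<eta> powr s"
proof (cases "s \<ge> 0")
  case True
  have "japanese (\<xi> + \<eta>) powr s \<le> (2 * (japanese \<xi> * japanese \<eta>)) powr s"
    using True japanese_pos[of "\<xi> + \<eta>"] by (intro powr_mono2 japanese_add_le) auto
  then show ?thesis
    using True japanese_pos[of \<xi>] japanese_pos[of \<eta>] by (simp add: powr_mult mult_ac)
next
  case False
  \<comment> \<open>For negative exponents the roles are exchanged: \<eta> is written as the sum of
    \<open>- \<xi>\<close> and \<open>\<xi> + \<eta>\<close>.\<close>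
  have "japanese \<eta> \<le> 2 * (japanese \<xi> * japanese (\<xi> + \<eta>))"
    using japanese_add_le[of "- \<xi>" "\<xi> + \<eta>"] by simp
  then have "(2 * (japanese \<xi> * japanese (\<xi> + \<eta>))) powr s \<le> japanese \<eta> powr s"
    using False japanese_pos[of \<eta>] by (intro powr_mono2') auto
  then have "(2 powr (- s) * japanese \<xi> powr (- s)) * (2 powr s * japanese \<xi> powr s * japanese (\<xi> + \<eta>) powr s)
      \<le> (2 powr (- s) * japanese \<xi> powr (- s)) * japanese \<eta> powr s"
    using japanese_pos[of \<xi>] japanese_pos[of "\<xi> + \<eta>"]
    by (intro mult_left_mono) (auto simp: powr_mult mult_ac)
  moreover have "(2 powr (- s) * japanese \<xi> powr (- s)) * (2 powr s * japanese \<xi> powr s * japanese (\<xi> + \<eta>) powr s)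
      = japanese (\<xi> + \<eta>) powr s"
    using japanese_pos[of \<xi>] by (simp add: powr_minus field_simps)
  ultimately show ?thesis
    using False by simp
qed

text \<open>After translation by \<theta>, Peetre's inequality pulls the order out at \<theta>, and
  the rapid decay of \<open>fourier \<phi>\<close> absorbs the growth that remains.\<close>

lemma nn_integral_fourier_japanese:
  fixes \<phi> :: "real^'n::finite \<Rightarrow> complex"
  assumes \<phi>: "\<phi> \<in> test_functions"
  shows "\<exists>C\<ge>0. \<forall>\<theta>. (\<integral>\<^sup>+\<xi>. ennreal (cmod (fourier \<phi> (\<xi> - \<theta>)) * japanese \<xi> powr (2 * r)) \<partial>lborel)
    \<le> ennreal (C * japanese \<theta> powr (2 * r))"
proof -
  note [measurable] = fourier_measurable[OF \<phi>]
  \<comment> \<open>The power \<open>\<bar>r\<bar>\<close> of the weight dominates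
    \<open>japanese \<xi> powr (2 * \<bar>r\<bar>)\<close>; one power more leaves the integrable
    factor \<open>inverse (weight \<xi>)\<close>.\<close>
  obtain M where M: "\<bar>r\<bar> + 1 \<le> real M"
    using real_arch_simple by blast
  obtain C where C: "\<And>\<xi>. weight \<xi> ^ M * cmod (fourier \<phi> \<xi>) \<le> C"
    using fourier_weight_decay[OF \<phi>] by blast
  have C0: "C \<ge> 0"
    using order_trans[OF _ C[of 0]] weight_pos[of "0::real^'n"] by simp
  obtain W where W0: "W \<ge> 0" and
    W: "(\<integral>\<^sup>+\<xi>. ennreal (inverse (weight (\<xi> :: real^'n))) \<partial>lborel) = ennreal W"
    using nn_integral_weight[where 'n = 'n] by (cases "\<integral>\<^sup>+\<xi>. ennreal (inverse (weight (\<xi> :: real^'n))) \<partial>lborel") auto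
  have wbound: "cmod (fourier \<phi> \<xi>) * japanese \<xi> powr (2 * \<bar>r\<bar>) \<le> C * inverse (weight \<xi>)" for \<xi>
  proof -
    have "japanese \<xi> powr (2 * \<bar>r\<bar>) = ((japanese \<xi>)\<^sup>2) powr \<bar>r\<bar>"
      using japanese_pos[of \<xi>] by (simp add: powr_powr flip: powr_numeral)
    also have "\<dots> \<le> weight \<xi> powr \<bar>r\<bar>"
      by (intro powr_mono2 japanese_sq_le_weight) auto
    also have "\<dots> \<le> weight \<xi> powr (real M - 1)"
      using M by (intro powr_mono weight_ge_1) auto
    also have "\<dots> = weight \<xi> ^ M * inverse (weight \<xi>)"
      using weight_pos[of \<xi>] by (simp add: powr_diff powr_realpow divide_inverse)
    finally have "cmod (fourier \<phi> \<xi>) * japanese \<xi> powr (2 * \<bar>r\<bar>)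
        \<le> cmod (fourier \<phi> \<xi>) * (weight \<xi> ^ M * inverse (weight \<xi>))"
      by (intro mult_left_mono) auto
    also have "\<dots> = (weight \<xi> ^ M * cmod (fourier \<phi> \<xi>)) * inverse (weight \<xi>)"
      by simp
    also have "\<dots> \<le> C * inverse (weight \<xi>)"
      using C weight_pos[of \<xi>] by (intro mult_right_mono) auto
    finally show ?thesis .
  qed
  have "(\<integral>\<^sup>+\<xi>. ennreal (cmod (fourier \<phi> (\<xi> - \<theta>)) * japanese \<xi> powr (2 * r)) \<partial>lborel)
      \<le> ennreal (2 powr \<bar>2 * r\<bar> * C * W * japanese \<theta> powr (2 * r))" for \<theta>
  proof -
    have "(\<integral>\<^sup>+\<xi>. ennreal (cmod (fourier \<phi> (\<xi> - \<theta>)) * japanese \<xi> powr (2 * r)) \<partial>lborel)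
        = (\<integral>\<^sup>+\<xi>. ennreal (cmod (fourier \<phi> \<xi>) * japanese (\<theta> + \<xi>) powr (2 * r)) \<partial>lborel)"
      by (subst lborel_distr_plus[of \<theta>, symmetric]) (simp add: nn_integral_distr)
    also have "\<dots> \<le> (\<integral>\<^sup>+\<xi>. ennreal (2 powr \<bar>2 * r\<bar> * C * japanese \<theta> powr (2 * r)) *
        ennreal (inverse (weight (\<xi> :: real^'n))) \<partial>lborel)"
    proof (intro nn_integral_mono)
      fix \<xi> :: "real^'n"
      have "cmod (fourier \<phi> \<xi>) * japanese (\<theta> + \<xi>) powr (2 * r)
        \<le> cmod (fourier \<phi> \<xi>) * (2 powr \<bar>2 * r\<bar> * japanese \<xi> powr \<bar>2 * r\<bar> * japanese \<theta> powr (2 * r))"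
        using peetre[of \<xi> \<theta> "2 * r"] by (intro mult_left_mono) (auto simp: add.commute)
      also have "\<dots> = 2 powr \<bar>2 * r\<bar> * japanese \<theta> powr (2 * r) * (cmod (fourier \<phi> \<xi>) * japanese \<xi> powr (2 * \<bar>r\<bar>))"
        by (simp add: abs_mult)
      also have "\<dots> \<le> 2 powr \<bar>2 * r\<bar> * japanese \<theta> powr (2 * r) * (C * inverse (weight \<xi>))"
        by (intro mult_left_mono wbound) auto
      finally show "ennreal (cmod (fourier \<phi> \<xi>) * japanese (\<theta> + \<xi>) powr (2 * r))
        \<le> ennreal (2 powr \<bar>2 * r\<bar> * C * japanese \<theta> powr (2 * r)) * ennreal (inverse (weight \<xi>))"
        using C0 weight_pos[of \<xi>] by (simp add: ennreal_mult'[symmetric] mult_ac)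
    qed
    also have "\<dots> = ennreal (2 powr \<bar>2 * r\<bar> * C * W * japanese \<theta> powr (2 * r))"
      using C0 W0 unfolding weight_def by (subst nn_integral_cmult)
        (auto simp: W[unfolded weight_def] ennreal_mult'[symmetric] mult_ac)
    finally show ?thesis .
  qed
  then show ?thesis
    using C0 W0 by (intro exI[of _ "2 powr \<bar>2 * r\<bar> * C * W"]) auto
qed

section \<open>Bump functions\<close>

text \<open>The function \<open>exp (- 1 / t)\<close> continued by 0. The powers of
  \<open>1 / t\<close> that differentiation produces are carried in \<open>k\<close>, so that
  derivatives are linear combinations of members of the family.\<close>

definition flat :: "nat \<Rightarrow> real \<Rightarrow> real" where
  "flat k t = (if t > 0 then exp (- inverse t) * inverse t ^ k else 0)"

lemma flat_tendsto_0: "(flat k \<longlongrightarrow> 0) (at 0)"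
proof (rule filterlim_split_at)
  show "(flat k \<longlongrightarrow> 0) (at_left 0)"
    by (rule tendsto_eventually) (auto simp: flat_def eventually_at_filter)
  have "((\<lambda>t::real. inverse t ^ k / exp (inverse t)) \<longlongrightarrow> 0) (at_right 0)"
    by (rule filterlim_compose[OF tendsto_power_div_exp_0 filterlim_inverse_at_top_right])
  then show "(flat k \<longlongrightarrow> 0) (at_right 0)"
    by (rule Lim_transform_eventually)
      (auto simp: flat_def eventually_at_filter exp_minus divide_inverse mult.commute)
qed

lemma flat_has_derivative:
  "(flat k has_real_derivative (flat (k + 2) t - real k * flat (k + 1) t)) (at t)"
proof -
  consider "t < 0" | "t = 0" | "t > 0"
    by linarith
  then show ?thesis
  proof cases
    case 1
    have "(flat k has_real_derivative 0) (at t)"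
      by (rule has_field_derivative_transform_within_open[OF DERIV_const, where S = "{..<0}"])
        (use 1 in \<open>auto simp: flat_def\<close>)
    then show ?thesis
      using 1 by (simp add: flat_def)
  next
    case 2
    \<comment> \<open>Dividing by \<open>h\<close> amounts to raising \<open>k\<close>, so that
      differentiability at 0 reduces to \<open>flat_tendsto_0\<close> for the next index.\<close>
    have "(flat k (0 + h) - flat k 0) / h = flat (Suc k) h" for h
      by (simp add: flat_def divide_inverse)
    then have "(flat k has_real_derivative 0) (at 0)"
      using flat_tendsto_0[of "Suc k"] by (simp add: DERIV_def)
    then show ?thesis
      using 2 by (simp add: flat_def)
  next
    case 3
    have "((\<lambda>t. exp (- inverse t) * inverse t ^ k) has_real_derivative
        (flat (k + 2) t - real k * flat (k + 1) t)) (at t)"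
      using 3 by (cases k) (auto intro!: derivative_eq_intros
          simp: flat_def power2_eq_square algebra_simps, metis One_nat_def power_eq_if)
    then show ?thesis
      by (rule has_field_derivative_transform_within_open[where S = "{0<..}"])
        (use 3 in \<open>auto simp: flat_def\<close>)
  qed
qed

text \<open>The squared distance keeps the argument of \<open>flat\<close> polynomial, hence smooth
  at the centre. The cutoff itself is \<open>bump 0\<close>; larger \<open>k\<close> arise in its
  derivatives.\<close>

definition bump :: "nat \<Rightarrow> real \<Rightarrow> real^'n::finite \<Rightarrow> real^'n \<Rightarrow> complex" where
  "bump k \<epsilon> a x = complex_of_real (flat k (\<epsilon>\<^sup>2 - (x - a) \<bullet> (x - a)))"

lemma bump_has_derivative:
  fixes a :: "real^'n::finite"
  shows "(bump k \<epsilon> a has_derivative (\<lambda>h. complex_of_real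
    (- (2 * (h \<bullet> (x - a))) * (flat (k + 2) (\<epsilon>\<^sup>2 - (x - a) \<bullet> (x - a)) -
      real k * flat (k + 1) (\<epsilon>\<^sup>2 - (x - a) \<bullet> (x - a)))))) (at x)"
proof -
  have "((\<lambda>x. \<epsilon>\<^sup>2 - (x - a) \<bullet> (x - a)) has_derivative (\<lambda>h. - (2 * (h \<bullet> (x - a))))) (at x)"
    by (auto intro!: derivative_eq_intros simp: inner_commute)
  from has_derivative_of_real[OF has_derivative_compose[OF this
      flat_has_derivative[unfolded has_field_derivative_def]]]
  show ?thesis
    unfolding bump_def[abs_def] by (simp add: mult.commute)
qed

text \<open>Smooth coefficients times \<open>bump k\<close> form a class whose partial derivatives
  are sums of members: the inner derivative is a linear factor, and differentiating
  \<open>flat\<close> raises \<open>k\<close>.\<close>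

lemma smooth_bump: "smooth (bump 0 \<epsilon> (a :: real^'n::finite))"
proof -
  let ?A = "{\<lambda>x. g x * bump k \<epsilon> a x |g k. smooth g}"
  have coord: "smooth (\<lambda>x. complex_of_real ((x - a) $ i))" for i
  proof -
    have "smooth (\<lambda>x. complex_of_real (x $ i))"
      by (intro smooth_linear bounded_linear_compose[OF bounded_linear_of_real]
          bounded_linear_vec_nth)
    from smooth_add[OF this smooth_const[of "- complex_of_real (a $ i)"]] show ?thesis
      by simp
  qed
  have diff: "h differentiable (at x)" if "h \<in> ?A" for h x
    using that smooth_differentiable differentiableI[OF bump_has_derivative]
    by (auto intro!: differentiable_mult)
  have deriv: "partial_deriv i h \<in> add_span ?A" if h: "h \<in> ?A" for h i
  proof -
    obtain g k where g: "smooth g" and h: "h = (\<lambda>x. g x * bump k \<epsilon> a x)"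
      using h by auto
    let ?c = "\<lambda>x. complex_of_real ((x - a) $ i)"
    have "partial_deriv i h x = partial_deriv i g x * bump k \<epsilon> a x +
        (((- 2) * (g x * ?c x)) * bump (k + 2) \<epsilon> a x +
         ((2 * of_nat k) * (g x * ?c x)) * bump (k + 1) \<epsilon> a x)" for x
      unfolding h partial_deriv_mult[OF smooth_differentiable[OF g]
          differentiableI[OF bump_has_derivative]] partial_deriv_eq[OF bump_has_derivative]
      by (simp add: bump_def inner_axis' algebra_simps)
    then have "partial_deriv i h = (\<lambda>x. partial_deriv i g x * bump k \<epsilon> a x +
        (((- 2) * (g x * ?c x)) * bump (k + 2) \<epsilon> a x +
         ((2 * of_nat k) * (g x * ?c x)) * bump (k + 1) \<epsilon> a x))"
      by blast
    moreover have "(\<lambda>x. partial_deriv i g x * bump k \<epsilon> a x) \<in> ?A"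
      using smooth_partial_deriv[OF g] by blast
    moreover have "(\<lambda>x. (b * (g x * ?c x)) * bump j \<epsilon> a x) \<in> ?A" for b j
    proof -
      have "smooth (\<lambda>x. b * (g x * ?c x))"
        by (intro smooth_mult smooth_const g coord)
      then show ?thesis
        by (intro CollectI exI[of _ "\<lambda>x. b * (g x * ?c x)"] exI[of _ j] conjI refl)
    qed
    ultimately show ?thesis
      by (simp only:) (intro add_span.intros)
  qed
  have "(\<lambda>x. 1 * bump 0 \<epsilon> a x) \<in> ?A"
    by (intro CollectI exI[of _ "\<lambda>x. 1"] exI[of _ 0] conjI refl smooth_const)
  from add_span_smooth[of ?A, OF diff deriv add_span.base[OF this]] show ?thesis
    by simp
qed

lemma bump_nonneg: "bump k \<epsilon> a x = complex_of_real (cmod (bump k \<epsilon> a x))"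
  by (simp add: bump_def flat_def)

lemma bump_center: "\<epsilon> > 0 \<Longrightarrow> bump k \<epsilon> a a \<noteq> 0"
  by (simp add: bump_def flat_def)

lemma supp_bump: "\<epsilon> > 0 \<Longrightarrow> supp (bump k \<epsilon> a) \<subseteq> cball a \<epsilon>"
proof (rule supp_subset)
  fix x assume "\<epsilon> > 0" "bump k \<epsilon> a x \<noteq> 0"
  then have "(norm (x - a))\<^sup>2 < \<epsilon>\<^sup>2"
    by (auto simp: bump_def flat_def dot_square_norm split: if_splits)
  then show "x \<in> cball a \<epsilon>"
    using \<open>\<epsilon> > 0\<close> by (simp add: power_less_imp_less_base[of _ 2] less_imp_le dist_norm norm_minus_commute)
qed simp

lemma bump_test_function: "\<epsilon> > 0 \<Longrightarrow> bump 0 \<epsilon> a \<in> test_functions"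
  using test_functionsI[OF smooth_bump compact_cball supp_bump] .

text \<open>A nonnegative function has no cancellation at frequency 0; its integral is positive
  because it is nonzero throughout an open ball.\<close>

lemma fourier_bump_0:
  assumes "\<epsilon> > 0"
  shows "cmod (fourier (bump 0 \<epsilon> a) 0) = (LINT x|lborel. cmod (bump 0 \<epsilon> a x))"
    and "0 < (LINT x|lborel. cmod (bump 0 \<epsilon> a x))"
proof -
  let ?I = "LINT x|lborel. cmod (bump 0 \<epsilon> a x)"
  have "fourier (bump 0 \<epsilon> a) 0 = (LINT x|lborel. complex_of_real (cmod (bump 0 \<epsilon> a x)))"
    by (simp add: fourier_def plane_wave_def flip: bump_nonneg)
  then show "cmod (fourier (bump 0 \<epsilon> a) 0) = ?I"
    by simp
  have meas: "{x. bump 0 \<epsilon> a x \<noteq> 0} \<in> sets borel"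
    by (intro borel_open open_Collect_neq smooth_continuous_on smooth_bump continuous_on_const)
  have "?I \<noteq> 0"
  proof
    assume "?I = 0"
    moreover have "integrable lborel (\<lambda>x. cmod (bump 0 \<epsilon> a x))"
      by (intro integrable_norm test_function_integrable bump_test_function assms)
    ultimately have "AE x in lborel. bump 0 \<epsilon> a x = 0"
      by (simp add: integral_nonneg_eq_0_iff_AE)
    then have "emeasure lborel {x. bump 0 \<epsilon> a x \<noteq> 0} = 0"
      using AE_iff_measurable[OF _ refl, of lborel "\<lambda>x. bump 0 \<epsilon> a x = 0"] meas by simp
    moreover have "ball a \<epsilon> \<subseteq> {x. bump 0 \<epsilon> a x \<noteq> 0}"
    proof
      fix x assume "x \<in> ball a \<epsilon>"
      then have "(norm (x - a))\<^sup>2 < \<epsilon>\<^sup>2"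
        using power_strict_mono[of "norm (x - a)" \<epsilon> 2] by (simp add: dist_norm norm_minus_commute)
      then show "x \<in> {x. bump 0 \<epsilon> a x \<noteq> 0}"
        by (simp add: bump_def flat_def dot_square_norm)
    qed
    ultimately have "emeasure lborel (ball a \<epsilon>) = 0"
      using emeasure_mono[of "ball a \<epsilon>" "{x. bump 0 \<epsilon> a x \<noteq> 0}" lborel] meas by auto
    then show False
      using content_ball_pos[OF assms, of a] by (simp add: measure_def)
  qed
  then show "0 < ?I"
    by (simp add: less_le)
qed

lemma fourier_bump_lower_bound:
  assumes "\<epsilon> > 0"
  shows "\<exists>c>0. \<exists>\<delta>>0. \<forall>\<xi>. norm \<xi> \<le> \<delta> \<longrightarrow> c \<le> cmod (fourier (bump 0 \<epsilon> (0 :: real^'n::finite)) \<xi>)"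
proof -
  let ?\<phi> = "bump 0 \<epsilon> (0 :: real^'n)"
  let ?I = "LINT x|lborel. cmod (?\<phi> x)"
  note test = bump_test_function[OF assms, of "0 :: real^'n"]
  \<comment> \<open>On the support, where \<open>norm x \<le> \<epsilon>\<close>, this radius keeps
    the phase \<open>x \<bullet> \<xi>\<close> at most 1/2 in modulus, so that passing from
    frequency 0 to \<xi> loses at most half of \<open>?I\<close>.\<close>
  have "?I / 2 \<le> cmod (fourier ?\<phi> \<xi>)" if \<xi>: "norm \<xi> \<le> 1 / (2 * \<epsilon>)" for \<xi>
  proof -
    have "fourier ?\<phi> \<xi> - fourier ?\<phi> 0
        = (LINT x|lborel. (plane_wave (- \<xi>) x * ?\<phi> x - plane_wave (- 0) x * ?\<phi> x))"
      unfolding fourier_def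
      by (intro Bochner_Integration.integral_diff[symmetric] plane_wave_integrable test)
    also have "cmod \<dots> \<le> (LINT x|lborel. cmod (plane_wave (- \<xi>) x * ?\<phi> x - plane_wave (- 0) x * ?\<phi> x))"
      by (rule integral_norm_bound)
    also have "\<dots> \<le> (LINT x|lborel. cmod (?\<phi> x) * (1 / 2))"
    proof (intro integral_mono integrable_norm Bochner_Integration.integrable_diff
        plane_wave_integrable test integrable_mult_left test_function_integrable)
      fix x
      have "cmod (plane_wave (- \<xi>) x * ?\<phi> x - plane_wave (- 0) x * ?\<phi> x)
          = cmod (?\<phi> x) * cmod (plane_wave (- \<xi>) x - 1)"
        by (simp add: plane_wave_def flip: norm_mult) (simp add: algebra_simps)
      also have "\<dots> \<le> cmod (?\<phi> x) * (1 / 2)"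
      proof (cases "x \<in> cball 0 \<epsilon>")
        case True
        have "cmod (plane_wave (- \<xi>) x - 1) \<le> \<bar>x \<bullet> (- \<xi>)\<bar>"
          unfolding plane_wave_def dist_exp_i_1 using abs_sin_x_le_abs_x[of "(x \<bullet> (- \<xi>)) / 2"] by simp
        also have "\<dots> \<le> norm x * norm \<xi>"
          using Cauchy_Schwarz_ineq2[of x "- \<xi>"] by simp
        also have "\<dots> \<le> \<epsilon> * (1 / (2 * \<epsilon>))"
          using True \<xi> assms by (intro mult_mono) auto
        finally show ?thesis
          using assms by (intro mult_left_mono) auto
      next
        case False
        then have "?\<phi> x = 0"
          using supp_bump[OF assms] by (intro supp_vanishes) blast
        then show ?thesis by simp
      qed
      finally show "cmod (plane_wave (- \<xi>) x * ?\<phi> x - plane_wave (- 0) x * ?\<phi> x)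
        \<le> cmod (?\<phi> x) * (1 / 2)" .
    qed
    finally have "cmod (fourier ?\<phi> \<xi> - fourier ?\<phi> 0) \<le> ?I / 2"
      by simp
    moreover have "cmod (fourier ?\<phi> 0) - cmod (fourier ?\<phi> \<xi>) \<le> cmod (fourier ?\<phi> \<xi> - fourier ?\<phi> 0)"
      by (metis norm_minus_commute norm_triangle_ineq2)
    ultimately show ?thesis
      using fourier_bump_0(1)[OF assms, of "0 :: real^'n"] by linarith
  qed
  moreover have "?I / 2 > 0" "1 / (2 * \<epsilon>) > 0"
    using fourier_bump_0(2)[OF assms, of "0 :: real^'n"] assms by auto
  ultimately show ?thesis
    by blast
qed

section \<open>Trigonometric polynomials as distributions\<close>

lemma dist_of_fun_distribution:
  fixes g :: "real^'n::finite \<Rightarrow> complex"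
  assumes "smooth g"
  shows "dist_of_fun g \<in> distributions"
proof -
  have int: "integrable lborel (\<lambda>x. g x * \<phi> x)" if "\<phi> \<in> test_functions" for \<phi>
    using that assms by (intro test_function_integrable_mult smooth_continuous_on)
  have add: "dist_of_fun g (\<lambda>x. \<phi> x + \<psi> x) = dist_of_fun g \<phi> + dist_of_fun g \<psi>"
    if "\<phi> \<in> test_functions" "\<psi> \<in> test_functions" for \<phi> \<psi>
    using that by (simp add: dist_of_fun_def test_function_add distrib_left int)
  have scale: "dist_of_fun g (\<lambda>x. c * \<phi> x) = c * dist_of_fun g \<phi>" if "\<phi> \<in> test_functions" for c \<phi>
    using that by (simp add: dist_of_fun_def test_function_cmult mult.left_commute)
  have bound: "\<exists>C N. \<forall>\<phi>\<in>test_functions. supp \<phi> \<subseteq> K \<longrightarrow> cmod (dist_of_fun g \<phi>) \<le> C * C_norm N \<phi>"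
    if K: "compact K" for K
  proof -
    have "bounded (g ` K)"
      using K assms by (intro compact_imp_bounded compact_continuous_image smooth_continuous_on)
    then obtain B where B: "B > 0" "\<And>x. x \<in> K \<Longrightarrow> cmod (g x) \<le> B"
      by (auto simp: bounded_pos)
    have "cmod (dist_of_fun g \<phi>) \<le> (B * measure lborel K) * C_norm 0 \<phi>"
      if \<phi>: "\<phi> \<in> test_functions" "supp \<phi> \<subseteq> K" for \<phi>
    proof -
      have "cmod (dist_of_fun g \<phi>) \<le> (LINT x|lborel. cmod (g x * \<phi> x))"
        using \<phi> by (simp add: dist_of_fun_def del: norm_mult)
      also have "\<dots> \<le> (LINT x|lborel. B * cmod (\<phi> x))"
      proof (intro integral_mono integrable_norm int integrable_mult_right test_function_integrable \<phi>)
        fix x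
        show "cmod (g x * \<phi> x) \<le> B * cmod (\<phi> x)"
          using B \<phi> supp_vanishes[of x \<phi>]
          by (cases "x \<in> supp \<phi>") (auto simp: norm_mult intro!: mult_right_mono)
      qed
      also have "\<dots> = B * (LINT x|lborel. cmod (\<phi> x))"
        by simp
      also have "\<dots> \<le> B * (measure lborel K * C_norm 0 \<phi>)"
        using integral_iter_partial_le_C_norm[OF \<phi>(1) K \<phi>(2), of "[]" 0] B
        by (intro mult_left_mono) auto
      finally show ?thesis
        by simp
    qed
    then show ?thesis
      by blast
  qed
  have "continuous_test_seminorm (\<lambda>\<phi>. cmod (dist_of_fun g \<phi>))"
    unfolding continuous_test_seminorm_def
    using bound by (auto simp: add scale norm_mult norm_triangle_ineq)
  then show ?thesis
    unfolding distributions_def by (auto simp: add scale) (simp add: dist_of_fun_def)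
qed

text \<open>The sum runs over labels rather than over a set of frequencies: equal frequencies count
  with multiplicity, and no injectivity of \<theta> has to be tracked.\<close>

definition trig_poly :: "real \<Rightarrow> 'l set \<Rightarrow> ('l \<Rightarrow> real^'n::finite) \<Rightarrow> real^'n \<Rightarrow> complex" where
  "trig_poly a A \<theta> x = complex_of_real a * (\<Sum>l\<in>A. plane_wave (\<theta> l) x)"

lemma smooth_trig_poly: "smooth (trig_poly a A \<theta>)"
  unfolding trig_poly_def[abs_def]
  by (intro smooth_mult smooth_const smooth_sum smooth_plane_wave)

lemma plane_wave_mult: "plane_wave \<theta> x * plane_wave \<eta> x = plane_wave (\<theta> + \<eta>) x"
  by (simp add: plane_wave_def inner_add_right distrib_left exp_add)

lemma dist_of_trig_poly:
  assumes "\<phi> \<in> test_functions"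
  shows "dist_of_fun (trig_poly a A \<theta>) \<phi> = complex_of_real a * (\<Sum>l\<in>A. fourier \<phi> (- \<theta> l))"
proof -
  have "dist_of_fun (trig_poly a A \<theta>) \<phi>
      = (LINT x|lborel. complex_of_real a * (\<Sum>l\<in>A. plane_wave (\<theta> l) x * \<phi> x))"
    using assms by (simp add: dist_of_fun_def trig_poly_def sum_distrib_right mult.assoc)
  also have "\<dots> = complex_of_real a * (\<Sum>l\<in>A. LINT x|lborel. plane_wave (\<theta> l) x * \<phi> x)"
    using assms by (simp add: plane_wave_integrable)
  finally show ?thesis
    by (simp add: fourier_def)
qed

lemma local_fourier_plane_wave:
  "local_fourier \<phi> u \<xi> = u (\<lambda>x. plane_wave (- \<xi>) x * \<phi> x)"
  by (simp add: local_fourier_def plane_wave_def mult.commute)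

lemma local_fourier_test:
  "\<phi> \<in> test_functions \<Longrightarrow> (\<lambda>x. plane_wave \<xi> x * \<phi> x) \<in> test_functions"
  by (intro test_function_mult smooth_plane_wave)

lemma local_fourier_trig_poly:
  assumes "\<phi> \<in> test_functions"
  shows "local_fourier \<phi> (dist_of_fun (trig_poly a A \<theta>)) \<xi>
    = complex_of_real a * (\<Sum>l\<in>A. fourier \<phi> (\<xi> - \<theta> l))"
  by (simp add: local_fourier_plane_wave dist_of_trig_poly[OF local_fourier_test[OF assms]]
      fourier_def plane_wave_mult flip: mult.assoc)

lemma local_fourier_trig_poly_measurable:
  assumes "\<phi> \<in> test_functions"
  shows "local_fourier \<phi> (dist_of_fun (trig_poly a A \<theta>)) \<in> borel_measurable borel"
proof -
  note [measurable] = fourier_measurable[OF assms]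
  show ?thesis
    unfolding local_fourier_trig_poly[OF assms, abs_def] by measurable
qed

text \<open>
  The gain over the triangle inequality comes from the overlap bound \<open>S\<close>, which does not grow with
  the number of frequencies when they are separated.
\<close>

lemma sobolev_energy_trig_poly_le:
  fixes \<phi> :: "real^'n::finite \<Rightarrow> complex"
  assumes \<phi>: "\<phi> \<in> test_functions"
  obtains C where "C \<ge> 0"
    and "\<And>V a (A :: 'l set) \<theta> S. finite A \<Longrightarrow> \<forall>\<xi>. (\<Sum>l\<in>A. cmod (fourier \<phi> (\<xi> - \<theta> l))) \<le> S \<Longrightarrow>
      sobolev_energy r \<phi> V (dist_of_fun (trig_poly a A \<theta>))
        \<le> ennreal (a\<^sup>2 * S * (C * (\<Sum>l\<in>A. japanese (\<theta> l) powr (2 * r))))"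
proof -
  note [measurable] = fourier_measurable[OF \<phi>]
  obtain C where C0: "C \<ge> 0"
    and C: "\<And>\<theta>. (\<integral>\<^sup>+\<xi>. ennreal (cmod (fourier \<phi> (\<xi> - \<theta>)) * japanese \<xi> powr (2 * r)) \<partial>lborel)
      \<le> ennreal (C * japanese \<theta> powr (2 * r))"
    using nn_integral_fourier_japanese[OF \<phi>, of r] by blast
  show thesis
  proof (rule that[OF C0])
    fix V a S and A :: "'l set" and \<theta> :: "'l \<Rightarrow> real^'n"
    assume A: "finite A" and "\<forall>\<xi>. (\<Sum>l\<in>A. cmod (fourier \<phi> (\<xi> - \<theta> l))) \<le> S"
    then have S: "(\<Sum>l\<in>A. cmod (fourier \<phi> (\<xi> - \<theta> l))) \<le> S" for \<xi>
      by blast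
    have S0: "S \<ge> 0"
      using S[of 0] sum_nonneg[of A "\<lambda>l. cmod (fourier \<phi> (0 - \<theta> l))"] by simp
    let ?f = "\<lambda>l \<xi>. cmod (fourier \<phi> (\<xi> - \<theta> l)) * japanese \<xi> powr (2 * r)"
    have "sobolev_energy r \<phi> V (dist_of_fun (trig_poly a A \<theta>))
        \<le> (\<integral>\<^sup>+\<xi>. ennreal (a\<^sup>2 * S) * (\<Sum>l\<in>A. ennreal (?f l \<xi>)) \<partial>lborel)"
      unfolding sobolev_energy_def
    proof (intro nn_integral_mono)
      fix \<xi>
      let ?s = "\<Sum>l\<in>A. cmod (fourier \<phi> (\<xi> - \<theta> l))"
      have "(cmod (\<Sum>l\<in>A. fourier \<phi> (\<xi> - \<theta> l)))\<^sup>2 \<le> ?s\<^sup>2"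
        by (intro power_mono norm_sum) auto
      \<comment> \<open>Of the two factors of the square, one is spent on the pointwise bound
        \<open>S\<close>; the other remains a plain sum and is integrated wave by wave.\<close>
      also have "\<dots> \<le> S * ?s"
        unfolding power2_eq_square by (intro mult_right_mono S sum_nonneg) auto
      finally have "(cmod (local_fourier \<phi> (dist_of_fun (trig_poly a A \<theta>)) \<xi>))\<^sup>2 * japanese \<xi> powr (2 * r)
          \<le> (a\<^sup>2 * (S * ?s)) * japanese \<xi> powr (2 * r)"
        unfolding local_fourier_trig_poly[OF \<phi>] norm_mult power_mult_distrib
        by (intro mult_right_mono mult_mono) auto
      also have "\<dots> = a\<^sup>2 * S * (\<Sum>l\<in>A. ?f l \<xi>)"
        by (simp add: sum_distrib_right)
      finally have "ennreal ((cmod (local_fourier \<phi> (dist_of_fun (trig_poly a A \<theta>)) \<xi>))\<^sup>2 * japanese \<xi> powr (2 * r))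
          \<le> ennreal (a\<^sup>2 * S * (\<Sum>l\<in>A. ?f l \<xi>))"
        by (rule ennreal_leI)
      also have "\<dots> = ennreal (a\<^sup>2 * S) * (\<Sum>l\<in>A. ennreal (?f l \<xi>))"
        using S0 by (subst ennreal_mult') (auto simp: sum_nonneg)
      finally show "ennreal ((cmod (local_fourier \<phi> (dist_of_fun (trig_poly a A \<theta>)) \<xi>))\<^sup>2 * japanese \<xi> powr (2 * r))
          * indicator V \<xi> \<le> ennreal (a\<^sup>2 * S) * (\<Sum>l\<in>A. ennreal (?f l \<xi>))"
        by (auto simp: indicator_def)
    qed
    also have "\<dots> = ennreal (a\<^sup>2 * S) * (\<Sum>l\<in>A. \<integral>\<^sup>+\<xi>. ennreal (?f l \<xi>) \<partial>lborel)"
      by (subst nn_integral_cmult, measurable) (subst nn_integral_sum, auto)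
    also have "\<dots> \<le> ennreal (a\<^sup>2 * S) * (\<Sum>l\<in>A. ennreal (C * japanese (\<theta> l) powr (2 * r)))"
      by (intro mult_left_mono sum_mono C) auto
    also have "\<dots> = ennreal (a\<^sup>2 * S) * ennreal (C * (\<Sum>l\<in>A. japanese (\<theta> l) powr (2 * r)))"
      using C0 by (subst sum_ennreal) (auto simp: sum_distrib_left)
    also have "\<dots> = ennreal (a\<^sup>2 * S * (C * (\<Sum>l\<in>A. japanese (\<theta> l) powr (2 * r))))"
      using S0 by (simp add: ennreal_mult')
    finally show "sobolev_energy r \<phi> V (dist_of_fun (trig_poly a A \<theta>))
        \<le> ennreal (a\<^sup>2 * S * (C * (\<Sum>l\<in>A. japanese (\<theta> l) powr (2 * r))))" .
  qed
qed

lemma sobolev_energy_trig_poly_finite: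
  assumes "\<phi> \<in> test_functions" "finite A"
  shows "sobolev_energy r \<phi> V (dist_of_fun (trig_poly a A \<theta>)) < \<infinity>"
proof -
  obtain C where C: "\<And>V a S. (\<And>\<xi>. (\<Sum>l\<in>A. cmod (fourier \<phi> (\<xi> - \<theta> l))) \<le> S) \<Longrightarrow>
      sobolev_energy r \<phi> V (dist_of_fun (trig_poly a A \<theta>))
        \<le> ennreal (a\<^sup>2 * S * (C * (\<Sum>l\<in>A. japanese (\<theta> l) powr (2 * r))))"
    using sobolev_energy_trig_poly_le[OF assms(1)] assms(2) by metis
  have "(\<Sum>l\<in>A. cmod (fourier \<phi> (\<xi> - \<theta> l))) \<le> real (card A) * (LINT x|lborel. cmod (\<phi> x))" for \<xi>
    by (intro sum_bounded_above fourier_le_L1)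
  from C[OF this] show ?thesis
    by (rule order.strict_trans1) simp
qed

text \<open>Energies are finite even over the whole frequency space, so \<open>UNIV\<close> serves
  as the cone for every direction. Hence these distributions lie in the space of
  \<open>wave_front_topology r L\<close> for every \<open>L\<close>.\<close>

lemma wave_front_trig_poly:
  assumes "finite A"
  shows "wave_front r (dist_of_fun (trig_poly a A \<theta>)) = {}"
proof -
  have "\<exists>V \<phi>. open V \<and> pos_cone V \<and> \<xi> \<in> V \<and> \<phi> \<in> test_functions \<and> \<phi> x \<noteq> 0 \<and>
      sobolev_energy r \<phi> V (dist_of_fun (trig_poly a A \<theta>)) < \<infinity>" for x \<xi>
    using sobolev_energy_trig_poly_finite[OF bump_test_function assms, of 1] bump_center[of 1 0 x]
      bump_test_function[of 1 x]
    by (intro exI[of _ UNIV] exI[of _ "bump 0 1 x"]) (auto simp: pos_cone_def)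
  then show ?thesis
    unfolding wave_front_def by blast
qed

text \<open>Decay in the coordinates \<open>J\<close> bounds the sum over the box by a product of
  one-dimensional sums, each at most \<open>3 * pi\<close>. Neither the size of the box nor the
  other coordinates of \<theta> enter \<open>S\<close>.\<close>

lemma overlap_bound:
  fixes \<phi> :: "real^'n::finite \<Rightarrow> complex"
  assumes \<phi>: "\<phi> \<in> test_functions"
  obtains S where "S \<ge> 0"
    and "\<And>N \<theta> \<xi>. (\<And>l i. l \<in> J \<rightarrow>\<^sub>E {..<N} \<Longrightarrow> i \<in> J \<Longrightarrow> \<theta> l $ i = real (l i)) \<Longrightarrow>
      (\<Sum>l\<in>J \<rightarrow>\<^sub>E {..<N}. cmod (fourier \<phi> (\<xi> - \<theta> l))) \<le> S"
proof -
  obtain C where C: "\<And>\<xi>. weight \<xi> ^ 1 * cmod (fourier \<phi> \<xi>) \<le> C"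
    using fourier_weight_decay[OF \<phi>] by blast
  have C0: "C \<ge> 0"
    using order_trans[OF _ C[of 0]] weight_pos[of "0::real^'n"] by simp
  have "(\<Sum>l\<in>J \<rightarrow>\<^sub>E {..<N}. cmod (fourier \<phi> (\<xi> - \<theta> l))) \<le> C * (3 * pi) ^ card J"
    if \<theta>: "\<And>l i. l \<in> J \<rightarrow>\<^sub>E {..<N} \<Longrightarrow> i \<in> J \<Longrightarrow> \<theta> l $ i = real (l i)" for N \<theta> \<xi>
  proof -
    have "(\<Sum>l\<in>J \<rightarrow>\<^sub>E {..<N}. cmod (fourier \<phi> (\<xi> - \<theta> l)))
        \<le> (\<Sum>l\<in>J \<rightarrow>\<^sub>E {..<N}. C * (\<Prod>i\<in>J. inverse (1 + (\<xi> $ i - real (l i))\<^sup>2)))"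
    proof (rule sum_mono)
      fix l assume l: "l \<in> J \<rightarrow>\<^sub>E {..<N}"
      let ?\<zeta> = "\<xi> - \<theta> l"
      have "(\<Prod>i\<in>J. 1 + (?\<zeta> $ i)\<^sup>2) \<le> weight ?\<zeta>"
        unfolding weight_def by (rule prod_mono2) auto
      moreover have pos: "(\<Prod>i\<in>J. 1 + (?\<zeta> $ i)\<^sup>2) > 0"
        by (intro prod_pos) (auto simp: add_pos_nonneg)
      ultimately have "cmod (fourier \<phi> ?\<zeta>) * (\<Prod>i\<in>J. 1 + (?\<zeta> $ i)\<^sup>2) \<le> C"
        using C[of ?\<zeta>] mult_left_mono[of "\<Prod>i\<in>J. 1 + (?\<zeta> $ i)\<^sup>2" "weight ?\<zeta>" "cmod (fourier \<phi> ?\<zeta>)"]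
        by (simp add: mult.commute)
      with pos have "cmod (fourier \<phi> ?\<zeta>) \<le> C * inverse (\<Prod>i\<in>J. 1 + (?\<zeta> $ i)\<^sup>2)"
        by (simp add: field_simps)
      also have "(\<Prod>i\<in>J. 1 + (?\<zeta> $ i)\<^sup>2) = (\<Prod>i\<in>J. 1 + (\<xi> $ i - real (l i))\<^sup>2)"
        by (intro prod.cong) (auto simp: \<theta>[OF l])
      finally show "cmod (fourier \<phi> ?\<zeta>) \<le> C * (\<Prod>i\<in>J. inverse (1 + (\<xi> $ i - real (l i))\<^sup>2))"
        by (simp add: prod_inversef[symmetric] comp_def)
    qed
    also have "\<dots> = C * (\<Prod>i\<in>J. \<Sum>l<N. inverse (1 + (\<xi> $ i - real l)\<^sup>2))"
      by (subst prod_sum_PiE) (auto simp: sum_distrib_left)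
    also have "\<dots> \<le> C * (\<Prod>i\<in>J. 3 * pi)"
      using C0 by (intro mult_left_mono prod_mono conjI sum_inverse_shifted_squares sum_nonneg)
        (auto simp: add_nonneg_nonneg)
    finally show ?thesis
      by simp
  qed
  then show thesis
    using that[of "C * (3 * pi) ^ card J"] C0 by simp
qed

section \<open>Convergence in seminorm topologies\<close>

text \<open>The condition is tested at every centre \<open>u\<close>, not only at \<open>z\<close>:
  the elements of \<open>P\<close> are arbitrary functions here, and without a triangle inequality a
  ball around \<open>u\<close> containing \<open>z\<close> need not contain a ball around
  \<open>z\<close>.\<close>

lemma limitin_seminorm_topologyI:
  assumes "P \<noteq> {}" and X: "\<And>n. x n \<in> X" "z \<in> X"
    and conv: "\<And>p u \<epsilon>. p \<in> P \<Longrightarrow> u \<in> X \<Longrightarrow> p (z - u) < \<epsilon> \<Longrightarrow> \<forall>\<^sub>F n in sequentially. p (x n - u) < \<epsilon>"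
  shows "limitin (seminorm_topology X P) x z sequentially"
  unfolding limitin_def
proof (intro conjI allI impI)
  obtain p where p: "p \<in> P"
    using \<open>P \<noteq> {}\<close> by blast
  have "z \<in> {v \<in> X. p (v - z) < max 1 (p (z - z) + 1)}"
    using X by simp
  moreover have "max 1 (p (z - z) + 1) > (0 :: real)"
    by simp
  ultimately show "z \<in> topspace (seminorm_topology X P)"
    unfolding seminorm_topology_def topology_generated_by_topspace using p X(2) by blast
  fix U assume "openin (seminorm_topology X P) U \<and> z \<in> U"
  then have "generate_topology_on {{v \<in> X. p (v - u) < \<epsilon>} | p u \<epsilon>. p \<in> P \<and> u \<in> X \<and> \<epsilon> > 0} U" "z \<in> U"
    by (auto simp: seminorm_topology_def openin_topology_generated_by_iff)
  then show "\<forall>\<^sub>F n in sequentially. x n \<in> U"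
  proof (induction rule: generate_topology_on.induct)
    case (Int a b)
    then show ?case
      by (auto intro: eventually_conj)
  next
    case (UN K)
    then obtain k where "k \<in> K" "z \<in> k" "\<forall>\<^sub>F n in sequentially. x n \<in> k"
      by blast
    then show ?case
      by (auto elim: eventually_mono)
  next
    case (Basis s)
    then show ?case
      using X(1) by (auto dest: conv elim: eventually_mono)
  qed simp
qed

text \<open>Only the ball centred at the limit is used. As \<open>w - w\<close> is the function that
  is 0 everywhere, this is where \<open>p\<close> has to vanish.\<close>

lemma limitin_seminorm_topologyD:
  assumes lim: "limitin (seminorm_topology X P) y w F"
    and p: "p \<in> P" "p (\<lambda>\<phi>. 0) = 0" and "\<epsilon> > 0"
  shows "\<forall>\<^sub>F n in F. p (y n - w) < \<epsilon>"
proof -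
  let ?U = "{v \<in> X. p (v - w) < \<epsilon>}"
  have "w \<in> topspace (seminorm_topology X P)"
    using lim limitin_topspace by metis
  then have w: "w \<in> X"
    by (auto simp: seminorm_topology_def)
  have "openin (seminorm_topology X P) ?U"
    unfolding seminorm_topology_def using p(1) w \<open>\<epsilon> > 0\<close>
    by (intro topology_generated_by_Basis) blast
  moreover have "w - w = (\<lambda>\<phi>. 0)"
    by (simp add: fun_eq_iff)
  then have "w \<in> ?U"
    using w p(2) \<open>\<epsilon> > 0\<close> by simp
  ultimately have "\<forall>\<^sub>F n in F. y n \<in> ?U"
    using lim unfolding limitin_def by blast
  then show ?thesis
    by (rule eventually_mono) simp
qed

text \<open>Off the test functions its value is \<open>undefined\<close>, so that it need not
  coincide with \<open>\<lambda>\<phi>. 0\<close>.\<close>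

abbreviation zero_dist :: "'n::finite functional" where
  "zero_dist \<equiv> dist_of_fun (\<lambda>x. 0)"

lemma zero_dist_apply: "\<phi> \<in> test_functions \<Longrightarrow> zero_dist \<phi> = 0"
  by (simp add: dist_of_fun_def)

lemma zero_dist_distribution: "zero_dist \<in> distributions"
  by (intro dist_of_fun_distribution smooth_const)

section \<open>Stability of Sobolev and strong balls under small perturbations\<close>

lemma local_fourier_diff: "local_fourier \<phi> (u - v) \<xi> = local_fourier \<phi> u \<xi> - local_fourier \<phi> v \<xi>"
  by (simp add: local_fourier_def)

lemma local_fourier_zero_dist: "\<phi> \<in> test_functions \<Longrightarrow> local_fourier \<phi> zero_dist \<xi> = 0"
  by (simp add: local_fourier_plane_wave zero_dist_apply local_fourier_test)

text \<open>The function \<open>f\<close> need not be measurable: its integral is then a lower integral.\<close>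

lemma nn_integral_cmult_add_le:
  assumes g: "g \<in> borel_measurable M" "\<And>x. g x < top" and "c > 0"
  shows "(\<integral>\<^sup>+x. ennreal c * f x + g x \<partial>M) \<le> ennreal c * (\<integral>\<^sup>+x. f x \<partial>M) + (\<integral>\<^sup>+x. g x \<partial>M)"
  unfolding nn_integral_def[of M "\<lambda>x. ennreal c * f x + g x"]
proof (rule SUP_least, clarsimp)
  fix s assume s: "simple_function M s" "s \<le> (\<lambda>x. ennreal c * f x + g x)"
  note [measurable] = g(1) borel_measurable_simple_function[OF s(1)]
  \<comment> \<open>Solving \<open>s \<le> c * f + g\<close> for \<open>f\<close> by truncated
    subtraction yields a measurable function below \<open>f\<close>, to which additivity of the
    integral applies.\<close>
  define t where "t x = ennreal (1 / c) * (s x - g x)" for x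
  have t_measurable [measurable]: "t \<in> borel_measurable M"
    unfolding t_def[abs_def] by measurable
  have t_le: "t x \<le> f x" for x
  proof -
    have "s x \<le> g x + ennreal c * f x"
      using s(2) by (simp add: le_fun_def add.commute)
    then have "s x - g x \<le> ennreal c * f x"
      using g(2)[of x] by (auto simp: ennreal_minus_le_iff)
    then have "t x \<le> ennreal (1 / c) * (ennreal c * f x)"
      unfolding t_def by (intro mult_left_mono) auto
    also have "\<dots> = f x"
      using \<open>c > 0\<close> by (simp add: mult.assoc[symmetric] ennreal_mult'[symmetric])
    finally show ?thesis .
  qed
  have s_le: "s x \<le> ennreal c * t x + g x" for x
  proof -
    have "ennreal c * t x = s x - g x"
      unfolding t_def using \<open>c > 0\<close> by (simp add: mult.assoc[symmetric] ennreal_mult'[symmetric])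
    then show ?thesis
      by (simp add: diff_add_self_ennreal not_le less_imp_le)
  qed
  have "integral\<^sup>S M s = (\<integral>\<^sup>+x. s x \<partial>M)"
    by (simp add: nn_integral_eq_simple_integral s(1))
  also have "\<dots> \<le> (\<integral>\<^sup>+x. ennreal c * t x + g x \<partial>M)"
    by (intro nn_integral_mono s_le)
  also have "\<dots> = ennreal c * (\<integral>\<^sup>+x. t x \<partial>M) + (\<integral>\<^sup>+x. g x \<partial>M)"
    by (subst nn_integral_add) (auto simp: nn_integral_cmult)
  also have "\<dots> \<le> ennreal c * (\<integral>\<^sup>+x. f x \<partial>M) + (\<integral>\<^sup>+x. g x \<partial>M)"
    by (intro add_right_mono mult_left_mono nn_integral_mono t_le) auto
  finally show "integral\<^sup>S M s \<le> ennreal c * (\<integral>\<^sup>+x. f x \<partial>M) + (\<integral>\<^sup>+x. g x \<partial>M)" .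
qed

text \<open>Measurability is asked of \<open>v\<close> only, since \<open>u\<close> and
  \<open>w\<close> will involve an arbitrary centre. The elementary inequality with free \<delta>
  stands in for Minkowski's: the factor of the main term can be brought as close to 1 as a strict
  bound requires.\<close>

lemma sobolev_energy_triangle:
  assumes meas: "local_fourier \<phi> v \<in> borel_measurable borel" "V \<in> sets borel" and "\<delta> > 0"
    and le: "\<And>\<xi>. cmod (local_fourier \<phi> w \<xi>) \<le> cmod (local_fourier \<phi> u \<xi>) + cmod (local_fourier \<phi> v \<xi>)"
  shows "sobolev_energy r \<phi> V w \<le>
    ennreal (1 + \<delta>) * sobolev_energy r \<phi> V u + ennreal (1 + 1 / \<delta>) * sobolev_energy r \<phi> V v"
proof -
  note [measurable] = meas
  let ?e = "\<lambda>u \<xi>. (cmod (local_fourier \<phi> u \<xi>))\<^sup>2 * japanese \<xi> powr (2 * r)"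
  have square: "(a + b)\<^sup>2 \<le> (1 + \<delta>) * a\<^sup>2 + (1 + 1 / \<delta>) * b\<^sup>2" for a b :: real
  proof -
    have "0 \<le> (\<delta> * a - b)\<^sup>2 / \<delta>"
      using \<open>\<delta> > 0\<close> by simp
    then show ?thesis
      using \<open>\<delta> > 0\<close> by (simp add: power2_eq_square field_simps)
  qed
  have "sobolev_energy r \<phi> V w \<le> (\<integral>\<^sup>+\<xi>. ennreal (1 + \<delta>) * (ennreal (?e u \<xi>) * indicator V \<xi>) +
      ennreal (1 + 1 / \<delta>) * (ennreal (?e v \<xi>) * indicator V \<xi>) \<partial>lborel)"
    unfolding sobolev_energy_def
  proof (intro nn_integral_mono)
    fix \<xi>
    have "(cmod (local_fourier \<phi> w \<xi>))\<^sup>2 \<le> (cmod (local_fourier \<phi> u \<xi>) + cmod (local_fourier \<phi> v \<xi>))\<^sup>2"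
      using le by (intro power_mono) auto
    also note square
    finally have "?e w \<xi> \<le> ((1 + \<delta>) * (cmod (local_fourier \<phi> u \<xi>))\<^sup>2 +
        (1 + 1 / \<delta>) * (cmod (local_fourier \<phi> v \<xi>))\<^sup>2) * japanese \<xi> powr (2 * r)"
      by (intro mult_right_mono) auto
    also have "\<dots> = (1 + \<delta>) * ?e u \<xi> + (1 + 1 / \<delta>) * ?e v \<xi>"
      by (simp add: algebra_simps)
    finally have "ennreal (?e w \<xi>) \<le> ennreal (1 + \<delta>) * ennreal (?e u \<xi>) + ennreal (1 + 1 / \<delta>) * ennreal (?e v \<xi>)"
      using \<open>\<delta> > 0\<close> by (simp add: ennreal_mult'[symmetric] ennreal_plus[symmetric] del: ennreal_plus)
    then show "ennreal (?e w \<xi>) * indicator V \<xi> \<le> ennreal (1 + \<delta>) * (ennreal (?e u \<xi>) * indicator V \<xi>) +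
        ennreal (1 + 1 / \<delta>) * (ennreal (?e v \<xi>) * indicator V \<xi>)"
      by (auto simp: indicator_def)
  qed
  also have "\<dots> \<le> ennreal (1 + \<delta>) * sobolev_energy r \<phi> V u +
      (\<integral>\<^sup>+\<xi>. ennreal (1 + 1 / \<delta>) * (ennreal (?e v \<xi>) * indicator V \<xi>) \<partial>lborel)"
    unfolding sobolev_energy_def using \<open>\<delta> > 0\<close>
    by (intro nn_integral_cmult_add_le) (auto simp: ennreal_mult_less_top indicator_def)
  also have "(\<integral>\<^sup>+\<xi>. ennreal (1 + 1 / \<delta>) * (ennreal (?e v \<xi>) * indicator V \<xi>) \<partial>lborel)
      = ennreal (1 + 1 / \<delta>) * sobolev_energy r \<phi> V v"
    unfolding sobolev_energy_def by (intro nn_integral_cmult) measurable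
  finally show ?thesis .
qed

text \<open>
  If the energy of \<open>u\<close> is infinite, then so is that of \<open>x n - u\<close>, and both seminorms are \<open>0\<close>.
\<close>

lemma sobolev_seminorm_eventually:
  assumes \<phi>: "\<phi> \<in> test_functions" and V: "V \<in> sets borel"
    and meas: "\<And>n. local_fourier \<phi> (x n) \<in> borel_measurable borel"
    and lim: "((\<lambda>n. sobolev_energy r \<phi> V (x n)) \<longlongrightarrow> 0) sequentially"
    and less: "sobolev_seminorm r \<phi> V (zero_dist - u) < \<epsilon>"
  shows "\<forall>\<^sub>F n in sequentially. sobolev_seminorm r \<phi> V (x n - u) < \<epsilon>"
proof -
  let ?E = "sobolev_energy r \<phi> V"
  have le1: "?E (x n - u) \<le> ennreal (1 + \<delta>) * ?E (zero_dist - u) + ennreal (1 + 1 / \<delta>) * ?E (x n)"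
    if "\<delta> > 0" for n \<delta>
  proof (intro sobolev_energy_triangle meas V that)
    fix \<xi>
    show "cmod (local_fourier \<phi> (x n - u) \<xi>)
        \<le> cmod (local_fourier \<phi> (zero_dist - u) \<xi>) + cmod (local_fourier \<phi> (x n) \<xi>)"
      using norm_triangle_ineq4[of "local_fourier \<phi> (x n) \<xi>" "local_fourier \<phi> u \<xi>"]
      by (simp add: local_fourier_diff local_fourier_zero_dist[OF \<phi>] add.commute)
  qed
  \<comment> \<open>The same inequality read backwards; only finiteness is at stake here, so
    \<open>\<delta> = 1\<close> will do.\<close>
  have le2: "?E (zero_dist - u) \<le> ennreal (1 + 1) * ?E (x n - u) + ennreal (1 + 1 / 1) * ?E (x n)" for n
  proof (intro sobolev_energy_triangle meas V)
    fix \<xi>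
    show "cmod (local_fourier \<phi> (zero_dist - u) \<xi>)
        \<le> cmod (local_fourier \<phi> (x n - u) \<xi>) + cmod (local_fourier \<phi> (x n) \<xi>)"
      using norm_triangle_ineq4[of "local_fourier \<phi> (x n - u) \<xi>" "local_fourier \<phi> (x n) \<xi>"]
      by (simp add: local_fourier_diff local_fourier_zero_dist[OF \<phi>])
  qed simp
  show ?thesis
  proof (cases "?E (zero_dist - u)")
    case top
    have "\<forall>\<^sub>F n in sequentially. ?E (x n) < 1"
      using order_tendstoD(2)[OF lim, of 1] by simp
    then show ?thesis
    proof (rule eventually_mono)
      fix n assume "?E (x n) < 1"
      then have "?E (x n - u) = top"
        using le2[of n] top by (auto simp: top_unique ennreal_mult_eq_top_iff ennreal_add_eq_top)
      then show "sobolev_seminorm r \<phi> V (x n - u) < \<epsilon>"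
        using less top by (simp add: sobolev_seminorm_def)
    qed
  next
    case (real e)
    have sqrt: "sqrt e < \<epsilon>"
      using less real by (simp add: sobolev_seminorm_def)
    have \<epsilon>: "\<epsilon> > 0"
      using order.strict_trans1[OF real_sqrt_ge_zero[OF real(1)] sqrt] .
    have "e < \<epsilon>\<^sup>2"
      using sqrt real(1) \<epsilon> by (metis real_less_rsqrt real_sqrt_abs real_sqrt_less_iff abs_of_pos)
    \<comment> \<open>One half of the gap between \<open>e\<close> and
      \<open>\<epsilon>\<^sup>2\<close> is reserved for the excess factor
      \<open>1 + \<delta>\<close>, the other for the energy of \<open>x n\<close>.\<close>
    define \<eta> where "\<eta> = (\<epsilon>\<^sup>2 - e) / 2"
    have \<eta>: "\<eta> > 0"
      using \<open>e < \<epsilon>\<^sup>2\<close> by (simp add: \<eta>_def)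
    \<comment> \<open>The denominator \<open>e + 1\<close> covers the case
      \<open>e = 0\<close>.\<close>
    define \<delta> where "\<delta> = \<eta> / (e + 1)"
    have \<delta>: "\<delta> > 0"
      using \<eta> real(1) by (simp add: \<delta>_def)
    have \<delta>e: "(1 + \<delta>) * e \<le> e + \<eta>"
    proof -
      have "\<delta> * e \<le> \<delta> * (e + 1)"
        using \<delta> by simp
      also have "\<dots> = \<eta>"
        using real(1) by (simp add: \<delta>_def)
      finally show ?thesis
        by (simp add: algebra_simps)
    qed
    have "\<forall>\<^sub>F n in sequentially. ?E (x n) < ennreal (\<eta> / (1 + 1 / \<delta>))"
      using \<eta> \<delta> by (intro order_tendstoD(2)[OF lim]) (simp add: add_pos_pos)
    then show ?thesis
    proof (rule eventually_mono)
      fix n assume n: "?E (x n) < ennreal (\<eta> / (1 + 1 / \<delta>))"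
      then obtain b where b: "?E (x n) = ennreal b" "b \<ge> 0"
        by (cases "?E (x n)") auto
      with n have "b < \<eta> / (1 + 1 / \<delta>)"
        by (simp add: ennreal_less_iff)
      then have "(1 + 1 / \<delta>) * b < \<eta>"
        using \<delta> by (simp add: pos_less_divide_eq add_pos_pos mult.commute)
      then have "(1 + \<delta>) * e + (1 + 1 / \<delta>) * b < e + \<eta> + \<eta>"
        by (rule add_le_less_mono[OF \<delta>e])
      also have "\<dots> = \<epsilon>\<^sup>2"
        by (simp add: \<eta>_def field_simps)
      finally have "(1 + \<delta>) * e + (1 + 1 / \<delta>) * b < \<epsilon>\<^sup>2" .
      moreover have "?E (x n - u) \<le> ennreal ((1 + \<delta>) * e + (1 + 1 / \<delta>) * b)"
        using le1[OF \<delta>, of n] real b \<delta>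
        by (simp add: ennreal_mult'[symmetric] ennreal_plus[symmetric] del: ennreal_plus)
      then have "enn2real (?E (x n - u)) \<le> (1 + \<delta>) * e + (1 + 1 / \<delta>) * b"
        using real(1) b(2) \<delta> by (intro enn2real_leI) auto
      ultimately have "enn2real (?E (x n - u)) < \<epsilon>\<^sup>2"
        by linarith
      then show "sobolev_seminorm r \<phi> V (x n - u) < \<epsilon>"
        using \<epsilon> real_sqrt_less_mono[of _ "\<epsilon>\<^sup>2"] by (fastforce simp: sobolev_seminorm_def)
    qed
  qed
qed

lemma strong_seminorm_eventually:
  assumes p: "p \<in> strong_seminorms" and u: "u \<in> distributions"
    and lim: "\<And>B. bounded_test_set B \<Longrightarrow>
      \<exists>b. b \<longlonglongrightarrow> 0 \<and> (\<forall>n. \<forall>\<phi>\<in>B. cmod (x n \<phi>) \<le> b n)"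
    and less: "p (zero_dist - u) < \<epsilon>"
  shows "\<forall>\<^sub>F n in sequentially. p (x n - u) < \<epsilon>"
proof -
  obtain B where B: "bounded_test_set B" "B \<noteq> {}" and p_def: "p = (\<lambda>u. SUP \<phi>\<in>B. cmod (u \<phi>))"
    using p by (auto simp: strong_seminorms_def)
  obtain b where b: "b \<longlonglongrightarrow> 0" "\<And>n \<phi>. \<phi> \<in> B \<Longrightarrow> cmod (x n \<phi>) \<le> b n"
    using lim[OF B(1)] by blast
  \<comment> \<open>Continuity of \<open>u\<close> bounds its values on \<open>B\<close>, so that
    the \<open>SUP\<close> over them is a true supremum.\<close>
  have test: "B \<subseteq> test_functions" and bdd: "bdd_above ((\<lambda>\<phi>. cmod (u \<phi>)) ` B)"
    using B u by (auto simp: bounded_test_set_def distributions_def)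
  have z: "zero_dist \<phi> = 0" if "\<phi> \<in> B" for \<phi>
    using that test by (simp add: zero_dist_apply subset_iff)
  have "\<forall>\<^sub>F n in sequentially. b n < \<epsilon> - p (zero_dist - u)"
    using b(1) less by (intro order_tendstoD(2)) auto
  then show ?thesis
  proof (rule eventually_mono)
    fix n assume n: "b n < \<epsilon> - p (zero_dist - u)"
    have "p (x n - u) \<le> b n + p (zero_dist - u)"
      unfolding p_def
    proof (rule cSUP_least[OF B(2)])
      fix \<phi> assume \<phi>: "\<phi> \<in> B"
      have "cmod ((x n - u) \<phi>) \<le> cmod (x n \<phi>) + cmod (u \<phi>)"
        by (simp add: norm_triangle_ineq4)
      moreover have "cmod (u \<phi>) \<le> (SUP \<phi>\<in>B. cmod (u \<phi>))"
        by (rule cSUP_upper[OF \<phi> bdd])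
      moreover have "(SUP \<phi>\<in>B. cmod ((zero_dist - u) \<phi>)) = (SUP \<phi>\<in>B. cmod (u \<phi>))"
        by (rule SUP_cong) (simp_all add: z)
      ultimately show "cmod ((x n - u) \<phi>) \<le> b n + (SUP \<phi>\<in>B. cmod ((zero_dist - u) \<phi>))"
        using b(2)[OF \<phi>, of n] by linarith
    qed
    then show "p (x n - u) < \<epsilon>"
      using n by linarith
  qed
qed

section \<open>Concentrating trigonometric polynomials\<close>

text \<open>Extensional functions have their values off \<open>J\<close> fixed, so that each lattice
  point is counted once and the box is finite.\<close>

definition freq_box :: "'n::finite set \<Rightarrow> nat \<Rightarrow> ('n \<Rightarrow> nat) set" where
  "freq_box J N = J \<rightarrow>\<^sub>E {..<N}"

definition freq :: "'n::finite set \<Rightarrow> real^'n \<Rightarrow> nat \<Rightarrow> ('n \<Rightarrow> nat) \<Rightarrow> real^'n" where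
  "freq J \<eta> N l = (\<chi> i. if i \<in> J then real (l i) else real N * \<eta> $ i)"

text \<open>\<open>Suc n\<close> stands for \<open>N\<close>, which keeps the base of
  \<open>powr\<close> positive. The exponent hides a division by \<open>card (freq_box J N)\<close>:
  up to the amplitude \<open>N powr b\<close> this is an average of waves.\<close>

definition peak :: "'n::finite set \<Rightarrow> real^'n \<Rightarrow> real \<Rightarrow> nat \<Rightarrow> real^'n \<Rightarrow> complex" where
  "peak J \<eta> b n = trig_poly (real (Suc n) powr (b - card J)) (freq_box J (Suc n)) (freq J \<eta> (Suc n))"

lemma finite_freq_box [simp]: "finite (freq_box J N)"
  by (simp add: freq_box_def finite_PiE)

lemma card_freq_box: "card (freq_box J N) = N ^ card J"
  by (simp add: freq_box_def card_PiE)

lemma dist_of_peak_distribution: "dist_of_fun (peak J \<eta> b n) \<in> distributions"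
  unfolding peak_def by (intro dist_of_fun_distribution smooth_trig_poly)

lemma japanese_le: "japanese \<xi> \<le> 1 + norm \<xi>"
  unfolding japanese_def by (rule real_le_lsqrt) (auto simp: power2_sum)

lemma norm_le_japanese: "norm \<xi> \<le> japanese \<xi>"
  unfolding japanese_def by (rule real_le_rsqrt) simp

text \<open>The sign of \<open>s\<close> decides which endpoint gives which bound; the sum and the
  minimum of the two endpoint values serve both signs.\<close>

lemma powr_le_between:
  fixes a b x N s :: real
  assumes "0 < a" "a * N \<le> x" "x \<le> b * N" "0 < N"
  shows "x powr s \<le> (a powr s + b powr s) * N powr s"
    and "min (a powr s) (b powr s) * N powr s \<le> x powr s"
proof -
  have x: "0 < x"
    using mult_pos_pos[of a N] assms by linarith
  then have "0 < b * N"
    using assms by linarith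
  then have b: "0 < b"
    using \<open>0 < N\<close> by (simp add: zero_less_mult_iff)
  have eq: "(a * N) powr s = a powr s * N powr s" "(b * N) powr s = b powr s * N powr s"
    using assms b by (simp_all add: powr_mult)
  have "(a * N) powr s \<le> x powr s \<and> x powr s \<le> (b * N) powr s \<or>
      (b * N) powr s \<le> x powr s \<and> x powr s \<le> (a * N) powr s"
  proof (cases "s \<ge> 0")
    case True
    then have "(a * N) powr s \<le> x powr s" "x powr s \<le> (b * N) powr s"
      using assms x by (auto intro!: powr_mono2)
    then show ?thesis by blast
  next
    case False
    then have "(b * N) powr s \<le> x powr s" "x powr s \<le> (a * N) powr s"
      using assms x by (auto intro!: powr_mono2')
    then show ?thesis by blast
  qed
  then have *: "a powr s * N powr s \<le> x powr s \<and> x powr s \<le> b powr s * N powr s \<or>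
      b powr s * N powr s \<le> x powr s \<and> x powr s \<le> a powr s * N powr s"
    unfolding eq .
  have nn: "0 \<le> a powr s * N powr s" "0 \<le> b powr s * N powr s"
    by auto
  show "x powr s \<le> (a powr s + b powr s) * N powr s"
    using * nn unfolding distrib_right by linarith
  have "min (a powr s) (b powr s) * N powr s \<le> a powr s * N powr s"
    "min (a powr s) (b powr s) * N powr s \<le> b powr s * N powr s"
    by (intro mult_right_mono; simp)+
  then show "min (a powr s) (b powr s) * N powr s \<le> x powr s"
    using * by linarith
qed

lemma freq_japanese_le:
  assumes "l \<in> freq_box J N" "N \<ge> 1"
  shows "japanese (freq J \<eta> N l) \<le> (1 + (\<Sum>i\<in>UNIV. 1 + \<bar>\<eta> $ i\<bar>)) * real N"
proof -
  have "norm (freq J \<eta> N l) \<le> (\<Sum>i\<in>UNIV. \<bar>freq J \<eta> N l $ i\<bar>)"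
    by (rule norm_le_l1_cart)
  also have "\<dots> \<le> (\<Sum>i\<in>UNIV. (1 + \<bar>\<eta> $ i\<bar>) * real N)"
  proof (rule sum_mono)
    fix i
    show "\<bar>freq J \<eta> N l $ i\<bar> \<le> (1 + \<bar>\<eta> $ i\<bar>) * real N"
    proof (cases "i \<in> J")
      case True
      then have "real (l i) \<le> 1 * real N"
        using assms(1) by (fastforce simp: freq_box_def PiE_iff)
      also have "\<dots> \<le> (1 + \<bar>\<eta> $ i\<bar>) * real N"
        by (intro mult_right_mono) auto
      finally show ?thesis
        using True by (simp add: freq_def)
    qed (simp add: freq_def abs_mult algebra_simps)
  qed
  finally have "norm (freq J \<eta> N l) \<le> (\<Sum>i\<in>UNIV. 1 + \<bar>\<eta> $ i\<bar>) * real N"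
    by (simp add: sum_distrib_right)
  then show ?thesis
    using japanese_le[of "freq J \<eta> N l"] assms(2) by (simp add: distrib_right)
qed

text \<open>If \<eta> is not 0, some coordinate outside \<open>J\<close> has size \<open>N\<close>,
  and all brackets are comparable to \<open>N\<close>. If \<eta> is 0, the box contains the
  frequency 0, whose bracket stays 1; hence the alternative \<open>r \<ge> 0\<close>.\<close>

lemma sum_freq_japanese_le:
  fixes r :: real
  assumes "\<And>i. i \<in> J \<Longrightarrow> \<eta> $ i = 0" and "\<eta> \<noteq> 0 \<or> r \<ge> 0"
  obtains C where "C \<ge> 0"
    and "\<And>N. N \<ge> 1 \<Longrightarrow> (\<Sum>l\<in>freq_box J N. japanese (freq J \<eta> N l) powr (2 * r))
      \<le> C * real N powr (card J + 2 * r)"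
proof -
  let ?b = "1 + (\<Sum>i\<in>UNIV. 1 + \<bar>\<eta> $ i\<bar>)"
  have "\<exists>C\<ge>0. \<forall>N\<ge>1. \<forall>l\<in>freq_box J N. japanese (freq J \<eta> N l) powr (2 * r) \<le> C * real N powr (2 * r)"
    using assms(2)
  proof
    assume "r \<ge> 0"
    have "japanese (freq J \<eta> N l) powr (2 * r) \<le> ?b powr (2 * r) * real N powr (2 * r)"
      if "N \<ge> 1" "l \<in> freq_box J N" for N l
    proof -
      have "japanese (freq J \<eta> N l) powr (2 * r) \<le> (?b * real N) powr (2 * r)"
        using \<open>r \<ge> 0\<close> japanese_pos[of "freq J \<eta> N l"] freq_japanese_le[OF that(2,1)]
        by (intro powr_mono2) auto
      also have "\<dots> = ?b powr (2 * r) * real N powr (2 * r)"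
        by (intro powr_mult)
      finally show ?thesis .
    qed
    then show ?thesis
      by (intro exI[of _ "?b powr (2 * r)"]) auto
  next
    assume "\<eta> \<noteq> 0"
    then obtain i where i: "\<eta> $ i \<noteq> 0"
      by (auto simp: vec_eq_iff)
    have "japanese (freq J \<eta> N l) powr (2 * r)
        \<le> (\<bar>\<eta> $ i\<bar> powr (2 * r) + ?b powr (2 * r)) * real N powr (2 * r)"
      if "N \<ge> 1" "l \<in> freq_box J N" for N l
    proof (rule powr_le_between(1))
      have "\<bar>\<eta> $ i\<bar> * real N = \<bar>freq J \<eta> N l $ i\<bar>"
        using i assms(1) by (auto simp: freq_def abs_mult)
      also have "\<dots> \<le> japanese (freq J \<eta> N l)"
        using component_le_norm_cart[of "freq J \<eta> N l" i] norm_le_japanese order_trans by blast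
      finally show "\<bar>\<eta> $ i\<bar> * real N \<le> japanese (freq J \<eta> N l)" .
    qed (use i freq_japanese_le[OF that(2,1)] that in auto)
    then show ?thesis
      by (intro exI[of _ "\<bar>\<eta> $ i\<bar> powr (2 * r) + ?b powr (2 * r)"]) auto
  qed
  then obtain C where C: "C \<ge> 0"
    "\<And>N l. N \<ge> 1 \<Longrightarrow> l \<in> freq_box J N \<Longrightarrow> japanese (freq J \<eta> N l) powr (2 * r) \<le> C * real N powr (2 * r)"
    by blast
  have "(\<Sum>l\<in>freq_box J N. japanese (freq J \<eta> N l) powr (2 * r)) \<le> C * real N powr (card J + 2 * r)"
    if N: "N \<ge> 1" for N
  proof -
    have "(\<Sum>l\<in>freq_box J N. japanese (freq J \<eta> N l) powr (2 * r))
        \<le> real (card (freq_box J N)) * (C * real N powr (2 * r))"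
      by (intro sum_bounded_above C N)
    also have "\<dots> = C * real N powr (card J + 2 * r)"
      using N by (simp add: card_freq_box powr_add powr_realpow)
    finally show ?thesis .
  qed
  from that[OF C(1) this] show thesis .
qed

lemma tendsto_cmult_Suc_powr:
  assumes "s < 0"
  shows "(\<lambda>n. c * real (Suc n) powr s) \<longlonglongrightarrow> 0"
  by (intro tendsto_mult_right_zero tendsto_neg_powr assms
      filterlim_compose[OF filterlim_real_sequentially filterlim_Suc])

text \<open>The squared coefficient contributes \<open>2 * b - 2 * card J\<close> to the exponent,
  the sum over the box \<open>card J + 2 * r'\<close>, the overlap nothing. Raising the order from
  \<open>r\<close> to \<open>r'\<close> first lets a negative \<open>r\<close> with
  \<open>\<eta> = 0\<close> be treated at order 0.\<close>

lemma sobolev_energy_peak_tendsto_0: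
  fixes \<phi> :: "real^'n::finite \<Rightarrow> complex" and r r' b :: real
  assumes \<phi>: "\<phi> \<in> test_functions" and \<eta>: "\<And>i. i \<in> J \<Longrightarrow> \<eta> $ i = 0"
    and r: "r \<le> r'" "\<eta> \<noteq> 0 \<or> r' \<ge> 0" "2 * b - card J + 2 * r' < 0"
  shows "((\<lambda>n. sobolev_energy r \<phi> V (dist_of_fun (peak J \<eta> b n))) \<longlongrightarrow> 0) sequentially"
proof -
  obtain C1 where C1: "C1 \<ge> 0" and energy: "\<And>V a (A :: ('n \<Rightarrow> nat) set) \<theta> S. finite A \<Longrightarrow>
      \<forall>\<xi>. (\<Sum>l\<in>A. cmod (fourier \<phi> (\<xi> - \<theta> l))) \<le> S \<Longrightarrow>
      sobolev_energy r' \<phi> V (dist_of_fun (trig_poly a A \<theta>))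
        \<le> ennreal (a\<^sup>2 * S * (C1 * (\<Sum>l\<in>A. japanese (\<theta> l) powr (2 * r'))))"
  proof (rule sobolev_energy_trig_poly_le[OF \<phi>, of r', where 'l = "'n \<Rightarrow> nat"], goal_cases)
    case (1 C)
    from 1(2,3) show thesis
      by (rule 1(1))
  qed
  obtain S where S: "S \<ge> 0" "\<And>N \<theta> \<xi>. (\<And>l i. l \<in> freq_box J N \<Longrightarrow> i \<in> J \<Longrightarrow> \<theta> l $ i = real (l i)) \<Longrightarrow>
      (\<Sum>l\<in>freq_box J N. cmod (fourier \<phi> (\<xi> - \<theta> l))) \<le> S"
  proof (rule overlap_bound[OF \<phi>, of J, folded freq_box_def], goal_cases)
    case (1 S)
    from 1(2,3) show thesis
      by (rule 1(1))
  qed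
  obtain C2 where C2: "C2 \<ge> 0" "\<And>N. N \<ge> 1 \<Longrightarrow>
      (\<Sum>l\<in>freq_box J N. japanese (freq J \<eta> N l) powr (2 * r')) \<le> C2 * real N powr (card J + 2 * r')"
  proof (rule sum_freq_japanese_le[of J \<eta> r'], goal_cases)
    case (3 C)
    from 3(2,3) show thesis
      by (rule 3(1))
  qed (use \<eta> r(2) in auto)
  have le: "sobolev_energy r \<phi> V (dist_of_fun (peak J \<eta> b n))
      \<le> ennreal ((S * C1 * C2) * real (Suc n) powr (2 * b - card J + 2 * r'))" for n
  proof -
    let ?N = "Suc n"
    have "sobolev_energy r \<phi> V (dist_of_fun (peak J \<eta> b n))
        \<le> sobolev_energy r' \<phi> V (dist_of_fun (peak J \<eta> b n))"
      unfolding sobolev_energy_def using r(1)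
      by (intro nn_integral_mono mult_right_mono ennreal_leI mult_left_mono powr_mono japanese_ge_1) auto
    also have "\<dots> \<le> ennreal ((real ?N powr (b - card J))\<^sup>2 * S *
        (C1 * (\<Sum>l\<in>freq_box J ?N. japanese (freq J \<eta> ?N l) powr (2 * r'))))"
      unfolding peak_def by (intro energy allI S(2)) (auto simp: freq_def)
    also have "\<dots> \<le> ennreal ((real ?N powr (b - card J))\<^sup>2 * S * (C1 * (C2 * real ?N powr (card J + 2 * r'))))"
      using S C1 by (intro ennreal_leI mult_left_mono C2(2)) auto
    also have "(real ?N powr (b - card J))\<^sup>2 * S * (C1 * (C2 * real ?N powr (card J + 2 * r')))
        = (S * C1 * C2) * (real ?N powr (b - card J) * real ?N powr (b - card J) * real ?N powr (card J + 2 * r'))"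
      by (simp add: power2_eq_square)
    also have "real ?N powr (b - card J) * real ?N powr (b - card J) * real ?N powr (card J + 2 * r')
        = real ?N powr (2 * b - card J + 2 * r')"
      by (simp add: algebra_simps flip: powr_add)
    finally show ?thesis .
  qed
  have "((\<lambda>n. ennreal ((S * C1 * C2) * real (Suc n) powr (2 * b - card J + 2 * r'))) \<longlongrightarrow> ennreal 0) sequentially"
    by (intro tendsto_ennrealI tendsto_cmult_Suc_powr r)
  then have lim: "(\<lambda>n. ennreal ((S * C1 * C2) * real (Suc n) powr (2 * b - card J + 2 * r'))) \<longlonglongrightarrow> 0"
    by (simp only: ennreal_0)
  show ?thesis
    by (rule tendsto_sandwich[OF _ _ tendsto_const lim]) (rule always_eventually, simp add: le del: of_nat_Suc)+
qed

text \<open>All frequencies share a coordinate of modulus \<open>N * \<bar>\<eta> $ i\<bar>\<close>,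
  in which Fourier transforms decay at any polynomial rate, uniformly over \<open>B\<close>.\<close>

lemma peak_strongly_tendsto_0:
  fixes \<eta> :: "real^'n::finite"
  assumes \<eta>: "\<And>i. i \<in> J \<Longrightarrow> \<eta> $ i = 0" "\<eta> \<noteq> 0" and B: "bounded_test_set B"
  shows "\<exists>\<beta>. \<beta> \<longlonglongrightarrow> 0 \<and> (\<forall>n. \<forall>\<phi>\<in>B. cmod (dist_of_fun (peak J \<eta> b n) \<phi>) \<le> \<beta> n)"
proof -
  obtain i where i: "\<eta> $ i \<noteq> 0"
    using \<eta>(2) by (auto simp: vec_eq_iff)
  \<comment> \<open>The coefficients add up to \<open>N powr b\<close>, so any rate above
    \<open>b\<close> wins.\<close>
  obtain M where M: "b < real M"
    using reals_Archimedean2 by blast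
  let ?p = "\<lambda>\<phi>. LINT x|lborel. cmod (iter_partial (replicate M i) \<phi> x)"
  have test: "B \<subseteq> test_functions" and "bdd_above (?p ` B)"
    using B continuous_test_seminorm_L1[of "replicate M i"] by (auto simp: bounded_test_set_def)
  then obtain P where P: "\<And>\<phi>. \<phi> \<in> B \<Longrightarrow> ?p \<phi> \<le> P"
    by (auto simp: bdd_above_def)
  have "cmod (dist_of_fun (peak J \<eta> b n) \<phi>) \<le> (P / \<bar>\<eta> $ i\<bar> ^ M) * real (Suc n) powr (b - M)"
    if \<phi>: "\<phi> \<in> B" for n \<phi>
  proof -
    let ?N = "Suc n"
    have pos: "0 < (real ?N * \<bar>\<eta> $ i\<bar>) ^ M"
      using i by simp
    have four: "cmod (fourier \<phi> (- freq J \<eta> ?N l)) \<le> P / (real ?N * \<bar>\<eta> $ i\<bar>) ^ M" for l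
    proof -
      have "\<bar>(- freq J \<eta> ?N l) $ i\<bar> = real ?N * \<bar>\<eta> $ i\<bar>"
        using i \<eta>(1) by (auto simp: freq_def abs_mult)
      then have "(real ?N * \<bar>\<eta> $ i\<bar>) ^ M * cmod (fourier \<phi> (- freq J \<eta> ?N l)) \<le> ?p \<phi>"
        using fourier_coordinate_decay[of \<phi> "- freq J \<eta> ?N l" i M] \<phi> test by auto
      also note P[OF \<phi>]
      finally show ?thesis
        using pos by (simp add: pos_le_divide_eq mult.commute)
    qed
    have "cmod (dist_of_fun (peak J \<eta> b n) \<phi>)
        = real ?N powr (b - card J) * cmod (\<Sum>l\<in>freq_box J ?N. fourier \<phi> (- freq J \<eta> ?N l))"
      using \<phi> test unfolding peak_def by (subst dist_of_trig_poly) (auto simp: norm_mult)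
    also have "\<dots> \<le> real ?N powr (b - card J) *
        (real (card (freq_box J ?N)) * (P / (real ?N * \<bar>\<eta> $ i\<bar>) ^ M))"
      by (rule mult_left_mono[OF sum_norm_bound[OF four] powr_ge_zero])
    also have "\<dots> = (P / \<bar>\<eta> $ i\<bar> ^ M) * real ?N powr (b - M)"
      using i by (simp add: card_freq_box powr_diff powr_realpow power_mult_distrib field_simps
          del: of_nat_Suc)
    finally show ?thesis .
  qed
  moreover have "(\<lambda>n. (P / \<bar>\<eta> $ i\<bar> ^ M) * real (Suc n) powr (b - M)) \<longlonglongrightarrow> 0"
    using M by (intro tendsto_cmult_Suc_powr) simp
  ultimately show ?thesis
    by blast
qed

lemma sobolev_energy_zero_dist: "\<phi> \<in> test_functions \<Longrightarrow> sobolev_energy r \<phi> V zero_dist = 0"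
  by (simp add: sobolev_energy_def local_fourier_zero_dist)

lemma wave_front_zero_dist: "wave_front r zero_dist = {}"
  using wave_front_trig_poly[of "{}" r 0] by (simp add: trig_poly_def[abs_def])

lemma limitin_local_sobolev_peak:
  fixes r r' b :: real
  assumes \<eta>: "\<And>i. i \<in> J \<Longrightarrow> \<eta> $ i = 0"
    and r: "r \<le> r'" "\<eta> \<noteq> 0 \<or> r' \<ge> 0" "2 * b - card J + 2 * r' < 0"
  shows "limitin (local_sobolev_topology r) (\<lambda>n. dist_of_fun (peak J \<eta> b n)) zero_dist sequentially"
  unfolding local_sobolev_topology_def
proof (rule limitin_seminorm_topologyI)
  show "{sobolev_seminorm r \<phi> UNIV |\<phi>. \<phi> \<in> (test_functions :: (real^'a \<Rightarrow> complex) set)} \<noteq> {}"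
    using bump_test_function[of 1 "0 :: real^'a"] by auto
  show "dist_of_fun (peak J \<eta> b n) \<in> {u \<in> distributions. \<forall>\<phi>\<in>test_functions. sobolev_energy r \<phi> UNIV u < \<infinity>}" for n
    using dist_of_peak_distribution[of J \<eta> b n]
    by (auto simp: peak_def intro: sobolev_energy_trig_poly_finite
        simp del: of_nat_Suc infinity_ennreal_def)
  show "zero_dist \<in> {u \<in> distributions. \<forall>\<phi>\<in>test_functions. sobolev_energy r \<phi> UNIV u < \<infinity>}"
    by (simp add: zero_dist_distribution sobolev_energy_zero_dist)
next
  fix p :: "'a functional \<Rightarrow> real" and u \<epsilon>
  assume "p \<in> {sobolev_seminorm r \<phi> UNIV |\<phi>. \<phi> \<in> test_functions}" and less: "p (zero_dist - u) < \<epsilon>"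
  then obtain \<phi> where \<phi>: "\<phi> \<in> test_functions" and p: "p = sobolev_seminorm r \<phi> UNIV"
    by blast
  show "\<forall>\<^sub>F n in sequentially. p (dist_of_fun (peak J \<eta> b n) - u) < \<epsilon>"
    using less \<phi> unfolding p
    by (intro sobolev_seminorm_eventually sobolev_energy_peak_tendsto_0[OF _ \<eta> r])
      (auto simp: peak_def intro!: local_fourier_trig_poly_measurable)
qed

text \<open>The energies tend to 0 over all closed cones at once. The strong seminorms add the
  demand \<open>\<eta> \<noteq> 0\<close>, under which all frequencies escape to infinity.\<close>

lemma limitin_wave_front_peak:
  fixes r b :: real
  assumes \<eta>: "\<And>i. i \<in> J \<Longrightarrow> \<eta> $ i = 0" "\<eta> \<noteq> 0" and r: "2 * b - card J + 2 * r < 0"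
  shows "limitin (wave_front_topology r L) (\<lambda>n. dist_of_fun (peak J \<eta> b n)) zero_dist sequentially"
  unfolding wave_front_topology_def
proof (rule limitin_seminorm_topologyI)
  have "bounded_test_set {bump 0 1 (0 :: real^'a)}"
    by (simp add: bounded_test_set_def bump_test_function)
  then show "strong_seminorms \<union> {sobolev_seminorm r \<phi> V |\<phi> V. \<phi> \<in> test_functions \<and> closed V \<and>
      pos_cone V \<and> supp \<phi> \<times> V \<inter> L = {}} \<noteq> {}"
    unfolding strong_seminorms_def by blast
  show "dist_of_fun (peak J \<eta> b n) \<in> {u \<in> distributions. wave_front r u \<subseteq> L}" for n
    using dist_of_peak_distribution[of J \<eta> b n] by (simp add: peak_def wave_front_trig_poly)
  show "zero_dist \<in> {u \<in> distributions. wave_front r u \<subseteq> L}"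
    by (simp add: zero_dist_distribution wave_front_zero_dist)
next
  fix p u \<epsilon>
  assume p: "p \<in> strong_seminorms \<union> {sobolev_seminorm r \<phi> V |\<phi> V. \<phi> \<in> test_functions \<and> closed V \<and>
      pos_cone V \<and> supp \<phi> \<times> V \<inter> L = {}}"
    and u: "u \<in> {u \<in> distributions. wave_front r u \<subseteq> L}" and less: "p (zero_dist - u) < \<epsilon>"
  from p show "\<forall>\<^sub>F n in sequentially. p (dist_of_fun (peak J \<eta> b n) - u) < \<epsilon>"
  proof
    assume "p \<in> strong_seminorms"
    then show ?thesis
      using u by (intro strong_seminorm_eventually[where u = u and p = p, OF _ _ _ less]
          peak_strongly_tendsto_0[OF \<eta>]) auto
  next
    assume "p \<in> {sobolev_seminorm r \<phi> V |\<phi> V. \<phi> \<in> test_functions \<and> closed V \<and>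
      pos_cone V \<and> supp \<phi> \<times> V \<inter> L = {}}"
    then obtain \<phi> V where \<phi>: "\<phi> \<in> test_functions" "closed V" and p: "p = sobolev_seminorm r \<phi> V"
      by blast
    show ?thesis
      using less \<phi> \<eta>(2) unfolding p
      by (intro sobolev_seminorm_eventually borel_closed
          sobolev_energy_peak_tendsto_0[OF _ \<eta>(1) order_refl _ r])
        (auto simp: peak_def intro!: local_fourier_trig_poly_measurable)
  qed
qed

section \<open>Pulling back along a map of deficient rank\<close>

abbreviation scaled_wave :: "real \<Rightarrow> real^'m::finite \<Rightarrow> nat \<Rightarrow> real^'m \<Rightarrow> complex" where
  "scaled_wave b \<xi> n \<equiv> trig_poly (real (Suc n) powr b) {()} (\<lambda>_. real (Suc n) *\<^sub>R \<xi>)"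

text \<open>\<open>dual\<close> expresses that the transpose of \<open>f\<close> maps \<eta> to
  \<xi>. The lattice coordinates sit where \<open>f x\<close> vanishes, so they drop out of every
  phase.\<close>

lemma peak_comp:
  assumes f0: "\<And>x i. i \<in> J \<Longrightarrow> f x $ i = 0" and \<eta>0: "\<And>i. i \<in> J \<Longrightarrow> \<eta> $ i = 0"
    and dual: "\<And>x. f x \<bullet> \<eta> = x \<bullet> \<xi>"
  shows "peak J \<eta> b n \<circ> f = scaled_wave b \<xi> n"
proof (rule ext)
  fix x
  have "plane_wave (freq J \<eta> (Suc n) l) (f x) = plane_wave (real (Suc n) *\<^sub>R \<xi>) x" for l
  proof -
    have "f x \<bullet> freq J \<eta> (Suc n) l = f x \<bullet> (real (Suc n) *\<^sub>R \<eta>)"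
      unfolding inner_vec_def by (rule sum.cong) (auto simp: freq_def f0)
    also have "\<dots> = x \<bullet> (real (Suc n) *\<^sub>R \<xi>)"
      by (simp add: dual)
    finally show ?thesis
      by (simp add: plane_wave_def)
  qed
  then have "(peak J \<eta> b n \<circ> f) x = complex_of_real (real (Suc n) powr (b - card J) * real (Suc n ^ card J)) *
      plane_wave (real (Suc n) *\<^sub>R \<xi>) x"
    by (simp add: peak_def trig_poly_def card_freq_box del: of_nat_Suc)
  also have "real (Suc n) powr (b - card J) * real (Suc n ^ card J) = real (Suc n) powr b"
    by (simp add: powr_diff powr_realpow del: of_nat_Suc)
  finally show "(peak J \<eta> b n \<circ> f) x = scaled_wave b \<xi> n x"
    by (simp add: trig_poly_def)
qed

text \<open>The zero distribution and the peaks all come from smooth functions, where the values of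
  the extension are prescribed; continuity carries the limit over.\<close>

lemma pullback_limit:
  assumes ext: "pullback_extends f X Y"
    and f0: "\<And>x i. i \<in> J \<Longrightarrow> f x $ i = 0" and \<eta>0: "\<And>i. i \<in> J \<Longrightarrow> \<eta> $ i = 0"
    and dual: "\<And>x. f x \<bullet> \<eta> = x \<bullet> \<xi>"
    and lim: "limitin X (\<lambda>n. dist_of_fun (peak J \<eta> b n)) zero_dist sequentially"
  shows "limitin Y (\<lambda>n. dist_of_fun (scaled_wave b \<xi> n)) zero_dist sequentially"
proof -
  obtain T where T: "continuous_map X Y T" "\<And>u. smooth u \<Longrightarrow> T (dist_of_fun u) = dist_of_fun (u \<circ> f)"
    using ext by (auto simp: pullback_extends_def)
  have "T zero_dist = zero_dist"
    using T(2)[OF smooth_const[of 0]] by (simp add: comp_def)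
  moreover have "T (dist_of_fun (peak J \<eta> b n)) = dist_of_fun (scaled_wave b \<xi> n)" for n
    using T(2)[of "peak J \<eta> b n"] peak_comp[of J f \<eta> \<xi> b n, OF f0 \<eta>0 dual]
    by (simp add: peak_def smooth_trig_poly)
  ultimately show ?thesis
    using continuous_map_limit[OF T(1) lim] by (simp add: comp_def)
qed

text \<open>The scaled waves are constantly 1 here, and pairing with a nonnegative bump returns its
  positive integral for every \<open>n\<close>. A single test function already forms a bounded
  set.\<close>

lemma not_limitin_distribution_topology:
  "\<not> limitin distribution_topology (\<lambda>n. dist_of_fun (scaled_wave 0 (0 :: real^'m::finite) n))
      zero_dist sequentially"
proof
  let ?\<phi> = "bump 0 1 (0 :: real^'m)"
  let ?p = "\<lambda>u :: 'm functional. SUP \<phi>\<in>{?\<phi>}. cmod (u \<phi>)"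
  have \<phi>: "?\<phi> \<in> test_functions"
    by (intro bump_test_function) simp
  then have "bounded_test_set {?\<phi>}"
    by (simp add: bounded_test_set_def)
  then have p: "?p \<in> strong_seminorms"
    unfolding strong_seminorms_def by blast
  assume "limitin distribution_topology (\<lambda>n. dist_of_fun (scaled_wave 0 (0 :: real^'m) n))
      zero_dist sequentially"
  from limitin_seminorm_topologyD[OF this[unfolded distribution_topology_def] p _
      fourier_bump_0(2)[OF zero_less_one, of "0 :: real^'m"]]
  have "\<forall>\<^sub>F n in sequentially. ?p (dist_of_fun (scaled_wave 0 0 n) - zero_dist)
      < (LINT x|lborel. cmod (?\<phi> x))"
    by simp
  moreover have "?p (dist_of_fun (scaled_wave 0 0 n) - zero_dist) = (LINT x|lborel. cmod (?\<phi> x))" for n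
    using \<phi> by (simp add: zero_dist_apply dist_of_trig_poly fourier_bump_0(1))
  ultimately show False
    by (simp add: eventually_False)
qed

text \<open>Directions whose angle to \<open>\<xi>0\<close> has cosine at least \<kappa>, written
  without division so that the origin is included and closedness is immediate.\<close>

definition ray_nbhd :: "real \<Rightarrow> real^'m::finite \<Rightarrow> (real^'m) set" where
  "ray_nbhd \<kappa> \<xi>0 = {\<xi>. \<kappa> * norm \<xi>0 * norm \<xi> \<le> \<xi> \<bullet> \<xi>0}"

lemma closed_ray_nbhd: "closed (ray_nbhd \<kappa> \<xi>0)"
  unfolding ray_nbhd_def by (intro closed_Collect_le continuous_intros)

lemma pos_cone_ray_nbhd: "pos_cone (ray_nbhd \<kappa> \<xi>0)"
proof -
  have "\<kappa> * norm \<xi>0 * (t * norm \<xi>) \<le> t * (\<xi> \<bullet> \<xi>0)"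
    if "\<kappa> * norm \<xi>0 * norm \<xi> \<le> \<xi> \<bullet> \<xi>0" "t > 0" for \<xi> t
    using mult_left_mono[OF that(1), of t] that(2) by (simp add: mult_ac)
  then show ?thesis
    by (auto simp: pos_cone_def ray_nbhd_def)
qed

text \<open>One radius serves all \<open>n\<close>: scaling down by \<open>Suc n\<close> maps the
  balls into a single ball around \<open>\<xi>0\<close>, and the cone is invariant under
  scaling.\<close>

lemma cball_subset_ray_nbhd:
  assumes "\<kappa> < 1" "\<xi>0 \<noteq> 0"
  obtains \<rho> where "\<rho> > 0" "\<And>n. cball (real (Suc n) *\<^sub>R \<xi>0) \<rho> \<subseteq> ray_nbhd \<kappa> \<xi>0"
proof -
  have "open {\<xi>. \<kappa> * norm \<xi>0 * norm \<xi> < \<xi> \<bullet> \<xi>0}"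
    by (intro open_Collect_less continuous_intros)
  moreover have "\<xi>0 \<in> {\<xi>. \<kappa> * norm \<xi>0 * norm \<xi> < \<xi> \<bullet> \<xi>0}"
    using assms by (simp add: dot_square_norm power2_eq_square)
  ultimately obtain \<rho> where \<rho>: "\<rho> > 0" "cball \<xi>0 \<rho> \<subseteq> {\<xi>. \<kappa> * norm \<xi>0 * norm \<xi> < \<xi> \<bullet> \<xi>0}"
    by (meson open_contains_cball)
  have "\<xi> \<in> ray_nbhd \<kappa> \<xi>0" if \<xi>: "\<xi> \<in> cball (real (Suc n) *\<^sub>R \<xi>0) \<rho>" for n \<xi>
  proof -
    let ?N = "real (Suc n)"
    have "dist \<xi>0 (\<xi> /\<^sub>R ?N) = dist (?N *\<^sub>R \<xi>0) \<xi> / ?N"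
    proof -
      have "\<xi>0 - \<xi> /\<^sub>R ?N = (?N *\<^sub>R \<xi>0 - \<xi>) /\<^sub>R ?N"
        by (simp add: scaleR_diff_right del: of_nat_Suc)
      then show ?thesis
        by (simp add: dist_norm divide_inverse mult.commute del: of_nat_Suc)
    qed
    also have "\<dots> \<le> dist (?N *\<^sub>R \<xi>0) \<xi>"
      by (simp add: divide_le_eq mult_le_cancel_left1 algebra_simps)
    also have "\<dots> \<le> \<rho>"
      using \<xi> by simp
    finally have "\<xi> /\<^sub>R ?N \<in> ray_nbhd \<kappa> \<xi>0"
      using \<rho>(2) by (auto simp: ray_nbhd_def subset_iff)
    then have "?N *\<^sub>R (\<xi> /\<^sub>R ?N) \<in> ray_nbhd \<kappa> \<xi>0"
      using pos_cone_ray_nbhd[of \<kappa> \<xi>0] unfolding pos_cone_def by (metis of_nat_0_less_iff zero_less_Suc)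
    then show ?thesis
      by (simp del: of_nat_Suc)
  qed
  then show thesis
    using that[OF \<rho>(1)] by blast
qed

text \<open>Modulation moves the Fourier transform of the bump to the frequency of the wave. On a
  ball of fixed radius there it is at least a multiple of the amplitude, whose exponent
  \<open>- r\<close> the order \<open>r\<close> cancels.\<close>

lemma sobolev_energy_scaled_wave_ge:
  fixes \<xi>0 :: "real^'m::finite"
  assumes "\<epsilon> > 0" "\<kappa> < 1" "\<xi>0 \<noteq> 0"
  shows "\<exists>c>0. \<forall>n. ennreal c \<le>
    sobolev_energy r (bump 0 \<epsilon> 0) (ray_nbhd \<kappa> \<xi>0) (dist_of_fun (scaled_wave (- r) \<xi>0 n))"
proof -
  let ?\<phi> = "bump 0 \<epsilon> (0 :: real^'m)"
  obtain c \<delta> where c: "c > 0" and \<delta>: "\<delta> > 0" "\<And>\<xi>. norm \<xi> \<le> \<delta> \<Longrightarrow> c \<le> cmod (fourier ?\<phi> \<xi>)"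
    using fourier_bump_lower_bound[OF assms(1), where 'n = 'm] by blast
  obtain \<rho>' where \<rho>': "\<rho>' > 0" "\<And>n. cball (real (Suc n) *\<^sub>R \<xi>0) \<rho>' \<subseteq> ray_nbhd \<kappa> \<xi>0"
    using cball_subset_ray_nbhd[OF assms(2,3)] by metis
  define \<rho> where "\<rho> = min \<delta> \<rho>'"
  have \<rho>: "\<rho> > 0"
    using \<delta> \<rho>' by (simp add: \<rho>_def)
  \<comment> \<open>\<open>m\<close> compares the bracket at the centre of the ball with
    \<open>Suc n\<close>, \<open>P\<close> bounds its variation over the ball by Peetre's
    inequality, and \<open>v\<close> is the volume of the ball.\<close>
  define m where "m = min (norm \<xi>0 powr (2 * r)) ((1 + norm \<xi>0) powr (2 * r))"
  have m: "m > 0"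
    using assms(3) add_pos_nonneg[OF zero_less_one norm_ge_zero[of \<xi>0]] by (simp add: m_def)
  define P where "P = 2 powr \<bar>2 * r\<bar> * (1 + \<rho>) powr \<bar>2 * r\<bar>"
  have P: "P > 0"
    using \<rho> by (auto simp: P_def)
  define v where "v = measure lborel (cball (0 :: real^'m) \<rho>)"
  have v: "v > 0"
    using content_cball_pos[OF \<rho>] by (simp add: v_def)
  have "ennreal (c\<^sup>2 * (m / P) * v) \<le>
    sobolev_energy r ?\<phi> (ray_nbhd \<kappa> \<xi>0) (dist_of_fun (scaled_wave (- r) \<xi>0 n))" for n
  proof -
    let ?N = "real (Suc n)"
    let ?B = "cball (?N *\<^sub>R \<xi>0) \<rho>"
    let ?u = "dist_of_fun (scaled_wave (- r) \<xi>0 n)"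
    have lower: "c\<^sup>2 * (m / P) \<le> (cmod (local_fourier ?\<phi> ?u \<xi>))\<^sup>2 * japanese \<xi> powr (2 * r)"
      if \<xi>: "\<xi> \<in> ?B" for \<xi>
    proof -
      have dist: "norm (?N *\<^sub>R \<xi>0 - \<xi>) \<le> \<rho>" "norm (\<xi> - ?N *\<^sub>R \<xi>0) \<le> \<delta>"
        using \<xi> by (auto simp: dist_norm norm_minus_commute \<rho>_def simp del: of_nat_Suc)
      have "m * ?N powr (2 * r) \<le> japanese (?N *\<^sub>R \<xi>0) powr (2 * r)"
        unfolding m_def
      proof (rule powr_le_between(2))
        show "norm \<xi>0 * ?N \<le> japanese (?N *\<^sub>R \<xi>0)"
          using norm_le_japanese[of "?N *\<^sub>R \<xi>0"] by (simp add: mult.commute del: of_nat_Suc)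
        show "japanese (?N *\<^sub>R \<xi>0) \<le> (1 + norm \<xi>0) * ?N"
        proof -
          have "1 \<le> ?N"
            by simp
          then show ?thesis
            using japanese_le[of "?N *\<^sub>R \<xi>0"] unfolding distrib_right norm_scaleR
            by (simp add: mult.commute del: of_nat_Suc)
        qed
      qed (use assms(3) in auto)
      also have "\<dots> \<le> 2 powr \<bar>2 * r\<bar> * japanese (?N *\<^sub>R \<xi>0 - \<xi>) powr \<bar>2 * r\<bar> * japanese \<xi> powr (2 * r)"
        using peetre[of "?N *\<^sub>R \<xi>0 - \<xi>" \<xi> "2 * r"] by simp
      also have "\<dots> \<le> P * japanese \<xi> powr (2 * r)"
        unfolding P_def using japanese_le[of "?N *\<^sub>R \<xi>0 - \<xi>"] japanese_pos[of "?N *\<^sub>R \<xi>0 - \<xi>"] dist(1)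
        by (intro mult_right_mono mult_left_mono powr_mono2) (auto simp del: of_nat_Suc)
      finally have J: "m / P * ?N powr (2 * r) \<le> japanese \<xi> powr (2 * r)"
        using P by (simp add: field_simps del: of_nat_Suc)
      have F: "cmod (local_fourier ?\<phi> ?u \<xi>) = ?N powr (- r) * cmod (fourier ?\<phi> (\<xi> - ?N *\<^sub>R \<xi>0))"
        by (subst local_fourier_trig_poly[OF bump_test_function[OF assms(1)]])
          (simp add: norm_mult del: of_nat_Suc)
      have "c\<^sup>2 * (m / P) = (?N powr (- r) * c)\<^sup>2 * (m / P * ?N powr (2 * r))"
      proof -
        have "(?N powr (- r))\<^sup>2 * ?N powr (2 * r) = 1"
          by (simp add: power2_eq_square flip: powr_add)
        then show ?thesis
          by (simp add: power_mult_distrib mult_ac del: of_nat_Suc)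
      qed
      also have "\<dots> \<le> (cmod (local_fourier ?\<phi> ?u \<xi>))\<^sup>2 * japanese \<xi> powr (2 * r)"
        unfolding F using c m P \<delta>(2)[OF dist(2)]
        by (intro mult_mono power_mono J) auto
      finally show ?thesis .
    qed
    have "emeasure lborel ?B = ennreal v"
      using \<rho> by (simp add: v_def emeasure_cball content_cball)
    then have "ennreal (c\<^sup>2 * (m / P) * v) = (\<integral>\<^sup>+\<xi>. ennreal (c\<^sup>2 * (m / P)) * indicator ?B \<xi> \<partial>lborel)"
      using m P by (simp add: nn_integral_cmult_indicator ennreal_mult'[symmetric] del: of_nat_Suc)
    also have "\<dots> \<le> sobolev_energy r ?\<phi> (ray_nbhd \<kappa> \<xi>0) ?u"
      unfolding sobolev_energy_def
    proof (intro nn_integral_mono)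
      fix \<xi>
      show "ennreal (c\<^sup>2 * (m / P)) * indicator ?B \<xi> \<le>
        ennreal ((cmod (local_fourier ?\<phi> ?u \<xi>))\<^sup>2 * japanese \<xi> powr (2 * r)) * indicator (ray_nbhd \<kappa> \<xi>0) \<xi>"
      proof (cases "\<xi> \<in> ?B")
        case True
        moreover have "?B \<subseteq> cball (?N *\<^sub>R \<xi>0) \<rho>'"
          by (rule subset_cball) (simp add: \<rho>_def)
        ultimately have "\<xi> \<in> ray_nbhd \<kappa> \<xi>0"
          using \<rho>'(2)[of n] by blast
        then show ?thesis
          using True ennreal_leI[OF lower[OF True]] by (simp only: indicator_simps mult_1_right)
      qed simp
    qed
    finally show ?thesis .
  qed
  then show ?thesis
    using c m P v by (intro exI[of _ "c\<^sup>2 * (m / P) * v"]) simp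
qed

lemma ray_nbhd_disjoint:
  fixes \<xi>0 :: "real^'m::finite"
  assumes conic: "\<And>x \<xi> t. (x, \<xi>) \<in> L \<Longrightarrow> t > 0 \<Longrightarrow> (x, t *\<^sub>R \<xi>) \<in> L" and nonzero: "\<And>x. (x, 0) \<notin> L"
    and "\<xi>0 \<noteq> 0" "\<epsilon> > 0"
    and nbhd: "\<And>x \<xi>. norm x \<le> \<epsilon> \<Longrightarrow> norm (\<xi> - \<xi>0) \<le> \<epsilon> \<Longrightarrow> (x, \<xi>) \<notin> L"
  obtains \<kappa> where "\<kappa> < 1" "cball 0 \<epsilon> \<times> ray_nbhd \<kappa> \<xi>0 \<inter> L = {}"
proof -
  \<comment> \<open>A vector of length \<open>norm \<xi>0\<close> in the cone has squared distance
    at most \<open>2 * (1 - \<kappa>) * (norm \<xi>0)\<^sup>2\<close> from \<open>\<xi>0\<close>;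
    this choice makes the bound \<open>\<epsilon>\<^sup>2\<close>.\<close>
  define \<kappa> where "\<kappa> = 1 - \<epsilon>\<^sup>2 / (2 * (norm \<xi>0)\<^sup>2)"
  have "\<kappa> < 1"
    using assms by (simp add: \<kappa>_def)
  moreover have "(x, \<xi>) \<notin> L" if x: "norm x \<le> \<epsilon>" and \<xi>: "\<xi> \<in> ray_nbhd \<kappa> \<xi>0" for x \<xi>
  proof (cases "\<xi> = 0")
    case False
    \<comment> \<open>As \<open>L\<close> is conic, \<xi> may be compared with \<open>\<xi>0\<close>
      at equal length.\<close>
    let ?t = "norm \<xi>0 / norm \<xi>"
    have t: "?t > 0"
      using False assms(3) by simp
    then have "?t *\<^sub>R \<xi> \<in> ray_nbhd \<kappa> \<xi>0"
      using \<xi> pos_cone_ray_nbhd[of \<kappa> \<xi>0] unfolding pos_cone_def by blast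
    then have inner: "\<kappa> * (norm \<xi>0)\<^sup>2 \<le> (?t *\<^sub>R \<xi>) \<bullet> \<xi>0"
      using False by (simp add: ray_nbhd_def power2_eq_square mult.assoc)
    have norm: "norm (?t *\<^sub>R \<xi>) = norm \<xi>0"
      using False by simp
    have "(norm (?t *\<^sub>R \<xi> - \<xi>0))\<^sup>2 = (norm (?t *\<^sub>R \<xi>))\<^sup>2 + (norm \<xi>0)\<^sup>2 - 2 * ((?t *\<^sub>R \<xi>) \<bullet> \<xi>0)"
      unfolding power2_norm_eq_inner by (simp add: inner_diff inner_commute)
    also have "\<dots> \<le> 2 * (norm \<xi>0)\<^sup>2 - 2 * (\<kappa> * (norm \<xi>0)\<^sup>2)"
      unfolding norm using inner by linarith
    also have "\<dots> = \<epsilon>\<^sup>2"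
      using assms(3) by (simp add: \<kappa>_def field_simps)
    finally have "norm (?t *\<^sub>R \<xi> - \<xi>0) \<le> \<epsilon>"
      by (rule power2_le_imp_le) (use assms(4) in simp)
    from nbhd[OF x this] show ?thesis
      using conic[OF _ t] by blast
  qed (use nonzero in simp)
  then have "cball 0 \<epsilon> \<times> ray_nbhd \<kappa> \<xi>0 \<inter> L = {}"
    by auto
  ultimately show thesis
    by (rule that)
qed

text \<open>\<open>L\<close> enters through conicity, absence of zero covectors and a neighbourhood
  free of it; in this form the lemma applies to a pulled back cone without first showing it
  closed.\<close>

lemma not_limitin_wave_front_topology:
  fixes \<xi>0 :: "real^'m::finite"
  assumes conic: "\<And>x \<xi> t. (x, \<xi>) \<in> L \<Longrightarrow> t > 0 \<Longrightarrow> (x, t *\<^sub>R \<xi>) \<in> L" and nonzero: "\<And>x. (x, 0) \<notin> L"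
    and "\<xi>0 \<noteq> 0" "\<epsilon> > 0"
    and nbhd: "\<And>x \<xi>. norm x \<le> \<epsilon> \<Longrightarrow> norm (\<xi> - \<xi>0) \<le> \<epsilon> \<Longrightarrow> (x, \<xi>) \<notin> L"
  shows "\<not> limitin (wave_front_topology r L) (\<lambda>n. dist_of_fun (scaled_wave (- r) \<xi>0 n))
      zero_dist sequentially"
proof
  assume lim: "limitin (wave_front_topology r L) (\<lambda>n. dist_of_fun (scaled_wave (- r) \<xi>0 n))
      zero_dist sequentially"
  let ?\<phi> = "bump 0 \<epsilon> (0 :: real^'m)"
  have \<phi>: "?\<phi> \<in> test_functions" and supp: "supp ?\<phi> \<subseteq> cball 0 \<epsilon>"
    using bump_test_function supp_bump assms(4) by blast+
  obtain \<kappa> where \<kappa>: "\<kappa> < 1" "cball 0 \<epsilon> \<times> ray_nbhd \<kappa> \<xi>0 \<inter> L = {}"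
    using ray_nbhd_disjoint[of L \<xi>0 \<epsilon>, OF conic nonzero assms(3,4) nbhd] by blast
  let ?p = "sobolev_seminorm r ?\<phi> (ray_nbhd \<kappa> \<xi>0)"
  obtain c where c: "c > 0" "\<And>n. ennreal c \<le>
      sobolev_energy r ?\<phi> (ray_nbhd \<kappa> \<xi>0) (dist_of_fun (scaled_wave (- r) \<xi>0 n))"
    using sobolev_energy_scaled_wave_ge[OF assms(4) \<kappa>(1) assms(3)] by blast
  have "?p \<in> strong_seminorms \<union> {sobolev_seminorm r \<phi> V |\<phi> V. \<phi> \<in> test_functions \<and> closed V \<and>
      pos_cone V \<and> supp \<phi> \<times> V \<inter> L = {}}"
    using \<phi> supp \<kappa>(2) closed_ray_nbhd[of \<kappa> \<xi>0] pos_cone_ray_nbhd[of \<kappa> \<xi>0] by blast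
  moreover have "?p (\<lambda>\<phi>. 0) = 0"
    by (simp add: sobolev_seminorm_def sobolev_energy_def local_fourier_def)
  ultimately have "\<forall>\<^sub>F n in sequentially. ?p (dist_of_fun (scaled_wave (- r) \<xi>0 n) - zero_dist) < sqrt c"
    using c(1) by (intro limitin_seminorm_topologyD[OF lim[unfolded wave_front_topology_def]]) auto
  from eventually_happens'[OF sequentially_bot this]
  obtain n where n: "?p (dist_of_fun (scaled_wave (- r) \<xi>0 n) - zero_dist) < sqrt c"
    by blast
  let ?E = "sobolev_energy r ?\<phi> (ray_nbhd \<kappa> \<xi>0) (dist_of_fun (scaled_wave (- r) \<xi>0 n))"
  have "?p (dist_of_fun (scaled_wave (- r) \<xi>0 n) - zero_dist) = sqrt (enn2real ?E)"
    unfolding sobolev_seminorm_def sobolev_energy_def local_fourier_diff local_fourier_zero_dist[OF \<phi>]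
    by simp
  \<comment> \<open>Finiteness matters: \<open>enn2real\<close> sends an infinite energy to 0, and
    the lower bound would be lost.\<close>
  moreover have "?E < \<infinity>"
    using \<phi> by (intro sobolev_energy_trig_poly_finite) auto
  then have "c \<le> enn2real ?E"
    using c(1) enn2real_mono[OF c(2)[of n]] by simp
  ultimately show False
    using n by simp
qed

text \<open>
  If \<open>(x, \<eta>)\<close> ranges over points of \<open>L\<close> whose pullbacks tend to \<open>(0, \<xi>0)\<close>, then either \<open>\<eta>\<close> stays
  bounded and a limit point lies in \<open>L\<close>, or the normalized \<open>\<eta>\<close> accumulate at a conormal in \<open>L\<close>.
\<close>

lemma pullback_cone_nbhd:
  fixes f :: "real^'m::finite \<Rightarrow> real^'n::finite"
  assumes f: "linear f" and L: "closed_conic L" and "L \<inter> conormals f = {}"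
    and "\<xi>0 \<noteq> 0" and avoid: "\<And>\<eta>. adjoint f \<eta> = \<xi>0 \<Longrightarrow> (0, \<eta>) \<notin> L"
  shows "\<exists>\<epsilon>>0. \<forall>x \<xi>. norm x \<le> \<epsilon> \<longrightarrow> norm (\<xi> - \<xi>0) \<le> \<epsilon> \<longrightarrow> (x, \<xi>) \<notin> pullback_cone f L"
proof (rule ccontr)
  have deriv: "frechet_derivative f (at x) = f" for x
    using frechet_derivative_at[OF bounded_linear_imp_has_derivative] f
    by (metis linear_conv_bounded_linear)
  have adj: "linear (adjoint f)"
    by (rule adjoint_linear[OF f])
  \<comment> \<open>Errors of at most half of \<open>norm \<xi>0\<close> keep
    \<open>adjoint f (\<eta> n)\<close> away from 0. This bounds \<open>norm (\<eta> n)\<close> from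
    below and confines its inverse to a compact interval.\<close>
  define \<delta> where "\<delta> = norm \<xi>0 / 2"
  define h where "h n = \<delta> * inverse (real (Suc n))" for n
  have \<delta>: "\<delta> > 0"
    using assms(4) by (simp add: \<delta>_def)
  have h: "h n > 0" "h n \<le> \<delta>" for n
    using \<delta> by (auto simp: h_def field_simps)
  assume neg: "\<not> ?thesis"
  have "\<exists>x \<eta>. norm x \<le> h n \<and> norm (adjoint f \<eta> - \<xi>0) \<le> h n \<and> (f x, \<eta>) \<in> L" for n
  proof -
    obtain x \<xi> where "norm x \<le> h n" "norm (\<xi> - \<xi>0) \<le> h n" and "(x, \<xi>) \<in> pullback_cone f L"
      using neg h(1)[of n] by blast
    moreover then obtain \<eta> where "\<xi> = adjoint f \<eta>" "(f x, \<eta>) \<in> L"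
      unfolding pullback_cone_def deriv by blast
    ultimately show ?thesis
      by blast
  qed
  then obtain x \<eta> where x: "\<And>n. norm (x n) \<le> h n" and \<eta>: "\<And>n. norm (adjoint f (\<eta> n) - \<xi>0) \<le> h n"
    and in_L: "\<And>n. (f (x n), \<eta> n) \<in> L"
    by metis
  have h_lim: "h \<longlonglongrightarrow> 0"
    unfolding h_def[abs_def] by (intro tendsto_mult_right_zero LIMSEQ_inverse_real_of_nat)
  have x_lim: "x \<longlonglongrightarrow> 0"
    by (rule Lim_null_comparison[OF _ h_lim]) (simp add: x)
  have "(\<lambda>n. adjoint f (\<eta> n) - \<xi>0) \<longlonglongrightarrow> 0"
    by (rule Lim_null_comparison[OF _ h_lim]) (simp add: \<eta>)
  then have \<eta>_lim: "(\<lambda>n. adjoint f (\<eta> n)) \<longlonglongrightarrow> \<xi>0"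
    by (simp add: LIM_zero_iff)
  obtain K where K: "K > 0" "\<And>\<eta>. norm (adjoint f \<eta>) \<le> norm \<eta> * K"
    using adj linear_conv_bounded_linear bounded_linear.pos_bounded by metis
  have \<eta>_ge: "norm (\<eta> n) \<ge> \<delta> / K" for n
  proof -
    have "norm \<xi>0 \<le> norm (adjoint f (\<eta> n)) + norm (adjoint f (\<eta> n) - \<xi>0)"
      by (metis norm_minus_commute norm_triangle_sub add.commute)
    then have "\<delta> \<le> norm (\<eta> n) * K"
      using K(2)[of "\<eta> n"] \<eta>[of n] h(2)[of n] by (simp add: \<delta>_def)
    then show ?thesis
      using K(1) by (simp add: divide_le_eq)
  qed
  then have \<eta>_pos: "norm (\<eta> n) > 0" for n
    using \<delta> K(1) by (meson divide_pos_pos less_le_trans)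
  \<comment> \<open>Pairs of a direction and an inverse length compactify the covectors at infinity:
    the limit \<open>\<tau>0 = 0\<close> stands for unbounded \<eta>, so one subsequence serves both
    cases.\<close>
  define \<tau> where "\<tau> n = inverse (norm (\<eta> n))" for n
  define \<nu> where "\<nu> n = \<tau> n *\<^sub>R \<eta> n" for n
  have "inverse (norm (\<eta> n)) \<le> inverse (\<delta> / K)" for n
    using \<eta>_ge \<delta> K(1) by (intro le_imp_inverse_le) auto
  then have in_K: "(\<nu> n, \<tau> n) \<in> sphere 0 1 \<times> {0..K / \<delta>}" for n
    using \<eta>_pos[of n] by (auto simp: \<nu>_def \<tau>_def)
  have "compact (sphere (0 :: real^'n) 1 \<times> {0..K / \<delta>})"
    by (intro compact_Times) auto
  then have "seq_compact (sphere (0 :: real^'n) 1 \<times> {0..K / \<delta>})"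
    by (rule compact_imp_seq_compact)
  from seq_compactE[OF this, of "\<lambda>n. (\<nu> n, \<tau> n)"] in_K
  obtain l s where l: "l \<in> sphere 0 1 \<times> {0..K / \<delta>}" and s: "strict_mono s"
    and lim: "((\<lambda>n. (\<nu> n, \<tau> n)) \<circ> s) \<longlonglongrightarrow> l"
    by blast
  obtain \<nu>0 \<tau>0 where l_def: "l = (\<nu>0, \<tau>0)"
    by fastforce
  have \<nu>_lim: "(\<lambda>n. \<nu> (s n)) \<longlonglongrightarrow> \<nu>0" and \<tau>_lim: "(\<lambda>n. \<tau> (s n)) \<longlonglongrightarrow> \<tau>0"
    using tendsto_fst[OF lim] tendsto_snd[OF lim] by (auto simp: l_def comp_def)
  have \<nu>0: "norm \<nu>0 = 1" "\<tau>0 \<ge> 0"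
    using l by (auto simp: l_def)
  have conic: "(y, t *\<^sub>R \<zeta>) \<in> L" if "(y, \<zeta>) \<in> L" "t > 0" for y \<zeta> t
    using L that by (auto simp: closed_conic_def)
  have "(\<lambda>n. adjoint f (\<nu> (s n))) \<longlonglongrightarrow> adjoint f \<nu>0"
    by (rule bounded_linear.tendsto[OF _ \<nu>_lim]) (use adj linear_conv_bounded_linear in blast)
  moreover have "(\<lambda>n. adjoint f (\<nu> (s n))) \<longlonglongrightarrow> \<tau>0 *\<^sub>R \<xi>0"
  proof -
    have "(\<lambda>n. \<tau> (s n) *\<^sub>R adjoint f (\<eta> (s n))) \<longlonglongrightarrow> \<tau>0 *\<^sub>R \<xi>0"
      using LIMSEQ_subseq_LIMSEQ[OF \<eta>_lim s] by (intro tendsto_scaleR \<tau>_lim) (simp add: comp_def)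
    then show ?thesis
      by (simp add: \<nu>_def linear_scale[OF adj])
  qed
  ultimately have adj_\<nu>0: "adjoint f \<nu>0 = \<tau>0 *\<^sub>R \<xi>0"
    by (rule LIMSEQ_unique)
  obtain C where C: "closed C" "L = UNIV \<times> (UNIV - {0}) \<inter> C"
    using L unfolding closed_conic_def closedin_closed by blast
  have "(f (x (s n)), \<nu> (s n)) \<in> L" for n
    unfolding \<nu>_def using conic[OF in_L] \<eta>_pos by (simp add: \<tau>_def)
  then have "(f (x (s n)), \<nu> (s n)) \<in> C" for n
    unfolding C(2) by blast
  moreover have "(\<lambda>n. (f (x (s n)), \<nu> (s n))) \<longlonglongrightarrow> (f 0, \<nu>0)"
    using LIMSEQ_subseq_LIMSEQ[OF x_lim s] f
    by (intro tendsto_Pair \<nu>_lim bounded_linear.tendsto[of f])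
      (auto simp: comp_def linear_conv_bounded_linear)
  ultimately have "(f 0, \<nu>0) \<in> C"
    by (rule closed_sequentially[OF C(1)])
  then have limit_in_L: "(f 0, \<nu>0) \<in> L"
    using \<nu>0(1) by (auto simp: C(2))
  show False
  proof (cases "\<tau>0 = 0")
    case True
    then have "(f 0, \<nu>0) \<in> conormals f"
      using adj_\<nu>0 unfolding conormals_def deriv by auto
    then show False
      using limit_in_L assms(3) by blast
  next
    case False
    then have "adjoint f (inverse \<tau>0 *\<^sub>R \<nu>0) = \<xi>0"
      by (simp add: linear_scale[OF adj] adj_\<nu>0)
    moreover have "(0, inverse \<tau>0 *\<^sub>R \<nu>0) \<in> L"
      using conic[OF limit_in_L, of "inverse \<tau>0"] False \<nu>0(2) by (simp add: linear_0[OF f])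
    ultimately show False
      using avoid by blast
  qed
qed

lemma pullback_cone_conic:
  assumes f: "linear f" and L: "closed_conic L" and "(x, \<xi>) \<in> pullback_cone f L" "t > 0"
  shows "(x, t *\<^sub>R \<xi>) \<in> pullback_cone f L"
proof -
  have "frechet_derivative f (at x) = f"
    using frechet_derivative_at[OF bounded_linear_imp_has_derivative] f
    by (metis linear_conv_bounded_linear)
  then obtain \<eta> where "\<xi> = adjoint f \<eta>" "(f x, \<eta>) \<in> L"
    using assms(3) by (auto simp: pullback_cone_def)
  then have "t *\<^sub>R \<xi> = adjoint f (t *\<^sub>R \<eta>)" "(f x, t *\<^sub>R \<eta>) \<in> L"
    using L assms(4) linear_scale[OF adjoint_linear[OF f]] by (auto simp: closed_conic_def)
  with \<open>frechet_derivative f (at x) = f\<close> show ?thesis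
    unfolding pullback_cone_def by force
qed

text \<open>The index types carry no order; the enumerations \<open>d\<close> and \<open>e\<close>
  give meaning to the first \<open>k\<close> coordinates. The vector \<open>\<eta>0\<close> is a
  function on all naturals that is read only on \<open>{1..k}\<close>.\<close>

theorem propositionA1:
  fixes k :: nat
    and d :: "nat \<Rightarrow> 'm::finite"
    and e :: "nat \<Rightarrow> 'n::finite"
    and f :: "real^'m \<Rightarrow> real^'n"
  assumes "bij_betw d {1..CARD('m)} UNIV"
    and "bij_betw e {1..CARD('n)} UNIV"
    and "0 < k" and "k \<le> CARD('m)" and "k < CARD('n)"
    and "\<And>x. f x = (\<Sum>j = 1..k. (x $ d j) *\<^sub>R axis (e j) 1)"
  shows
    "(\<forall>r2 :: real. r2 < (real CARD('n) - real k) / 2 \<longrightarrow>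
        \<not> pullback_extends f (local_sobolev_topology r2) distribution_topology)
   \<and> (\<forall>(r1 :: real) (r2 :: real) (L' :: ((real^'m) \<times> (real^'m)) set).
        r2 - r1 < (real CARD('n) - real k) / 2 \<longrightarrow>
        closed_conic L' \<longrightarrow>
        ({0} \<times> ({\<xi>. \<forall>j\<in>{k<..CARD('m)}. \<xi> $ d j = 0} - {0})) - L' \<noteq> {} \<longrightarrow>
        \<not> pullback_extends f (local_sobolev_topology r2) (wave_front_topology r1 L'))
   \<and> (\<forall>(r1 :: real) (r2 :: real) (L :: ((real^'n) \<times> (real^'n)) set).
        r2 - r1 < (real CARD('n) - real k) / 2 \<longrightarrow>
        closed_conic L \<longrightarrow>
        L \<inter> conormals f = {} \<longrightarrow>
        (\<exists>\<eta>0 :: nat \<Rightarrow> real. (\<exists>j\<in>{1..k}. \<eta>0 j \<noteq> 0) \<and>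
           ({0} \<times> {\<eta>. \<forall>j\<in>{1..k}. \<eta> $ e j = \<eta>0 j}) \<inter> L = {}) \<longrightarrow>
        \<not> pullback_extends f (wave_front_topology r2 L) (wave_front_topology r1 (pullback_cone f L)))"
proof -
  note d_bij = assms(1) and e_bij = assms(2) and f_def = assms(6)
  define J where "J = - (e ` {1..k})"
  have inj_e: "inj_on e {1..CARD('n)}" and inj_d: "inj_on d {1..CARD('m)}"
    using d_bij e_bij by (auto simp: bij_betw_def)
  have e_inj: "e i = e j \<longleftrightarrow> i = j" if "i \<in> {1..k}" "j \<in> {1..k}" for i j
    using that assms(5) inj_on_eq_iff[OF inj_e, of i j] by auto
  have card_J: "real (card J) = real CARD('n) - real k"
  proof -
    have "card (e ` {1..k}) = k"
      using e_inj by (subst card_image) (auto simp: inj_on_def)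
    moreover have "card J = CARD('n) - card (e ` {1..k})"
      unfolding J_def Compl_eq_Diff_UNIV by (rule card_Diff_subset) auto
    ultimately show ?thesis
      using assms(5) by simp
  qed
  have lin: "linear f"
    unfolding f_def
    by (intro linearI) (simp_all add: algebra_simps sum.distrib scaleR_sum_right)
  have f_e: "f x $ e j = x $ d j" if j: "j \<in> {1..k}" for x j
  proof -
    have "f x $ e j = (\<Sum>i = 1..k. if i = j then x $ d i else 0)"
      unfolding f_def sum_component by (rule sum.cong) (use j e_inj in \<open>auto simp: axis_def\<close>)
    then show ?thesis
      using j by simp
  qed
  have f0: "f x $ i = 0" if "i \<in> J" for x i
    using that unfolding f_def sum_component J_def by (intro sum.neutral) (auto simp: axis_def)
  have inner_f: "f x \<bullet> \<eta> = (\<Sum>j = 1..k. x $ d j * \<eta> $ e j)" for x \<eta>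
    unfolding f_def by (simp add: inner_sum_left inner_axis')
  have inner_d: "x \<bullet> \<xi> = (\<Sum>j = 1..k. x $ d j * \<xi> $ d j)"
    if \<xi>: "\<And>j. j \<in> {k<..CARD('m)} \<Longrightarrow> \<xi> $ d j = 0" for x \<xi>
  proof -
    have "x \<bullet> \<xi> = (\<Sum>j\<in>{1..CARD('m)}. x $ d j * \<xi> $ d j)"
      unfolding inner_vec_def using sum.reindex_bij_betw[OF d_bij, of "\<lambda>i. x $ i * \<xi> $ i"] by simp
    also have "\<dots> = (\<Sum>j = 1..k. x $ d j * \<xi> $ d j)"
      using assms(4) \<xi> by (intro sum.mono_neutral_right) auto
    finally show ?thesis .
  qed
  \<comment> \<open>On vectors supported in the first \<open>k\<close> coordinates \<open>f\<close>
    is an isometry, so \<open>f \<xi>\<close> is a frequency in \<open>real^'n\<close> that pulls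
    back to \<xi>; by \<open>f0\<close> it vanishes on \<open>J\<close>.\<close>
  have dual: "f x \<bullet> f \<xi> = x \<bullet> \<xi>" if "\<And>j. j \<in> {k<..CARD('m)} \<Longrightarrow> \<xi> $ d j = 0" for x \<xi>
  proof -
    have "f x \<bullet> f \<xi> = (\<Sum>j = 1..k. x $ d j * \<xi> $ d j)"
      unfolding inner_f by (intro sum.cong) (auto simp: f_e)
    also have "\<dots> = x \<bullet> \<xi>"
      by (rule inner_d[symmetric]) (rule that)
    finally show ?thesis .
  qed
  have f_nonzero: "f \<xi> \<noteq> 0" if "\<And>j. j \<in> {k<..CARD('m)} \<Longrightarrow> \<xi> $ d j = 0" "\<xi> \<noteq> 0" for \<xi>
    using dual[OF that(1), of \<xi>] that(2) by auto
  have part1: "\<not> pullback_extends f (local_sobolev_topology r2) distribution_topology"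
    if r2: "r2 < (real CARD('n) - real k) / 2" for r2 :: real
  proof
    assume ext: "pullback_extends f (local_sobolev_topology r2) distribution_topology"
    \<comment> \<open>The exponent is \<open>2 * max r2 0 - card J\<close>: negative for
      \<open>r2 \<le> 0\<close> because \<open>k < CARD('n)\<close>, and otherwise by the bound on
      \<open>r2\<close>.\<close>
    have "limitin (local_sobolev_topology r2) (\<lambda>n. dist_of_fun (peak J (0 :: real^'n) 0 n)) zero_dist sequentially"
      using r2 assms(5) by (intro limitin_local_sobolev_peak[where r' = "max r2 0"]) (auto simp: card_J max_def)
    from pullback_limit[where \<xi> = 0, OF ext f0 _ _ this] show False
      using not_limitin_distribution_topology[where 'm = 'm] by simp
  qed
  have part2: "\<not> pullback_extends f (local_sobolev_topology r2) (wave_front_topology r1 L')"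
    if r: "r2 - r1 < (real CARD('n) - real k) / 2" and L': "closed_conic L'"
      and ne: "({0} \<times> ({\<xi>. \<forall>j\<in>{k<..CARD('m)}. \<xi> $ d j = 0} - {0})) - L' \<noteq> {}"
    for r1 r2 :: real and L' :: "((real^'m) \<times> (real^'m)) set"
  proof
    assume ext: "pullback_extends f (local_sobolev_topology r2) (wave_front_topology r1 L')"
    obtain \<xi>0 where \<xi>0: "\<And>j. j \<in> {k<..CARD('m)} \<Longrightarrow> \<xi>0 $ d j = 0" "\<xi>0 \<noteq> 0" "(0, \<xi>0) \<notin> L'"
      using ne by blast
    \<comment> \<open>For \<open>b = - r1\<close> the exponent
      \<open>2 * b - card J + 2 * r2\<close> is negative exactly when \<open>r2 - r1\<close> is
      below the threshold.\<close>
    have "limitin (local_sobolev_topology r2) (\<lambda>n. dist_of_fun (peak J (f \<xi>0) (- r1) n)) zero_dist sequentially"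
      using r f_nonzero[OF \<xi>0(1,2)] f0
      by (intro limitin_local_sobolev_peak[where r' = r2]) (auto simp: card_J)
    from pullback_limit[OF ext f0 f0 dual[OF \<xi>0(1)] this]
    have lim: "limitin (wave_front_topology r1 L') (\<lambda>n. dist_of_fun (scaled_wave (- r1) \<xi>0 n)) zero_dist sequentially"
      by simp
    have nonzero: "(x, 0) \<notin> L'" for x
      using L' closedin_subset unfolding closed_conic_def by fastforce
    obtain C where C: "closed C" "L' = UNIV \<times> (UNIV - {0}) \<inter> C"
      using L' unfolding closed_conic_def closedin_closed by blast
    have "(0, \<xi>0) \<in> - C" "open (- C)"
      using C \<xi>0 by auto
    then obtain \<delta> where \<delta>: "\<delta> > 0" "ball (0, \<xi>0) \<delta> \<subseteq> - C"
      by (meson open_contains_ball)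
    \<comment> \<open>Thirds, since two non-strict bounds have to add up to less than
      \<delta>.\<close>
    have nbhd: "(x, \<xi>) \<notin> L'" if "norm x \<le> \<delta> / 3" "norm (\<xi> - \<xi>0) \<le> \<delta> / 3" for x \<xi>
    proof -
      have "dist (0, \<xi>0) (x, \<xi>) \<le> dist 0 x + dist \<xi>0 \<xi>"
        unfolding dist_Pair_Pair by (rule sqrt_sum_squares_le_sum) auto
      also have "\<dots> < \<delta>"
        using that \<delta>(1) by (simp add: dist_norm norm_minus_commute)
      finally show ?thesis
        using \<delta>(2) C(2) by auto
    qed
    have conic: "(x, t *\<^sub>R \<xi>) \<in> L'" if "(x, \<xi>) \<in> L'" "t > 0" for x \<xi> t
      using L' that unfolding closed_conic_def by blast
    show False
      using not_limitin_wave_front_topology[of L' \<xi>0 "\<delta> / 3" r1, OF conic nonzero \<xi>0(2) _ nbhd] lim \<delta>(1)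
      by simp
  qed
  have part3: "\<not> pullback_extends f (wave_front_topology r2 L) (wave_front_topology r1 (pullback_cone f L))"
    if r: "r2 - r1 < (real CARD('n) - real k) / 2" and L: "closed_conic L" "L \<inter> conormals f = {}"
      and avoid: "\<exists>\<eta>0 :: nat \<Rightarrow> real. (\<exists>j\<in>{1..k}. \<eta>0 j \<noteq> 0) \<and>
           ({0} \<times> {\<eta>. \<forall>j\<in>{1..k}. \<eta> $ e j = \<eta>0 j}) \<inter> L = {}"
    for r1 r2 :: real and L :: "((real^'n) \<times> (real^'n)) set"
  proof
    assume ext: "pullback_extends f (wave_front_topology r2 L) (wave_front_topology r1 (pullback_cone f L))"
    obtain \<eta>0 :: "nat \<Rightarrow> real" and j0 where j0: "j0 \<in> {1..k}" "\<eta>0 j0 \<noteq> 0"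
      and \<eta>0: "({0} \<times> {\<eta>. \<forall>j\<in>{1..k}. \<eta> $ e j = \<eta>0 j}) \<inter> L = {}"
      using avoid by blast
    have d_inj: "d i = d j \<longleftrightarrow> i = j" if "i \<in> {1..CARD('m)}" "j \<in> {1..CARD('m)}" for i j
      using that inj_on_eq_iff[OF inj_d] by blast
    define \<xi>0 :: "real^'m" where "\<xi>0 = (\<Sum>j = 1..k. \<eta>0 j *\<^sub>R axis (d j) 1)"
    have \<xi>0_d: "\<xi>0 $ d j = (if j \<le> k then \<eta>0 j else 0)" if j: "j \<in> {1..CARD('m)}" for j
    proof -
      have "\<xi>0 $ d j = (\<Sum>i = 1..k. if i = j then \<eta>0 i else 0)"
        unfolding \<xi>0_def sum_component
        by (rule sum.cong) (use j d_inj assms(4) in \<open>auto simp: axis_def\<close>)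
      then show ?thesis
        using j by simp
    qed
    have \<xi>0: "\<And>j. j \<in> {k<..CARD('m)} \<Longrightarrow> \<xi>0 $ d j = 0" "\<xi>0 \<noteq> 0"
    proof -
      show "\<xi>0 $ d j = 0" if "j \<in> {k<..CARD('m)}" for j
        using \<xi>0_d[of j] that by simp
      have "\<xi>0 $ d j0 \<noteq> 0"
        using \<xi>0_d[of j0] j0 assms(4) by simp
      then show "\<xi>0 \<noteq> 0"
        by auto
    qed
    have adj: "adjoint f \<eta> $ d j = \<eta> $ e j" if j: "j \<in> {1..k}" for \<eta> j
    proof -
      have "adjoint f \<eta> $ d j = axis (d j) 1 \<bullet> adjoint f \<eta>"
        by (simp add: inner_axis')
      also have "\<dots> = f (axis (d j) 1) \<bullet> \<eta>"
        by (rule adjoint_works[OF lin])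
      also have "\<dots> = (\<Sum>i = 1..k. if i = j then \<eta> $ e i else 0)"
        unfolding inner_f by (rule sum.cong) (use j d_inj assms(4) in \<open>auto simp: axis_def\<close>)
      finally show ?thesis
        using j by simp
    qed
    \<comment> \<open>The transpose of \<open>f\<close> reads off the first \<open>k\<close>
      coordinates, so every preimage of \<open>\<xi>0\<close> lies in the slice that
      \<open>L\<close> avoids over 0.\<close>
    have "(0, \<eta>) \<notin> L" if "adjoint f \<eta> = \<xi>0" for \<eta>
      using \<eta>0 adj[of _ \<eta>] \<xi>0_d that assms(4) by fastforce
    from pullback_cone_nbhd[OF lin L \<xi>0(2) this]
    obtain \<epsilon> where \<epsilon>: "\<epsilon> > 0" "\<And>x \<xi>. norm x \<le> \<epsilon> \<Longrightarrow> norm (\<xi> - \<xi>0) \<le> \<epsilon> \<Longrightarrow> (x, \<xi>) \<notin> pullback_cone f L"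
      by blast
    \<comment> \<open>A covector of \<open>L\<close> with zero pullback would be conormal.\<close>
    have nonzero: "(x, 0) \<notin> pullback_cone f L" for x
      using L(2) unfolding pullback_cone_def conormals_def by force
    have "limitin (wave_front_topology r2 L) (\<lambda>n. dist_of_fun (peak J (f \<xi>0) (- r1) n)) zero_dist sequentially"
      using r f_nonzero[OF \<xi>0] f0 by (intro limitin_wave_front_peak) (auto simp: card_J)
    from pullback_limit[OF ext f0 f0 dual[OF \<xi>0(1)] this]
    have "limitin (wave_front_topology r1 (pullback_cone f L)) (\<lambda>n. dist_of_fun (scaled_wave (- r1) \<xi>0 n))
        zero_dist sequentially"
      by simp
    with not_limitin_wave_front_topology[of "pullback_cone f L" \<xi>0 \<epsilon> r1,
          OF pullback_cone_conic[OF lin L(1)] nonzero \<xi>0(2) \<epsilon>]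
    show False
      by simp
  qed
  show ?thesis
    by (intro conjI allI impI; (rule part1 | rule part2 | rule part3); assumption)
qed

end
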